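(* Let $p$ be an odd prime, $F$ a field of characteristic $p$ and $G$ a finite $p$-group of nilpotency class $2$ with cyclic center. If $H$ is a group such that the group algebras $FG$ and $FH$ are isomorphic (as $F$-algebras), then the groups $G$ and $H$ are isomorphic.
   Context: $FG$ denotes the group algebra of $G$ over $F$. Nilpotency class $2$ means class exactly $2$ (so the group is not abelian). *)

theory Defs
  imports
    "HOL-Algebra.Algebra"
    "HOL-Library.Poly_Mapping"
begin

definition group_center :: "('g, 'm) monoid_scheme \<Rightarrow> 'g set" where
  "group_center G = {z \<in> carrier G. \<forall>x \<in> carrier G. z \<otimes>\<^bsub>G\<^esub> x = x \<otimes>\<^bsub>G\<^esub> z}"

definition commutator_subgroup :: "('g, 'm) monoid_scheme \<Rightarrow> 'g set \<Rightarrow> 'g set \<Rightarrow> 'g set" where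
  "commutator_subgroup G H K =
     generate G (\<Union>h \<in> H. \<Union>k \<in> K. {h \<otimes>\<^bsub>G\<^esub> k \<otimes>\<^bsub>G\<^esub> inv\<^bsub>G\<^esub> h \<otimes>\<^bsub>G\<^esub> inv\<^bsub>G\<^esub> k})"

(* Indexing starts at 0: lower_central_series G n is the term usually written gamma_(n+1)(G). *)
primrec lower_central_series :: "('g, 'm) monoid_scheme \<Rightarrow> nat \<Rightarrow> 'g set" where
  "lower_central_series G 0 = carrier G"
| "lower_central_series G (Suc n) =
     commutator_subgroup G (lower_central_series G n) (carrier G)"

(* Class exactly c, not at most c. *)
definition has_nilpotency_class :: "('g, 'm) monoid_scheme \<Rightarrow> nat \<Rightarrow> bool" where
  "has_nilpotency_class G c \<longleftrightarrow>
     lower_central_series G c = {\<one>\<^bsub>G\<^esub>} \<and>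
     (\<forall>m<c. lower_central_series G m \<noteq> {\<one>\<^bsub>G\<^esub>})"

definition finite_p_group :: "nat \<Rightarrow> ('g, 'm) monoid_scheme \<Rightarrow> bool" where
  "finite_p_group p G \<longleftrightarrow> group G \<and> finite (carrier G) \<and> (\<exists>n. order G = p ^ n)"

(* The coefficient field is the whole type 'f, passed as the argument TYPE('f).  Elements are
   the finitely supported functions from 'g to 'f whose support lies in the carrier of G, so
   that infinite groups are covered as well; the product is the bilinear extension of the
   product of G. *)
definition group_algebra ::
  "'f::field itself \<Rightarrow> ('g, 'm) monoid_scheme \<Rightarrow> ('f, 'g \<Rightarrow>\<^sub>0 'f) module" where
  "group_algebra F G =
     \<lparr> carrier = {a. Poly_Mapping.keys a \<subseteq> carrier G},
       monoid.mult = (\<lambda>a b. \<Sum>x \<in> Poly_Mapping.keys a. \<Sum>y \<in> Poly_Mapping.keys b.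
                 Poly_Mapping.single (x \<otimes>\<^bsub>G\<^esub> y)
                   (Poly_Mapping.lookup a x * Poly_Mapping.lookup b y)),
       one = Poly_Mapping.single \<one>\<^bsub>G\<^esub> 1,
       ring.zero = 0,
       add = (+),
       smult = (\<lambda>c a. Poly_Mapping.map ((*) c) a) \<rparr>"

(* HOL-Algebra's ring isomorphisms are unital; its locale algebra is restricted to commutative
   algebras and so is not used here. *)
definition algebra_iso ::
  "('f::field, 'a, 'm) module_scheme \<Rightarrow> ('f, 'b, 'n) module_scheme \<Rightarrow> ('a \<Rightarrow> 'b) set" where
  "algebra_iso A B =
     {h \<in> ring_iso A B. \<forall>c. \<forall>a \<in> carrier A. h (c \<odot>\<^bsub>A\<^esub> a) = c \<odot>\<^bsub>B\<^esub> h a}"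

definition is_algebra_iso ::
  "('f::field, 'a, 'm) module_scheme \<Rightarrow> ('f, 'b, 'n) module_scheme \<Rightarrow> bool" where
  "is_algebra_iso A B \<longleftrightarrow> algebra_iso A B \<noteq> {}"

end

theory Submission
  imports Defs "HOL-Number_Theory.Cong"
begin

text \<open>
Let \<open>Z = \<langle>z\<rangle>\<close> be the centre of \<open>G\<close>, of order \<open>p^n\<close>. Two functions on \<open>G\<close> with values modulo
\<open>p^n\<close> describe the group: the commutator pairing \<open>w x y = log_z [x, y]\<close>, which is a nondegenerate
alternating form on \<open>G/Z\<close>, and \<open>\<chi> x = log_z (x^(p^n))\<close>, which is a homomorphism on \<open>G/Z\<close> because
\<open>p\<close> is odd and the class is 2. The proof has three parts.

\<^item> The form and the character determine the group (\<open>iso_of_isometry\<close>). Suppose an isomorphism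
\<open>G/Z(G) \<rightarrow> H/Z(H)\<close> respects \<open>w\<close> and \<open>\<chi>\<close>, and let \<open>K \<le> G \<times> H\<close> be the group of pairs whose classes
correspond. The homomorphism \<open>(z^a, z'^b) \<mapsto> b - a\<close> on \<open>Z(G) \<times> Z(H)\<close> kills all commutators and all
\<open>p^n\<close>-th powers of \<open>K\<close>, exactly because \<open>w\<close> and \<open>\<chi>\<close> are respected. It therefore extends to \<open>K\<close>
(\<open>extend_hom_mod\<close>), and the kernel of the extension is the graph of an isomorphism.

\<^item> The form and the character are determined by numerical data (\<open>isometry_exists\<close>). Write
\<open>T_k\<close> for the set of \<open>x\<close> with \<open>p^k w(x, _) = 0\<close>, the preimage of the \<open>p^k\<close>-torsion of \<open>G/Z\<close>. An isometry
that respects \<open>\<chi>\<close> exists as soon as the orders of all \<open>T_k\<close> agree, and for all \<open>k\<close> and \<open>l\<close> the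
statement "\<open>p^l \<chi>\<close> vanishes on \<open>T_k\<close>" has the same truth value on both sides. The induction splits
off a hyperbolic plane of maximal order on which \<open>\<chi>\<close> takes a normal form. On the orthogonal
complement only the restriction of \<open>\<chi>\<close> to a certain torsion subgroup matters, since everything
beyond it can be absorbed by shearing the complement along the plane (\<open>extend_isometry\<close>); so the
statement is proved with a bound \<open>k \<le> l + e\<close> on the data, where \<open>e\<close> decreases in the induction.

\<^item> The group algebra knows these data. For a normal subgroup \<open>N\<close> let \<open>I_N\<close> be the kernel of
\<open>FG \<rightarrow> F[G/N]\<close>. An isomorphism of group algebras maps \<open>I_{G'}\<close> to \<open>I_{H'}\<close>, and when \<open>G'\<close> and \<open>H'\<close> are
central and cyclic it also matches the ideals of their subgroups (\<open>matched_generate_pow\<close>). Over a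
\<open>p\<close>-group the centre of \<open>F[G/N]\<close> is, modulo additive commutators, spanned by the central elements of
\<open>G/N\<close>: the other class sums are sums of \<open>p^i\<close> conjugate elements and hence vanish there. This yields
the orders of the preimages of the centres of \<open>G/N\<close> (\<open>card_center_mod_cosets\<close>), which are the \<open>T_k\<close>
when \<open>N\<close> runs over the subgroups of \<open>G'\<close>. Modulo commutators the map \<open>v \<mapsto> v^(p^k)\<close> is the Frobenius
map on coefficients combined with the power map of the group (\<open>tr_p_power_map\<close>), so the algebra also
decides whether a fixed \<open>p\<close>-power kills the preimage of a centre (\<open>center_mod_power_transfer\<close>); on \<open>T_k\<close>
this is the vanishing of \<open>p^l \<chi>\<close>.

The same counts give what is needed about \<open>H\<close> itself: the order of \<open>Z(H) H'\<close> forces \<open>H' \<le> Z(H)\<close>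
(\<open>derived_central_transfer\<close>), and the exponent of \<open>Z(H)\<close> makes it cyclic.
\<close>


section \<open>Counting arguments in characteristic p\<close>

lemma (in group) inv_mult_cancel:
  assumes "x \<in> carrier G" "y \<in> carrier G"
  shows "inv x \<otimes> (x \<otimes> y) = y" "x \<otimes> (inv x \<otimes> y) = y"
  using assms by (simp_all add: m_assoc[symmetric])

text \<open>A matrix whose rows are linearly independent has at most as many rows as columns;
  the proof is Gaussian elimination of one column. It compares two group algebras through the
  coefficients of finitely many elements, without a vector space structure on either of them.\<close>

lemma steinitz_functions:
  fixes a :: "'t \<Rightarrow> 's \<Rightarrow> 'f::field"
  assumes "finite S" "finite T"
    and "\<And>c. (\<And>s. s \<in> S \<Longrightarrow> (\<Sum>t\<in>T. c t * a t s) = 0) \<Longrightarrow> (\<forall>t\<in>T. c t = 0)"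
  shows "card T \<le> card S"
  using assms
proof (induction S arbitrary: T a rule: finite_induct)
  case empty
  have "\<forall>t\<in>T. (1::'f) = 0" using empty(2)[of "\<lambda>_. 1"] by simp
  then show ?case by auto
next
  case (insert s0 S)
  show ?case
  proof (cases "\<forall>t\<in>T. a t s0 = 0")
    case True
    have "card T \<le> card S"
    proof (rule insert.IH[of _ a])
      fix c assume "\<And>s. s \<in> S \<Longrightarrow> (\<Sum>t\<in>T. c t * a t s) = 0"
      moreover have "(\<Sum>t\<in>T. c t * a t s0) = 0" using True by simp
      ultimately show "\<forall>t\<in>T. c t = 0" using insert.prems(2)[of c] by blast
    qed (fact insert.prems)
    then show ?thesis using insert.hyps by simp
  next
    case False
    then obtain t0 where t0: "t0 \<in> T" "a t0 s0 \<noteq> 0" by blast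
    define b where "b t s = a t s - a t s0 / a t0 s0 * a t0 s" for t s
    have "card (T - {t0}) \<le> card S"
    proof (rule insert.IH[of _ b])
      show "finite (T - {t0})" using insert.prems by simp
      fix c assume c: "\<And>s. s \<in> S \<Longrightarrow> (\<Sum>t\<in>T-{t0}. c t * b t s) = 0"
      define r where "r = (\<Sum>t\<in>T-{t0}. c t * (a t s0 / a t0 s0))"
      define d where "d t = (if t = t0 then - r else c t)" for t
      have sumd: "(\<Sum>t\<in>T. d t * a t s) = - r * a t0 s + (\<Sum>t\<in>T-{t0}. c t * a t s)" for s
        by (subst sum.remove[OF insert.prems(1) t0(1)]) (simp add: d_def)
      have sumb: "(\<Sum>t\<in>T. d t * a t s) = (\<Sum>t\<in>T-{t0}. c t * b t s)" for s
        unfolding sumd b_def r_def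
        by (simp add: right_diff_distrib sum_subtractf sum_distrib_right mult.assoc)
      have "\<forall>t\<in>T. d t = 0"
      proof (rule insert.prems(2))
        fix s assume "s \<in> insert s0 S"
        then show "(\<Sum>t\<in>T. d t * a t s) = 0"
          using c[of s] sumb[of s] t0(2) by (auto simp: b_def)
      qed
      then show "\<forall>t\<in>T-{t0}. c t = 0" by (auto simp: d_def split: if_splits)
    qed
    then show ?thesis using insert.hyps insert.prems(1) t0(1) by simp
  qed
qed

text \<open>An orbit with more than one point has a positive power of \<open>p\<close> as its
  length, so an invariant function sums to zero over it. The two applications are the
  conjugation action of the group on cosets and the rotation of words.\<close>

lemma (in group_action) sum_invariant_eq_sum_fixed:
  fixes f :: "_ \<Rightarrow> 'f::field"
  assumes p: "Factorial_Ring.prime p" and char: "CHAR('f) = p"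
    and ord: "order G = p ^ n" and finE: "finite E"
    and inv: "\<And>g x. g \<in> carrier G \<Longrightarrow> x \<in> E \<Longrightarrow> f (\<phi> g x) = f x"
  shows "sum f E = sum f {x\<in>E. \<forall>g\<in>carrier G. \<phi> g x = x}"
proof -
  have orbsum: "(\<Sum>y\<in>orbit G \<phi> x. f y) = (if orbit G \<phi> x = {x} then f x else 0)" if "x \<in> E" for x
  proof -
    have cst: "f y = f x" if "y \<in> orbit G \<phi> x" for y
      using that inv \<open>x \<in> E\<close> by (auto simp: orbit_def)
    then have eq: "(\<Sum>y\<in>orbit G \<phi> x. f y) = of_nat (card (orbit G \<phi> x)) * f x" by simp
    have "card (orbit G \<phi> x) dvd p ^ n"
      using orbit_stabilizer_theorem[OF that] ord by (metis dvd_triv_left)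
    then obtain k where k: "card (orbit G \<phi> x) = p ^ k"
      using p divides_primepow_nat by blast
    show ?thesis
    proof (cases "k = 0")
      case True
      then have "card (orbit G \<phi> x) = 1" using k by simp
      moreover have "x \<in> orbit G \<phi> x" using orbit_refl that by blast
      ultimately have "orbit G \<phi> x = {x}" by (metis card_1_singletonE singletonD)
      then show ?thesis by simp
    next
      case False
      then have "p ^ k > 1" using one_less_power[OF prime_gt_1_nat[OF p], of k] False by simp
      then have "orbit G \<phi> x \<noteq> {x}" using k by (auto dest: arg_cong[where f = card])
      moreover have "of_nat (card (orbit G \<phi> x)) = (0::'f)"
        using k False char by (metis dvd_power of_nat_CHAR dvd_def of_nat_mult mult_zero_left gr0I)
      ultimately show ?thesis using eq by simp
    qed
  qed
  define Fx where "Fx = {x\<in>E. \<forall>g\<in>carrier G. \<phi> g x = x}"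
  have one: "\<one> \<in> carrier G" using group_hom group_hom.axioms(1) group.is_monoid monoid.one_closed by blast
  have Fx: "x \<in> Fx \<longleftrightarrow> orbit G \<phi> x = {x}" if "x \<in> E" for x
  proof
    assume "x \<in> Fx"
    then have "\<phi> g x = x" if "g \<in> carrier G" for g using that by (auto simp: Fx_def)
    then show "orbit G \<phi> x = {x}" using one unfolding orbit_def by force
  qed (use that in \<open>auto simp: Fx_def orbit_def\<close>)
  have "sum f E = (\<Sum>ob\<in>orbits G E \<phi>. \<Sum>x\<in>ob. f x)"
    using disjoint_sum[OF finE, of f] by simp
  also have "\<dots> = (\<Sum>ob\<in>orbits G E \<phi>. \<Sum>x\<in>ob. if x \<in> Fx then f x else 0)"
  proof (rule sum.cong[OF refl])
    fix ob assume "ob \<in> orbits G E \<phi>"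
    then obtain x where x: "x \<in> E" "ob = orbit G \<phi> x" by (auto simp: orbits_def)
    show "(\<Sum>x\<in>ob. f x) = (\<Sum>x\<in>ob. if x \<in> Fx then f x else 0)"
    proof (cases "orbit G \<phi> x = {x}")
      case True
      then show ?thesis using Fx[OF x(1)] x(2) by simp
    next
      case False
      have "y \<notin> Fx" if "y \<in> ob" for y
      proof
        assume y: "y \<in> Fx"
        then have "orbit G \<phi> y = {y}" "y \<in> E" using Fx by (auto simp: Fx_def)
        moreover have "x \<in> orbit G \<phi> y" using orbit_sym[of x y] that x \<open>y \<in> E\<close> by blast
        ultimately show False using False by simp
      qed
      then show ?thesis using orbsum[OF x(1)] False x(2) by simp
    qed
  qed
  also have "\<dots> = (\<Sum>x\<in>E. if x \<in> Fx then f x else 0)"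
    using disjoint_sum[OF finE, of "\<lambda>x. if x \<in> Fx then f x else 0"] by simp
  also have "\<dots> = sum f Fx"
    using finE by (simp add: sum.If_cases Fx_def Collect_conj_eq[symmetric] Int_def)
  finally show ?thesis by (simp add: Fx_def)
qed

section \<open>The group algebra of a finite group\<close>

locale finite_group_algebra = group G for G (structure) +
  fixes F :: "'f::field itself"
  assumes finite_carrier: "finite (carrier G)"
begin

abbreviation "FG \<equiv> group_algebra F G"

lemma carrier_FG: "a \<in> carrier FG \<longleftrightarrow> (\<forall>g. g \<notin> carrier G \<longrightarrow> Poly_Mapping.lookup a g = 0)"
  by (auto simp: group_algebra_def in_keys_iff subset_iff)

lemma lookup_outside: "a \<in> carrier FG \<Longrightarrow> g \<notin> carrier G \<Longrightarrow> Poly_Mapping.lookup a g = 0"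
  by (simp add: carrier_FG)

lemma one_FG: "\<one>\<^bsub>FG\<^esub> = Poly_Mapping.single \<one> 1"
  and zero_FG: "\<zero>\<^bsub>FG\<^esub> = 0"
  and add_FG: "a \<oplus>\<^bsub>FG\<^esub> b = a + b"
  and smult_FG: "c \<odot>\<^bsub>FG\<^esub> a = Poly_Mapping.map ((*) c) a"
  by (simp_all add: group_algebra_def)

lemma lookup_smult: "Poly_Mapping.lookup (c \<odot>\<^bsub>FG\<^esub> a) g = c * Poly_Mapping.lookup a g"
  by (simp add: smult_FG Poly_Mapping.map.rep_eq when_def)

lemma mult_FG:
  assumes "a \<in> carrier FG" "b \<in> carrier FG"
  shows "a \<otimes>\<^bsub>FG\<^esub> b = (\<Sum>x\<in>carrier G. \<Sum>y\<in>carrier G.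
    Poly_Mapping.single (x \<otimes> y) (Poly_Mapping.lookup a x * Poly_Mapping.lookup b y))"
proof -
  have k: "Poly_Mapping.keys a \<subseteq> carrier G" "Poly_Mapping.keys b \<subseteq> carrier G"
    using assms by (auto simp: group_algebra_def)
  have "a \<otimes>\<^bsub>FG\<^esub> b = (\<Sum>x\<in>Poly_Mapping.keys a. \<Sum>y\<in>Poly_Mapping.keys b.
    Poly_Mapping.single (x \<otimes> y) (Poly_Mapping.lookup a x * Poly_Mapping.lookup b y))"
    by (simp add: group_algebra_def)
  also have "\<dots> = (\<Sum>x\<in>Poly_Mapping.keys a. \<Sum>y\<in>carrier G.
    Poly_Mapping.single (x \<otimes> y) (Poly_Mapping.lookup a x * Poly_Mapping.lookup b y))"
    by (intro sum.cong[OF refl] sum.mono_neutral_left finite_carrier k) (auto simp: in_keys_iff)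
  also have "\<dots> = (\<Sum>x\<in>carrier G. \<Sum>y\<in>carrier G.
    Poly_Mapping.single (x \<otimes> y) (Poly_Mapping.lookup a x * Poly_Mapping.lookup b y))"
    by (intro sum.mono_neutral_left finite_carrier k) (auto simp: in_keys_iff)
  finally show ?thesis .
qed

lemma lookup_mult_FG:
  assumes "a \<in> carrier FG" "b \<in> carrier FG" "g \<in> carrier G"
  shows "Poly_Mapping.lookup (a \<otimes>\<^bsub>FG\<^esub> b) g =
    (\<Sum>x\<in>carrier G. Poly_Mapping.lookup a x * Poly_Mapping.lookup b (inv x \<otimes> g))"
proof -
  have "(\<Sum>y\<in>carrier G. Poly_Mapping.lookup (Poly_Mapping.single (x \<otimes> y) (Poly_Mapping.lookup a x * Poly_Mapping.lookup b y)) g)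
     = Poly_Mapping.lookup a x * Poly_Mapping.lookup b (inv x \<otimes> g)" if x: "x \<in> carrier G" for x
  proof -
    have "(\<Sum>y\<in>carrier G. Poly_Mapping.lookup (Poly_Mapping.single (x \<otimes> y) (Poly_Mapping.lookup a x * Poly_Mapping.lookup b y)) g)
      = (\<Sum>y\<in>carrier G. if inv x \<otimes> g = y then Poly_Mapping.lookup a x * Poly_Mapping.lookup b y else 0)"
      using x assms(3) by (intro sum.cong) (auto simp: lookup_single when_def inv_solve_left m_assoc[symmetric])
    then show ?thesis using x assms(3) finite_carrier by simp
  qed
  then show ?thesis by (simp add: mult_FG[OF assms(1,2)] lookup_sum)
qed

lemma mult_FG_closed:
  assumes "a \<in> carrier FG" "b \<in> carrier FG"
  shows "a \<otimes>\<^bsub>FG\<^esub> b \<in> carrier FG"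
proof -
  have "Poly_Mapping.lookup (a \<otimes>\<^bsub>FG\<^esub> b) g = 0" if "g \<notin> carrier G" for g
    using that unfolding mult_FG[OF assms] lookup_sum
    by (intro sum.neutral ballI) (auto simp: lookup_single when_def)
  then show ?thesis by (simp add: carrier_FG)
qed

lemma FG_eqI:
  assumes "a \<in> carrier FG" "b \<in> carrier FG"
    "\<And>g. g \<in> carrier G \<Longrightarrow> Poly_Mapping.lookup a g = Poly_Mapping.lookup b g"
  shows "a = b"
  using assms by (intro poly_mapping_eqI) (metis carrier_FG)

lemma sum_translate:
  fixes f :: "'a \<Rightarrow> 'f"
  assumes "y \<in> carrier G"
  shows "(\<Sum>x\<in>carrier G. f (y \<otimes> x)) = (\<Sum>x\<in>carrier G. f x)"
  using assms by (intro sum.reindex_bij_witness[of _ "\<lambda>x. inv y \<otimes> x" "\<lambda>x. y \<otimes> x"])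
    (auto simp: m_assoc[symmetric])

lemma single_FG [simp]: "x \<in> carrier G \<Longrightarrow> Poly_Mapping.single x c \<in> carrier FG"
  by (auto simp: carrier_FG lookup_single when_def)

sublocale FG: ring FG
proof (rule ringI)
  show "abelian_group FG"
  proof (rule abelian_groupI)
    fix x assume x: "x \<in> carrier FG"
    show "\<exists>y\<in>carrier FG. y \<oplus>\<^bsub>FG\<^esub> x = \<zero>\<^bsub>FG\<^esub>"
      by (rule bexI[of _ "-x"]) (use x in \<open>auto simp: add_FG zero_FG carrier_FG\<close>)
  qed (auto simp: add_FG zero_FG carrier_FG lookup_add)
  show "Group.monoid FG"
  proof (rule monoidI)
    show "\<one>\<^bsub>FG\<^esub> \<in> carrier FG" by (simp add: one_FG)
    fix a assume a: "a \<in> carrier FG"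
    show "\<one>\<^bsub>FG\<^esub> \<otimes>\<^bsub>FG\<^esub> a = a"
    proof (rule FG_eqI)
      fix g assume g: "g \<in> carrier G"
      have "Poly_Mapping.lookup (\<one>\<^bsub>FG\<^esub> \<otimes>\<^bsub>FG\<^esub> a) g =
        (\<Sum>x\<in>carrier G. if \<one> = x then Poly_Mapping.lookup a (inv x \<otimes> g) else 0)"
        unfolding lookup_mult_FG[OF \<open>\<one>\<^bsub>FG\<^esub> \<in> carrier FG\<close> a g]
        by (intro sum.cong) (auto simp: one_FG lookup_single when_def)
      then show "Poly_Mapping.lookup (\<one>\<^bsub>FG\<^esub> \<otimes>\<^bsub>FG\<^esub> a) g = Poly_Mapping.lookup a g"
        using finite_carrier g by simp
    qed (use a mult_FG_closed \<open>\<one>\<^bsub>FG\<^esub> \<in> carrier FG\<close> in auto)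
    show "a \<otimes>\<^bsub>FG\<^esub> \<one>\<^bsub>FG\<^esub> = a"
    proof (rule FG_eqI)
      fix g assume g: "g \<in> carrier G"
      have "Poly_Mapping.lookup (a \<otimes>\<^bsub>FG\<^esub> \<one>\<^bsub>FG\<^esub>) g =
        (\<Sum>x\<in>carrier G. if g = x then Poly_Mapping.lookup a x else 0)"
        unfolding lookup_mult_FG[OF a \<open>\<one>\<^bsub>FG\<^esub> \<in> carrier FG\<close> g]
        using g by (intro sum.cong)
         (auto simp: one_FG lookup_single when_def, metis inv_equality inv_inv inv_closed)
      then show "Poly_Mapping.lookup (a \<otimes>\<^bsub>FG\<^esub> \<one>\<^bsub>FG\<^esub>) g = Poly_Mapping.lookup a g"
        using finite_carrier g by simp
    qed (use a mult_FG_closed \<open>\<one>\<^bsub>FG\<^esub> \<in> carrier FG\<close> in auto)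
    fix b c assume b: "b \<in> carrier FG" and c: "c \<in> carrier FG"
    show "a \<otimes>\<^bsub>FG\<^esub> b \<otimes>\<^bsub>FG\<^esub> c = a \<otimes>\<^bsub>FG\<^esub> (b \<otimes>\<^bsub>FG\<^esub> c)"
    proof (rule FG_eqI)
      fix g assume g: "g \<in> carrier G"
      have "Poly_Mapping.lookup (a \<otimes>\<^bsub>FG\<^esub> b \<otimes>\<^bsub>FG\<^esub> c) g =
        (\<Sum>x\<in>carrier G. \<Sum>y\<in>carrier G. Poly_Mapping.lookup a y *
           Poly_Mapping.lookup b (inv y \<otimes> x) * Poly_Mapping.lookup c (inv x \<otimes> g))"
        by (simp add: lookup_mult_FG a b c g mult_FG_closed sum_distrib_right)
      also have "\<dots> = (\<Sum>y\<in>carrier G. \<Sum>x\<in>carrier G. Poly_Mapping.lookup a y *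
           Poly_Mapping.lookup b (inv y \<otimes> x) * Poly_Mapping.lookup c (inv x \<otimes> g))"
        by (rule sum.swap)
      also have "\<dots> = (\<Sum>y\<in>carrier G. \<Sum>x\<in>carrier G. Poly_Mapping.lookup a y *
           Poly_Mapping.lookup b (inv y \<otimes> (y \<otimes> x)) * Poly_Mapping.lookup c (inv (y \<otimes> x) \<otimes> g))"
        by (intro sum.cong[OF refl] sum_translate[symmetric])
      also have "\<dots> = (\<Sum>y\<in>carrier G. \<Sum>x\<in>carrier G. Poly_Mapping.lookup a y *
           Poly_Mapping.lookup b x * Poly_Mapping.lookup c (inv x \<otimes> (inv y \<otimes> g)))"
        by (intro sum.cong refl) (simp add: m_assoc[symmetric] inv_mult_group g)
      also have "\<dots> = Poly_Mapping.lookup (a \<otimes>\<^bsub>FG\<^esub> (b \<otimes>\<^bsub>FG\<^esub> c)) g"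
        by (simp add: lookup_mult_FG a b c g mult_FG_closed sum_distrib_left mult.assoc)
      finally show "Poly_Mapping.lookup (a \<otimes>\<^bsub>FG\<^esub> b \<otimes>\<^bsub>FG\<^esub> c) g =
        Poly_Mapping.lookup (a \<otimes>\<^bsub>FG\<^esub> (b \<otimes>\<^bsub>FG\<^esub> c)) g" .
    qed (use a b c mult_FG_closed in auto)
  qed (rule mult_FG_closed)
next
  fix a b c assume a: "a \<in> carrier FG" and b: "b \<in> carrier FG" and c: "c \<in> carrier FG"
  have ab: "a + b \<in> carrier FG" if "a \<in> carrier FG" "b \<in> carrier FG" for a b
    using that by (simp add: carrier_FG lookup_add)
  show "(a \<oplus>\<^bsub>FG\<^esub> b) \<otimes>\<^bsub>FG\<^esub> c = a \<otimes>\<^bsub>FG\<^esub> c \<oplus>\<^bsub>FG\<^esub> b \<otimes>\<^bsub>FG\<^esub> c"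
    by (rule FG_eqI)
      (simp_all add: a b c ab mult_FG_closed add_FG lookup_add lookup_mult_FG distrib_right sum.distrib)
  show "c \<otimes>\<^bsub>FG\<^esub> (a \<oplus>\<^bsub>FG\<^esub> b) = c \<otimes>\<^bsub>FG\<^esub> a \<oplus>\<^bsub>FG\<^esub> c \<otimes>\<^bsub>FG\<^esub> b"
    by (rule FG_eqI)
      (simp_all add: a b c ab mult_FG_closed add_FG lookup_add lookup_mult_FG distrib_left sum.distrib)
qed

lemma diff_FG_closed [simp]: "a \<in> carrier FG \<Longrightarrow> b \<in> carrier FG \<Longrightarrow> a - b \<in> carrier FG"
  and plus_FG_closed [simp]: "a \<in> carrier FG \<Longrightarrow> b \<in> carrier FG \<Longrightarrow> a + b \<in> carrier FG"
  and smult_FG_closed [simp]: "a \<in> carrier FG \<Longrightarrow> c \<odot>\<^bsub>FG\<^esub> a \<in> carrier FG"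
  and zero_in_FG [simp]: "0 \<in> carrier FG"
  by (auto simp: carrier_FG lookup_add lookup_minus lookup_smult)

lemma diff_mult_FG:
  assumes "a \<in> carrier FG" "b \<in> carrier FG" "c \<in> carrier FG"
  shows "(a - b) \<otimes>\<^bsub>FG\<^esub> c = a \<otimes>\<^bsub>FG\<^esub> c - b \<otimes>\<^bsub>FG\<^esub> c"
    and "c \<otimes>\<^bsub>FG\<^esub> (a - b) = c \<otimes>\<^bsub>FG\<^esub> a - c \<otimes>\<^bsub>FG\<^esub> b"
  using FG.l_distr[of "a - b" b c] FG.r_distr[of "a - b" b c] assms
  by (simp_all add: add_FG algebra_simps)

lemma smult_mult_FG:
  assumes "a \<in> carrier FG" "b \<in> carrier FG"
  shows "(c \<odot>\<^bsub>FG\<^esub> a) \<otimes>\<^bsub>FG\<^esub> b = c \<odot>\<^bsub>FG\<^esub> (a \<otimes>\<^bsub>FG\<^esub> b)"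
    and "a \<otimes>\<^bsub>FG\<^esub> (c \<odot>\<^bsub>FG\<^esub> b) = c \<odot>\<^bsub>FG\<^esub> (a \<otimes>\<^bsub>FG\<^esub> b)"
  using assms
  by (auto intro!: FG_eqI simp: lookup_smult lookup_mult_FG sum_distrib_left mult_FG_closed mult.assoc mult.left_commute)

lemma left_div_eq_iff:
  assumes "x \<in> carrier G" "y \<in> carrier G" "g \<in> carrier G"
  shows "x = inv y \<otimes> g \<longleftrightarrow> g \<otimes> inv x = y"
  using assms by (metis inv_closed inv_solve_left inv_solve_right)

lemma lookup_mult_single:
  assumes "a \<in> carrier FG" "x \<in> carrier G" "g \<in> carrier G"
  shows lookup_mult_single_right:
      "Poly_Mapping.lookup (a \<otimes>\<^bsub>FG\<^esub> Poly_Mapping.single x 1) g = Poly_Mapping.lookup a (g \<otimes> inv x)"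
    and lookup_mult_single_left:
      "Poly_Mapping.lookup (Poly_Mapping.single x 1 \<otimes>\<^bsub>FG\<^esub> a) g = Poly_Mapping.lookup a (inv x \<otimes> g)"
proof -
  have "Poly_Mapping.lookup (a \<otimes>\<^bsub>FG\<^esub> Poly_Mapping.single x 1) g =
    (\<Sum>y\<in>carrier G. if g \<otimes> inv x = y then Poly_Mapping.lookup a y else 0)"
    unfolding lookup_mult_FG[OF assms(1) single_FG[OF assms(2)] assms(3)]
    using assms(2,3) by (intro sum.cong refl) (simp add: lookup_single when_def left_div_eq_iff)
  then show "Poly_Mapping.lookup (a \<otimes>\<^bsub>FG\<^esub> Poly_Mapping.single x 1) g = Poly_Mapping.lookup a (g \<otimes> inv x)"
    using finite_carrier assms by simp
  have "Poly_Mapping.lookup (Poly_Mapping.single x 1 \<otimes>\<^bsub>FG\<^esub> a) g =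
    (\<Sum>y\<in>carrier G. if x = y then Poly_Mapping.lookup a (inv y \<otimes> g) else 0)"
    unfolding lookup_mult_FG[OF single_FG[OF assms(2)] assms(1) assms(3)]
    using assms(2,3) by (intro sum.cong) (auto simp: lookup_single when_def)
  then show "Poly_Mapping.lookup (Poly_Mapping.single x 1 \<otimes>\<^bsub>FG\<^esub> a) g = Poly_Mapping.lookup a (inv x \<otimes> g)"
    using finite_carrier assms by simp
qed

lemma single_mult_single:
  assumes "x \<in> carrier G" "y \<in> carrier G"
  shows "Poly_Mapping.single x 1 \<otimes>\<^bsub>FG\<^esub> Poly_Mapping.single y (1::'f) = Poly_Mapping.single (x \<otimes> y) 1"
  using assms by (intro FG_eqI)
    (auto simp: lookup_mult_single_left mult_FG_closed lookup_single when_def inv_solve_left inv_solve_right m_assoc[symmetric])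

lemma single_pow:
  "x \<in> carrier G \<Longrightarrow> Poly_Mapping.single x (1::'f) [^]\<^bsub>FG\<^esub> (n::nat) = Poly_Mapping.single (x [^] n) 1"
  by (induction n) (auto simp: one_FG single_mult_single)

text \<open>The functionals through which the group algebra is studied. For a conjugacy class
  \<open>S\<close> the functional vanishes on additive commutators; for a coset of a normal
  subgroup it is a coefficient of the image in the algebra of the quotient.\<close>

definition tr :: "'a set \<Rightarrow> ('a \<Rightarrow>\<^sub>0 'f) \<Rightarrow> 'f" where
  "tr S v = (\<Sum>g\<in>S. Poly_Mapping.lookup v g)"

lemma tr_add: "tr S (a + b) = tr S a + tr S b"
  and tr_diff: "tr S (a - b) = tr S a - tr S b"
  and tr_smult: "tr S (c \<odot>\<^bsub>FG\<^esub> a) = c * tr S a"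
  and tr_zero: "tr S 0 = 0"
  and tr_sum: "tr S (\<Sum>i\<in>I. h i) = (\<Sum>i\<in>I. tr S (h i))"
  by (simp_all add: tr_def lookup_add lookup_minus sum.distrib sum_subtractf lookup_smult sum_distrib_left
     lookup_sum sum.swap[of _ I S])

lemma tr_single: "S \<subseteq> carrier G \<Longrightarrow> tr S (Poly_Mapping.single x c) = (if x \<in> S then c else 0)"
  using finite_carrier by (simp add: tr_def lookup_single when_def finite_subset)

lemma tr_disjoint_union:
  "S \<subseteq> carrier G \<Longrightarrow> R \<subseteq> carrier G \<Longrightarrow> S \<inter> R = {} \<Longrightarrow> tr (S \<union> R) v = tr S v + tr R v"
  unfolding tr_def using finite_carrier by (intro sum.union_disjoint) (auto simp: finite_subset)

definition subsp :: "('a \<Rightarrow>\<^sub>0 'f) set \<Rightarrow> bool" where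
  "subsp U \<longleftrightarrow> U \<subseteq> carrier FG \<and> 0 \<in> U \<and> (\<forall>a\<in>U. \<forall>b\<in>U. a + b \<in> U) \<and> (\<forall>c. \<forall>a\<in>U. c \<odot>\<^bsub>FG\<^esub> a \<in> U)"

lemma subsp_sum:
  assumes "subsp U" "\<And>i. i \<in> I \<Longrightarrow> h i \<in> U"
  shows "sum h I \<in> U"
  using assms(2)
proof (induction I rule: infinite_finite_induct)
qed (use assms(1) in \<open>auto simp: subsp_def\<close>)

lemma expansion:
  assumes "v \<in> carrier FG"
  shows "v = (\<Sum>x\<in>carrier G. Poly_Mapping.lookup v x \<odot>\<^bsub>FG\<^esub> Poly_Mapping.single x 1)"
proof (rule poly_mapping_eqI)
  fix g
  have "(\<Sum>x\<in>carrier G. Poly_Mapping.lookup v x * (1 when x = g)) = (\<Sum>x\<in>carrier G. if g = x then Poly_Mapping.lookup v x else 0)"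
    by (intro sum.cong) (auto simp: when_def)
  then show "Poly_Mapping.lookup v g =
    Poly_Mapping.lookup (\<Sum>x\<in>carrier G. Poly_Mapping.lookup v x \<odot>\<^bsub>FG\<^esub> Poly_Mapping.single x 1) g"
    using lookup_outside[OF assms, of g] finite_carrier
    by (simp add: lookup_sum lookup_smult lookup_single)
qed

text \<open>Modulo \<open>U\<close> every group element is equal to its representative, so
  \<open>v\<close> is congruent to a combination of representatives whose coefficients are the
  given sums.\<close>

lemma subsp_collapse:
  fixes r :: "'a \<Rightarrow> 'a"
  assumes U: "subsp U" and v: "v \<in> carrier FG"
    and r: "\<And>x. x \<in> carrier G \<Longrightarrow> r x \<in> carrier G"
    and diff: "\<And>x. x \<in> carrier G \<Longrightarrow> Poly_Mapping.single x 1 - Poly_Mapping.single (r x) 1 \<in> U"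
    and tr: "\<And>y. y \<in> carrier G \<Longrightarrow> tr {x\<in>carrier G. r x = y} v = 0"
  shows "v \<in> U"
proof -
  have "(\<Sum>x\<in>carrier G. Poly_Mapping.lookup v x \<odot>\<^bsub>FG\<^esub> Poly_Mapping.single (r x) 1) = 0"
  proof (rule poly_mapping_eqI)
    fix g
    have "Poly_Mapping.lookup (\<Sum>x\<in>carrier G. Poly_Mapping.lookup v x \<odot>\<^bsub>FG\<^esub> Poly_Mapping.single (r x) 1) g
      = (\<Sum>x\<in>carrier G. if r x = g then Poly_Mapping.lookup v x else 0)"
      unfolding lookup_sum lookup_smult by (intro sum.cong) (auto simp: lookup_single)
    also have "\<dots> = tr {x\<in>carrier G. r x = g} v"
      using finite_carrier by (simp add: tr_def sum.inter_filter)
    also have "\<dots> = 0"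
    proof (cases "g \<in> carrier G")
      case False
      then have "{x\<in>carrier G. r x = g} = {}" using r by blast
      then show ?thesis by (simp only: tr_def sum.empty)
    qed (rule tr)
    finally show "Poly_Mapping.lookup (\<Sum>x\<in>carrier G. Poly_Mapping.lookup v x \<odot>\<^bsub>FG\<^esub> Poly_Mapping.single (r x) 1) g
      = Poly_Mapping.lookup 0 g" by simp
  qed
  moreover have "c \<odot>\<^bsub>FG\<^esub> (a - b) = c \<odot>\<^bsub>FG\<^esub> a - c \<odot>\<^bsub>FG\<^esub> b" for c a b
    by (rule poly_mapping_eqI) (simp add: lookup_smult lookup_minus algebra_simps)
  ultimately have "v = (\<Sum>x\<in>carrier G. Poly_Mapping.lookup v x \<odot>\<^bsub>FG\<^esub>
      (Poly_Mapping.single x 1 - Poly_Mapping.single (r x) 1))"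
    using expansion[OF v] by (simp add: sum_subtractf)
  also have "\<dots> \<in> U"
    using diff U by (intro subsp_sum[OF U]) (auto simp: subsp_def)
  finally show ?thesis .
qed

end

context finite_group_algebra
begin

text \<open>Unions of left cosets of \<open>N\<close>.\<close>

definition sat :: "'a set \<Rightarrow> 'a set \<Rightarrow> bool" where
  "sat N S \<longleftrightarrow> S \<subseteq> carrier G \<and> (\<forall>x\<in>S. \<forall>n\<in>N. x \<otimes> n \<in> S)"

definition conj_closed :: "'a set \<Rightarrow> bool" where
  "conj_closed S \<longleftrightarrow> (\<forall>x\<in>S. \<forall>h\<in>carrier G. h \<otimes> x \<otimes> inv h \<in> S)"

text \<open>The kernel of the map to the group algebra of \<open>G/N\<close>. Vanishing on all
  unions of cosets is the same as vanishing on single cosets, and is immediately inherited by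
  larger normal subgroups.\<close>

definition aug_ideal :: "'a set \<Rightarrow> ('a \<Rightarrow>\<^sub>0 'f) set" where
  "aug_ideal N = {v \<in> carrier FG. \<forall>S. sat N S \<longrightarrow> tr S v = 0}"

text \<open>The preimage of the space of additive commutators of the algebra of
  \<open>G/N\<close>; by \<open>trace_kernel_least\<close> below it is the span of the additive
  commutators and \<open>aug_ideal N\<close>.\<close>

definition trace_kernel :: "'a set \<Rightarrow> ('a \<Rightarrow>\<^sub>0 'f) set" where
  "trace_kernel N = {v \<in> carrier FG. \<forall>S. sat N S \<and> conj_closed S \<longrightarrow> tr S v = 0}"

text \<open>The preimage of the centre of \<open>G/N\<close>. Next to it,
  \<open>algebra_center_mod\<close> is the preimage of the centre of the algebra of
  \<open>G/N\<close>.\<close>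

definition center_mod :: "'a set \<Rightarrow> 'a set" where
  "center_mod N = {x \<in> carrier G. \<forall>h\<in>carrier G. inv x \<otimes> (h \<otimes> x \<otimes> inv h) \<in> N}"

definition algebra_center_mod :: "'a set \<Rightarrow> ('a \<Rightarrow>\<^sub>0 'f) set" where
  "algebra_center_mod N = {v \<in> carrier FG. \<forall>u\<in>carrier FG. v \<otimes>\<^bsub>FG\<^esub> u - u \<otimes>\<^bsub>FG\<^esub> v \<in> aug_ideal N}"

lemma tr_mult_single:
  assumes "v \<in> carrier FG" "y \<in> carrier G" "S \<subseteq> carrier G"
  shows "tr S (v \<otimes>\<^bsub>FG\<^esub> Poly_Mapping.single y 1) = tr ((\<lambda>g. g \<otimes> inv y) ` S) v"
    and "tr S (Poly_Mapping.single y 1 \<otimes>\<^bsub>FG\<^esub> v) = tr ((\<lambda>g. inv y \<otimes> g) ` S) v"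
proof -
  have "inj_on (\<lambda>g. g \<otimes> inv y) S" "inj_on (\<lambda>g. inv y \<otimes> g) S"
    using assms by (auto intro!: inj_onI simp: subset_iff)
  then show "tr S (v \<otimes>\<^bsub>FG\<^esub> Poly_Mapping.single y 1) = tr ((\<lambda>g. g \<otimes> inv y) ` S) v"
     "tr S (Poly_Mapping.single y 1 \<otimes>\<^bsub>FG\<^esub> v) = tr ((\<lambda>g. inv y \<otimes> g) ` S) v"
    using assms by (auto simp: tr_def sum.reindex lookup_mult_single subset_iff intro!: sum.cong)
qed

lemma mult_in_subsp:
  assumes U: "subsp U" and v: "v \<in> carrier FG" and u: "u \<in> carrier FG"
  shows "(\<And>y. y \<in> carrier G \<Longrightarrow> v \<otimes>\<^bsub>FG\<^esub> Poly_Mapping.single y 1 \<in> U) \<Longrightarrow> v \<otimes>\<^bsub>FG\<^esub> u \<in> U"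
    and "(\<And>y. y \<in> carrier G \<Longrightarrow> Poly_Mapping.single y 1 \<otimes>\<^bsub>FG\<^esub> v \<in> U) \<Longrightarrow> u \<otimes>\<^bsub>FG\<^esub> v \<in> U"
proof -
  have lin: "v \<otimes>\<^bsub>FG\<^esub> (\<Sum>y\<in>Y. c y \<odot>\<^bsub>FG\<^esub> Poly_Mapping.single y 1) =
      (\<Sum>y\<in>Y. c y \<odot>\<^bsub>FG\<^esub> (v \<otimes>\<^bsub>FG\<^esub> Poly_Mapping.single y 1)) \<and>
     (\<Sum>y\<in>Y. c y \<odot>\<^bsub>FG\<^esub> Poly_Mapping.single y 1) \<otimes>\<^bsub>FG\<^esub> v =
      (\<Sum>y\<in>Y. c y \<odot>\<^bsub>FG\<^esub> (Poly_Mapping.single y 1 \<otimes>\<^bsub>FG\<^esub> v)) \<and>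
     (\<Sum>y\<in>Y. c y \<odot>\<^bsub>FG\<^esub> Poly_Mapping.single y (1::'f)) \<in> carrier FG"
    if "Y \<subseteq> carrier G" for Y and c :: "'a \<Rightarrow> 'f"
    using finite_subset[OF that finite_carrier] that
  proof (induction Y rule: finite_induct)
    case empty
    then show ?case using v FG.r_null[of v] FG.l_null[of v] by (simp add: zero_FG)
  next
    case (insert y Y)
    then show ?case
      using v FG.l_distr[of "c y \<odot>\<^bsub>FG\<^esub> Poly_Mapping.single y 1"
          "\<Sum>y\<in>Y. c y \<odot>\<^bsub>FG\<^esub> Poly_Mapping.single y 1" v]
        FG.r_distr[of "c y \<odot>\<^bsub>FG\<^esub> Poly_Mapping.single y 1"
          "\<Sum>y\<in>Y. c y \<odot>\<^bsub>FG\<^esub> Poly_Mapping.single y 1" v]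
      by (simp add: add_FG smult_mult_FG)
  qed
  show "v \<otimes>\<^bsub>FG\<^esub> u \<in> U" if "\<And>y. y \<in> carrier G \<Longrightarrow> v \<otimes>\<^bsub>FG\<^esub> Poly_Mapping.single y 1 \<in> U"
    using lin[OF subset_refl, of "Poly_Mapping.lookup u"] expansion[OF u] that U
    by (auto simp: subsp_def intro!: subsp_sum[OF U])
  show "u \<otimes>\<^bsub>FG\<^esub> v \<in> U" if "\<And>y. y \<in> carrier G \<Longrightarrow> Poly_Mapping.single y 1 \<otimes>\<^bsub>FG\<^esub> v \<in> U"
    using lin[OF subset_refl, of "Poly_Mapping.lookup u"] expansion[OF u] that U
    by (auto simp: subsp_def intro!: subsp_sum[OF U])
qed

lemma subsp_aug_ideal: "subsp (aug_ideal N)"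
  by (auto simp: subsp_def aug_ideal_def tr_add tr_smult tr_zero)

lemma subsp_trace_kernel: "subsp (trace_kernel N)"
  by (auto simp: subsp_def trace_kernel_def tr_add tr_smult tr_zero)

lemma aug_ideal_subset_trace_kernel: "aug_ideal N \<subseteq> trace_kernel N"
  by (auto simp: aug_ideal_def trace_kernel_def)

lemma normal_conj:
  assumes "N \<lhd> G" "n \<in> N" "h \<in> carrier G"
  shows "h \<otimes> n \<otimes> inv h \<in> N" "inv h \<otimes> n \<otimes> h \<in> N"
  using assms by (auto simp: normal_inv_iff) (metis inv_closed inv_inv)

lemma aug_ideal_mult:
  assumes "N \<lhd> G" "v \<in> aug_ideal N" "u \<in> carrier FG"
  shows "v \<otimes>\<^bsub>FG\<^esub> u \<in> aug_ideal N" "u \<otimes>\<^bsub>FG\<^esub> v \<in> aug_ideal N"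
proof -
  have v: "v \<in> carrier FG" using assms(2) by (simp add: aug_ideal_def)
  have N: "N \<subseteq> carrier G" using assms(1) by (meson normal_imp_subgroup subgroup.subset)
  have s1: "sat N ((\<lambda>g. g \<otimes> inv y) ` S)" and s2: "sat N ((\<lambda>g. inv y \<otimes> g) ` S)"
    if S: "sat N S" and y: "y \<in> carrier G" for S y
  proof -
    have SG: "S \<subseteq> carrier G" using S by (simp add: sat_def)
    have "x \<otimes> inv y \<otimes> n \<in> (\<lambda>g. g \<otimes> inv y) ` S" if "x \<in> S" "n \<in> N" for x n
    proof -
      have "x \<otimes> inv y \<otimes> n = x \<otimes> (inv y \<otimes> n \<otimes> y) \<otimes> inv y"
        using that y SG N by (simp add: m_assoc subset_iff)
      moreover have "x \<otimes> (inv y \<otimes> n \<otimes> y) \<in> S"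
        using S that normal_conj(2)[OF assms(1) that(2) y] by (simp add: sat_def)
      ultimately show ?thesis by blast
    qed
    then show "sat N ((\<lambda>g. g \<otimes> inv y) ` S)" using SG y by (auto simp: sat_def)
    have "inv y \<otimes> x \<otimes> n \<in> (\<lambda>g. inv y \<otimes> g) ` S" if "x \<in> S" "n \<in> N" for x n
    proof -
      have "inv y \<otimes> x \<otimes> n = inv y \<otimes> (x \<otimes> n)"
        using that y SG N by (simp add: m_assoc subset_iff)
      moreover have "x \<otimes> n \<in> S" using S that by (simp add: sat_def)
      ultimately show ?thesis by blast
    qed
    then show "sat N ((\<lambda>g. inv y \<otimes> g) ` S)" using SG y by (auto simp: sat_def)
  qed
  have "v \<otimes>\<^bsub>FG\<^esub> Poly_Mapping.single y 1 \<in> aug_ideal N \<and> Poly_Mapping.single y 1 \<otimes>\<^bsub>FG\<^esub> v \<in> aug_ideal N"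
    if y: "y \<in> carrier G" for y
    using assms(2) s1[OF _ y] s2[OF _ y] v y
    by (auto simp: aug_ideal_def mult_FG_closed tr_mult_single sat_def)
  then show "v \<otimes>\<^bsub>FG\<^esub> u \<in> aug_ideal N" "u \<otimes>\<^bsub>FG\<^esub> v \<in> aug_ideal N"
    by (auto intro!: mult_in_subsp[OF subsp_aug_ideal v assms(3)])
qed

lemma sat_iff:
  assumes "subgroup N G" "sat N S" "x \<in> carrier G" "n \<in> N"
  shows "x \<otimes> n \<in> S \<longleftrightarrow> x \<in> S"
proof
  assume "x \<otimes> n \<in> S"
  then have "x \<otimes> n \<otimes> inv n \<in> S"
    using assms by (auto simp: sat_def subgroup.m_inv_closed)
  then show "x \<in> S" using assms by (metis inv_closed m_assoc r_inv r_one subgroup.mem_carrier)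
qed (use assms in \<open>auto simp: sat_def\<close>)

lemma single_diff_in_aug_ideal:
  assumes "subgroup N G" "x \<in> carrier G" "n \<in> N"
  shows "Poly_Mapping.single (x \<otimes> n) 1 - Poly_Mapping.single x 1 \<in> aug_ideal N"
  using assms subgroup.mem_carrier[OF assms(1,3)] sat_iff[OF assms(1) _ assms(2,3)]
  by (auto simp: aug_ideal_def tr_diff tr_single sat_def)

text \<open>Minimality is the form in which this ideal can be transported: to show that an
  isomorphism maps it into a given subspace it suffices to look at the differences of elements
  in one coset.\<close>

lemma aug_ideal_least:
  assumes U: "subsp U" and N: "subgroup N G"
    and gen: "\<And>x n. x \<in> carrier G \<Longrightarrow> n \<in> N \<Longrightarrow> Poly_Mapping.single (x \<otimes> n) 1 - Poly_Mapping.single x 1 \<in> U"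
  shows "aug_ideal N \<subseteq> U"
proof
  fix v assume v: "v \<in> aug_ideal N"
  define r where "r x = (SOME y. y \<in> x <# N)" for x
  have r: "r x \<in> x <# N" if "x \<in> carrier G" for x
    unfolding r_def by (rule someI[of _ x]) (use that N in \<open>metis lcos_self\<close>)
  show "v \<in> U"
  proof (rule subsp_collapse[OF U, of v r])
    show "v \<in> carrier FG" using v by (simp add: aug_ideal_def)
    fix x assume x: "x \<in> carrier G"
    obtain n where n: "n \<in> N" "r x = x \<otimes> n" using r[OF x] by (auto simp: l_coset_def)
    show "r x \<in> carrier G" using n x N by (simp add: subgroup.mem_carrier)
    have "inv n \<in> N" using n N by (simp add: subgroup.m_inv_closed)
    from gen[OF \<open>r x \<in> carrier G\<close> this]
    show "Poly_Mapping.single x 1 - Poly_Mapping.single (r x) 1 \<in> U"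
      using n x N by (simp add: m_assoc subgroup.mem_carrier)
  next
    fix y assume y: "y \<in> carrier G"
    have "(x \<otimes> n) <# N = x <# N" if "x \<in> carrier G" "n \<in> N" for x n
      using that N
      by (metis l_coset_def l_repr_independence lcos_m_assoc subgroup.subset coset_join3 subgroup.mem_carrier)
    then have "r (x \<otimes> n) = r x" if "x \<in> carrier G" "n \<in> N" for x n using that by (simp add: r_def)
    then have "sat N {x \<in> carrier G. r x = y}"
      using N by (auto simp: sat_def subgroup.mem_carrier)
    then show "tr {x \<in> carrier G. r x = y} v = 0" using v by (simp add: aug_ideal_def)
  qed
qed

lemma conj_closed_comm:
  assumes "conj_closed S" "x \<in> carrier G" "y \<in> carrier G" "x \<otimes> y \<in> S"
  shows "y \<otimes> x \<in> S"
proof -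
  have "y \<otimes> (x \<otimes> y) \<otimes> inv y \<in> S" using assms by (auto simp: conj_closed_def)
  then show ?thesis using assms by (simp add: m_assoc)
qed

text \<open>The membership of \<open>xy\<close> in a conjugation-invariant set is symmetric in
  \<open>x\<close> and \<open>y\<close>.\<close>

lemma tr_mult_commute:
  assumes "a \<in> carrier FG" "b \<in> carrier FG" "conj_closed S" "S \<subseteq> carrier G"
  shows "tr S (a \<otimes>\<^bsub>FG\<^esub> b) = tr S (b \<otimes>\<^bsub>FG\<^esub> a)"
proof -
  have "tr S (a \<otimes>\<^bsub>FG\<^esub> b) = (\<Sum>x\<in>carrier G. \<Sum>y\<in>carrier G.
     if x \<otimes> y \<in> S then Poly_Mapping.lookup a x * Poly_Mapping.lookup b y else 0)"
    by (simp add: mult_FG assms(1,2) tr_sum tr_single assms(4))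
  also have "\<dots> = (\<Sum>x\<in>carrier G. \<Sum>y\<in>carrier G.
     if y \<otimes> x \<in> S then Poly_Mapping.lookup b y * Poly_Mapping.lookup a x else 0)"
    by (intro sum.cong refl) (use conj_closed_comm[OF assms(3)] in \<open>auto simp: mult.commute\<close>)
  also have "\<dots> = tr S (b \<otimes>\<^bsub>FG\<^esub> a)"
    by (subst sum.swap) (simp add: mult_FG assms(1,2) tr_sum tr_single assms(4))
  finally show ?thesis .
qed

lemma commutator_in_trace_kernel:
  "a \<in> carrier FG \<Longrightarrow> b \<in> carrier FG \<Longrightarrow> a \<otimes>\<^bsub>FG\<^esub> b - b \<otimes>\<^bsub>FG\<^esub> a \<in> trace_kernel N"
  by (auto simp: trace_kernel_def mult_FG_closed tr_diff tr_mult_commute sat_def)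

text \<open>Here \<open>x - hxh\<inverse>\<close> is the additive commutator of
  \<open>xh\<inverse>\<close> and \<open>h\<close>.\<close>

lemma single_conj_diff:
  assumes x: "x \<in> carrier G" and h: "h \<in> carrier G"
    and U: "\<And>a b. a \<in> carrier FG \<Longrightarrow> b \<in> carrier FG \<Longrightarrow> a \<otimes>\<^bsub>FG\<^esub> b - b \<otimes>\<^bsub>FG\<^esub> a \<in> U"
  shows "Poly_Mapping.single x 1 - Poly_Mapping.single (h \<otimes> x \<otimes> inv h) 1 \<in> U"
  using U[of "Poly_Mapping.single (x \<otimes> inv h) 1" "Poly_Mapping.single h 1"] x h
  by (simp add: single_mult_single m_assoc)

text \<open>Each element is congruent to any element of its conjugacy class modulo
  \<open>N\<close>, and the hypothesis on traces says that the coefficients add up to zero along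
  each such class.\<close>

lemma trace_kernel_least:
  assumes U: "subsp U" and N: "N \<lhd> G"
    and comm: "\<And>a b. a \<in> carrier FG \<Longrightarrow> b \<in> carrier FG \<Longrightarrow> a \<otimes>\<^bsub>FG\<^esub> b - b \<otimes>\<^bsub>FG\<^esub> a \<in> U"
    and aug: "aug_ideal N \<subseteq> U"
  shows "trace_kernel N \<subseteq> U"
proof
  fix v assume v: "v \<in> trace_kernel N"
  have sN: "subgroup N G" using N by (rule normal_imp_subgroup)
  have NG: "n \<in> carrier G" if "n \<in> N" for n using that sN by (simp add: subgroup.mem_carrier)
  define cl where "cl x = {h \<otimes> x \<otimes> inv h \<otimes> n | h n. h \<in> carrier G \<and> n \<in> N}" for x
  have cl_conj: "h \<otimes> x \<otimes> inv h \<otimes> n \<in> cl x" if "h \<in> carrier G" "n \<in> N" for h x n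
    using that by (auto simp: cl_def)
  have cl_sub: "cl y \<subseteq> cl x" if x: "x \<in> carrier G" and y: "y \<in> cl x" for x y
  proof
    fix w assume "w \<in> cl y"
    then obtain h n h' n' where *: "h \<in> carrier G" "n \<in> N" "h' \<in> carrier G" "n' \<in> N"
       "y = h \<otimes> x \<otimes> inv h \<otimes> n" "w = h' \<otimes> y \<otimes> inv h' \<otimes> n'" using y by (auto simp: cl_def)
    have "w = (h' \<otimes> h) \<otimes> x \<otimes> inv (h' \<otimes> h) \<otimes> ((h' \<otimes> n \<otimes> inv h') \<otimes> n')"
      using * NG x by (simp add: m_assoc inv_mult_group inv_mult_cancel)
    moreover have "(h' \<otimes> n \<otimes> inv h') \<otimes> n' \<in> N"
      using * normal_conj(1)[OF N] sN by (simp add: subgroup.m_closed)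
    ultimately show "w \<in> cl x" using cl_conj[of "h' \<otimes> h" "(h' \<otimes> n \<otimes> inv h') \<otimes> n'" x] * by simp
  qed
  have cl_sym: "x \<in> cl y" if x: "x \<in> carrier G" and y: "y \<in> cl x" for x y
  proof -
    obtain h n where *: "h \<in> carrier G" "n \<in> N" "y = h \<otimes> x \<otimes> inv h \<otimes> n" using y by (auto simp: cl_def)
    have "x = inv h \<otimes> y \<otimes> inv (inv h) \<otimes> (inv h \<otimes> inv n \<otimes> h)"
      using * NG x by (simp add: m_assoc inv_mult_cancel)
    moreover have "inv h \<otimes> inv n \<otimes> h \<in> N"
      using normal_conj(2)[OF N subgroup.m_inv_closed[OF sN]] * by simp
    ultimately show ?thesis using cl_conj[of "inv h" "inv h \<otimes> inv n \<otimes> h" y] * by simp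
  qed
  have cl_carrier: "cl x \<subseteq> carrier G" if "x \<in> carrier G" for x using that NG by (auto simp: cl_def)
  have cl_eq: "cl y = cl x" if "x \<in> carrier G" "y \<in> cl x" for x y
    using cl_sub cl_sym that cl_carrier by (meson subset_antisym subsetD)
  have cl_self: "x \<in> cl x" if "x \<in> carrier G" for x
    using cl_conj[of \<one> \<one> x] that sN by (simp add: subgroup.one_closed)
  define r where "r x = (SOME y. y \<in> cl x)" for x
  have r: "r x \<in> cl x" if "x \<in> carrier G" for x
    unfolding r_def by (rule someI[of _ x]) (rule cl_self[OF that])
  show "v \<in> U"
  proof (rule subsp_collapse[OF U, of v r])
    show "v \<in> carrier FG" using v by (simp add: trace_kernel_def)
    fix x assume x: "x \<in> carrier G"
    show rG: "r x \<in> carrier G" using r[OF x] cl_carrier[OF x] by blast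
    obtain h n where n: "h \<in> carrier G" "n \<in> N" "r x = h \<otimes> x \<otimes> inv h \<otimes> n" using r[OF x] by (auto simp: cl_def)
    define y where "y = h \<otimes> x \<otimes> inv h"
    have y: "y \<in> carrier G" using x n by (simp add: y_def)
    have "Poly_Mapping.single x 1 - Poly_Mapping.single y 1 \<in> U"
      unfolding y_def by (rule single_conj_diff[OF x n(1) comm])
    moreover have "r x = y \<otimes> n" "inv n \<in> N" using n sN by (simp_all add: y_def subgroup.m_inv_closed)
    then have "Poly_Mapping.single y 1 - Poly_Mapping.single (r x) 1 \<in> U"
      using single_diff_in_aug_ideal[OF sN rG, of "inv n"] aug y n NG by (auto simp: m_assoc)
    ultimately have "(Poly_Mapping.single x 1 - Poly_Mapping.single y 1) + (Poly_Mapping.single y 1 - Poly_Mapping.single (r x) 1) \<in> U"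
      using U unfolding subsp_def by blast
    then show "Poly_Mapping.single x 1 - Poly_Mapping.single (r x) 1 \<in> U" by simp
  next
    fix y assume y: "y \<in> carrier G"
    have "r (h \<otimes> x \<otimes> inv h \<otimes> n) = r x" if "x \<in> carrier G" "h \<in> carrier G" "n \<in> N" for x h n
      using cl_eq[OF that(1) cl_conj[OF that(2,3)]] by (simp add: r_def)
    from this[of _ \<one>] this[of _ _ \<one>]
    have "sat N {x \<in> carrier G. r x = y} \<and> conj_closed {x \<in> carrier G. r x = y}"
      using NG sN by (auto simp: sat_def conj_closed_def subgroup.one_closed)
    then show "tr {x \<in> carrier G. r x = y} v = 0" using v by (simp add: trace_kernel_def)
  qed
qed

end

context finite_group_algebra
begin

lemma tr_coset_sum:
  assumes N: "subgroup N G" and R: "sat N R"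
  shows "tr R v = (\<Sum>A\<in>(\<lambda>x. x <# N) ` R. tr A v)"
proof -
  have RG: "R \<subseteq> carrier G" using R by (simp add: sat_def)
  define E where "E = (\<lambda>x. x <# N) ` R"
  have coset_eq: "y <# N = x <# N" if "y \<in> x <# N" "x \<in> carrier G" for x y
    by (rule l_repr_independence[OF that N, symmetric])
  have coset_sub: "x <# N \<subseteq> R" if "x \<in> R" for x
    using that R by (auto simp: sat_def l_coset_def)
  have "\<Union>E = R"
  proof
    show "\<Union>E \<subseteq> R" unfolding E_def using coset_sub by blast
    show "R \<subseteq> \<Union>E"
    proof
      fix x assume "x \<in> R"
      then have "x \<in> x <# N" using RG by (intro lcos_self[OF _ N]) blast
      then show "x \<in> \<Union>E" unfolding E_def using \<open>x \<in> R\<close> by blast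
    qed
  qed
  moreover have "A \<inter> B = {}" if AB: "A \<in> E" "B \<in> E" "A \<noteq> B" for A B
  proof (rule ccontr)
    assume "A \<inter> B \<noteq> {}"
    then obtain z where "z \<in> A" "z \<in> B" by blast
    moreover obtain x y where "x \<in> R" "y \<in> R" "A = x <# N" "B = y <# N" using AB unfolding E_def by blast
    ultimately show False using coset_eq[of z x] coset_eq[of z y] RG AB(3) by (metis subsetD)
  qed
  moreover have "finite A" if "A \<in> E" for A
  proof -
    have "A \<subseteq> carrier G" using that coset_sub RG unfolding E_def by blast
    then show ?thesis using finite_carrier by (rule finite_subset)
  qed
  ultimately show ?thesis
    unfolding tr_def E_def[symmetric] using sum.Union_disjoint[of E "Poly_Mapping.lookup v"] by (simp add: comp_def)
qed

end

locale p_group_algebra = finite_group_algebra G F for G (structure) and F :: "'f::field itself" +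
  fixes p :: nat and e :: nat
  assumes prime_p: "Factorial_Ring.prime p" and char_p: "CHAR('f) = p" and order_p_power: "order G = p ^ e"
begin

lemma conj_image:
  assumes "A \<subseteq> carrier G" "h \<in> carrier G"
  shows "h <# A #> inv h = (\<lambda>a. h \<otimes> a \<otimes> inv h) ` A"
  by (auto simp: l_coset_def r_coset_def)

lemma conj_conj_inv:
  assumes "A \<subseteq> carrier G" "h \<in> carrier G"
  shows "inv h <# (h <# A #> inv h) #> inv (inv h) = A"
proof -
  have eq: "inv h \<otimes> (h \<otimes> a \<otimes> inv h) \<otimes> inv (inv h) = a" if "a \<in> A" for a
  proof -
    have "a \<in> carrier G" using that assms(1) by blast
    then show ?thesis using assms(2) by (simp add: m_assoc inv_mult_cancel)
  qed
  have "(\<lambda>a. h \<otimes> a \<otimes> inv h) ` A \<subseteq> carrier G" using assms by blast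
  then have "inv h <# (h <# A #> inv h) #> inv (inv h) = (\<lambda>a. inv h \<otimes> (h \<otimes> a \<otimes> inv h) \<otimes> inv (inv h)) ` A"
    by (simp only: conj_image[OF assms] conj_image[OF _ inv_closed[OF assms(2)]] image_image)
  also have "\<dots> = (\<lambda>a. a) ` A" by (rule image_cong[OF refl eq])
  finally show ?thesis by simp
qed

text \<open>An element that is central modulo \<open>N\<close> has coset sums that are invariant
  under conjugation.\<close>

lemma tr_conj:
  assumes "v \<in> algebra_center_mod N" "sat N A" "h \<in> carrier G" "N \<subseteq> carrier G"
  shows "tr (h <# A #> inv h) v = tr A v"
proof -
  have v: "v \<in> carrier FG" using assms(1) by (simp add: algebra_center_mod_def)
  have A: "A \<subseteq> carrier G" using assms(2) by (simp add: sat_def)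
  define S where "S = (\<lambda>a. h \<otimes> a) ` A"
  have SG: "S \<subseteq> carrier G" using A assms(3) by (auto simp: S_def)
  have "h \<otimes> x \<otimes> n \<in> S" if "x \<in> A" "n \<in> N" for x n
  proof -
    have "h \<otimes> x \<otimes> n = h \<otimes> (x \<otimes> n)" using that A assms(3,4) by (simp add: m_assoc subset_iff)
    then show ?thesis using that assms(2) by (auto simp: S_def sat_def)
  qed
  then have "sat N S" using SG by (auto simp: sat_def S_def)
  moreover have "v \<otimes>\<^bsub>FG\<^esub> Poly_Mapping.single h 1 - Poly_Mapping.single h 1 \<otimes>\<^bsub>FG\<^esub> v \<in> aug_ideal N"
    using assms(1,3) by (simp add: algebra_center_mod_def)
  ultimately have "tr S (v \<otimes>\<^bsub>FG\<^esub> Poly_Mapping.single h 1) = tr S (Poly_Mapping.single h 1 \<otimes>\<^bsub>FG\<^esub> v)"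
    by (simp add: aug_ideal_def tr_diff)
  moreover have "(\<lambda>g. g \<otimes> inv h) ` S = h <# A #> inv h"
    by (simp add: conj_image[OF A assms(3)] S_def image_image)
  moreover have "(\<lambda>g. inv h \<otimes> g) ` S = A"
  proof -
    have "(\<lambda>g. inv h \<otimes> g) ` S = (\<lambda>g. g) ` A" unfolding S_def image_image
      using A assms(3) by (intro image_cong refl) (auto simp: inv_mult_cancel)
    then show ?thesis by simp
  qed
  ultimately show ?thesis by (simp add: tr_mult_single v assms(3) SG)
qed

text \<open>The only part of a central element of \<open>F[G/N]\<close> that survives modulo
  commutators is the one supported on the centre of \<open>G/N\<close>. Indeed the coset sums of
  \<open>v\<close> are constant on orbits of cosets under conjugation, and no coset in
  \<open>R\<close> is fixed, so that the group, being a \<open>p\<close>-group, makes every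
  orbit sum zero.\<close>

lemma tr_noncentral_eq_0:
  assumes N: "N \<lhd> G" and v: "v \<in> algebra_center_mod N"
    and R: "sat N R" "conj_closed R" "R \<inter> center_mod N = {}"
  shows "tr R v = 0"
proof -
  have sN: "subgroup N G" using N by (rule normal_imp_subgroup)
  have NG: "N \<subseteq> carrier G" using sN by (rule subgroup.subset)
  have RG: "R \<subseteq> carrier G" using R(1) by (simp add: sat_def)
  define E where "E = (\<lambda>x. x <# N) ` R"
  have trR: "tr R v = (\<Sum>A\<in>E. tr A v)"
    unfolding E_def by (rule tr_coset_sum[OF sN R(1)])
  have conj_coset: "h <# (x <# N) #> inv h = (h \<otimes> x \<otimes> inv h) <# N" if x: "x \<in> carrier G" and h: "h \<in> carrier G" for x h
  proof -
    have "h <# (x <# N) #> inv h = h <# ((x <# N) #> inv h)"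
      using x h NG by (simp add: l_coset_def r_coset_def) (auto simp: m_assoc subset_iff)
    also have "(x <# N) #> inv h = x <# (N #> inv h)"
      using x h NG by (auto simp: l_coset_def r_coset_def m_assoc subset_iff)
    also have "N #> inv h = inv h <# N" using N h by (simp add: normal.coset_eq)
    finally show ?thesis using x h NG by (simp add: lcos_m_assoc m_assoc)
  qed
  have conjE: "h <# A #> inv h \<in> E" if A: "A \<in> E" and h: "h \<in> carrier G" for A h
  proof -
    obtain x where x: "x \<in> R" "A = x <# N" using A unfolding E_def by blast
    then have "h \<otimes> x \<otimes> inv h \<in> R" using R(2) h by (simp add: conj_closed_def)
    then show ?thesis using conj_coset[of x h] x RG h by (auto simp: E_def)
  qed
  have satE: "sat N A" if AE: "A \<in> E" for A
  proof -
    obtain x where x: "x \<in> R" "A = x <# N" using AE unfolding E_def by blast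
    have xG: "x \<in> carrier G" using x RG by blast
    have "y \<otimes> n \<in> x <# N" if "y \<in> x <# N" "n \<in> N" for y n
    proof -
      obtain m where m: "m \<in> N" "y = x \<otimes> m" using \<open>y \<in> x <# N\<close> unfolding l_coset_def by blast
      then have "y \<otimes> n = x \<otimes> (m \<otimes> n)" using xG \<open>n \<in> N\<close> NG by (simp add: m_assoc subset_iff)
      then show ?thesis using m \<open>n \<in> N\<close> subgroup.m_closed[OF sN] unfolding l_coset_def by blast
    qed
    then show ?thesis using l_coset_subset_G[OF NG xG] x(2) by (simp add: sat_def)
  qed
  have EG: "A \<subseteq> carrier G" if "A \<in> E" for A using satE[OF that] by (simp add: sat_def)
  \<comment> \<open>The group acts on all subsets of \<open>G\<close>; extending the coset sums
    by zero keeps the function invariant.\<close>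
  define f where "f A = (if A \<in> E then tr A v else 0)" for A
  have backE: "A \<in> E" if h: "h \<in> carrier G" and A: "A \<subseteq> carrier G" and hA: "h <# A #> inv h \<in> E" for h A
  proof -
    have "inv h <# (h <# A #> inv h) #> inv (inv h) = A" by (rule conj_conj_inv[OF A h])
    then show ?thesis using conjE[OF hA inv_closed[OF h]] by (simp only:)
  qed
  define \<phi> where "\<phi> = (\<lambda>g. \<lambda>H\<in>{H. H \<subseteq> carrier G}. g <# H #> inv g)"
  interpret act: group_action G "{H. H \<subseteq> carrier G}" \<phi>
    unfolding \<phi>_def by (rule action_by_conjugation_on_power_set)
  have "(\<Sum>A\<in>E. tr A v) = sum f {H. H \<subseteq> carrier G}"
  proof (rule sum.mono_neutral_cong_left)
    show "finite {H. H \<subseteq> carrier G}" using finite_carrier by (simp add: Pow_def[symmetric])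
  qed (use EG in \<open>auto simp: f_def\<close>)
  also have "\<dots> = sum f {A\<in>{H. H \<subseteq> carrier G}. \<forall>g\<in>carrier G. \<phi> g A = A}"
  proof (rule act.sum_invariant_eq_sum_fixed[OF prime_p char_p order_p_power])
    show "finite {H. H \<subseteq> carrier G}" using finite_carrier by (simp add: Pow_def[symmetric])
    fix g A assume g: "g \<in> carrier G" and A: "A \<in> {H. H \<subseteq> carrier G}"
    show "f (\<phi> g A) = f A"
    proof (cases "A \<in> E")
      case True
      then show ?thesis using conjE[OF True g] tr_conj[OF v satE[OF True] g NG] A by (simp add: f_def \<phi>_def)
    next
      case False
      then have "g <# A #> inv g \<notin> E" using backE[OF g] A by blast
      then show ?thesis using False A by (simp add: f_def \<phi>_def)
    qed
  qed
  also have "\<dots> = 0"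
  proof (intro sum.neutral ballI)
    fix A assume A: "A \<in> {A\<in>{H. H \<subseteq> carrier G}. \<forall>g\<in>carrier G. \<phi> g A = A}"
    show "f A = 0"
    proof (rule ccontr)
      assume "f A \<noteq> 0"
      then have "A \<in> E" by (auto simp: f_def split: if_splits)
      then obtain x where x: "x \<in> R" "A = x <# N" unfolding E_def by blast
      have xG: "x \<in> carrier G" using x RG by blast
      have "inv x \<otimes> (h \<otimes> x \<otimes> inv h) \<in> N" if h: "h \<in> carrier G" for h
      proof -
        have "h <# A #> inv h = A" using A h unfolding \<phi>_def by auto
        then have "h \<otimes> x \<otimes> inv h \<in> x <# N"
          using lcos_self[OF _ sN, of "h \<otimes> x \<otimes> inv h"] conj_coset[OF xG h] x h xG by simp
        then obtain n where "n \<in> N" "h \<otimes> x \<otimes> inv h = x \<otimes> n" unfolding l_coset_def by blast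
        then show ?thesis using xG NG by (simp add: inv_mult_cancel subset_iff)
      qed
      then have "x \<in> center_mod N" using xG by (simp add: center_mod_def)
      then show False using R(3) x by blast
    qed
  qed
  finally show ?thesis using trR by simp
qed

end

section \<open>Powers modulo commutators\<close>

lemma rotate1_fixed_imp_constant:
  assumes "rotate1 (x # xs) = x # xs"
  shows "x # xs = replicate (length (x # xs)) x"
proof -
  have "xs @ [x] = x # xs \<Longrightarrow> xs = replicate (length xs) x"
    by (induction xs) auto
  then show ?thesis using assms by simp
qed

lemma rotate_action:
  assumes p: "p > 0"
  shows "group_action (integer_mod_group p) {xs. set xs \<subseteq> A \<and> length xs = p}
    (\<lambda>i. \<lambda>xs\<in>{xs. set xs \<subseteq> A \<and> length xs = p}. rotate (nat i) xs)"
proof -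
  let ?L = "{xs. set xs \<subseteq> A \<and> length xs = p}"
  let ?f = "\<lambda>i. \<lambda>xs\<in>?L. rotate (nat i) xs"
  have rot: "rotate k xs \<in> ?L" if "xs \<in> ?L" for k xs using that by simp
  have bij: "?f i \<in> Bij ?L" if "i \<in> carrier (integer_mod_group p)" for i
  proof -
    have i: "0 \<le> i" "i < int p" using that p by (auto simp: carrier_integer_mod_group)
    have "nat i + (p - nat i) = p" "(p - nat i) + nat i = p" using i by auto
    then have "bij_betw (rotate (nat i)) ?L ?L"
      by (intro bij_betw_byWitness[where f' = "rotate (p - nat i)"])
         (auto simp: rotate_rotate)
    then have "bij_betw (?f i) ?L ?L" by (subst bij_betw_cong[of ?L _ "rotate (nat i)"]) auto
    then show ?thesis by (simp add: Bij_def)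
  qed
  have "?f \<in> hom (integer_mod_group p) (BijGroup ?L)"
  proof (rule homI)
    fix i assume "i \<in> carrier (integer_mod_group p)"
    then show "?f i \<in> carrier (BijGroup ?L)" using bij by (simp add: BijGroup_def)
  next
    fix i j assume ij: "i \<in> carrier (integer_mod_group p)" "j \<in> carrier (integer_mod_group p)"
    then have nn: "0 \<le> i" "0 \<le> j" using p by (auto simp: carrier_integer_mod_group)
    have "rotate (nat ((i + j) mod int p)) xs = rotate (nat i) (rotate (nat j) xs)" if "xs \<in> ?L" for xs
    proof -
      have "nat ((i + j) mod int p) = (nat i + nat j) mod length xs"
        using that nn by (simp add: nat_mod_distrib nat_add_distrib)
      then show ?thesis by (metis rotate_conv_mod rotate_rotate)
    qed
    then have "?f (i \<otimes>\<^bsub>integer_mod_group p\<^esub> j) = compose ?L (?f i) (?f j)"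
      by (intro ext) (auto simp: compose_def)
    then show "?f (i \<otimes>\<^bsub>integer_mod_group p\<^esub> j) = ?f i \<otimes>\<^bsub>BijGroup ?L\<^esub> ?f j"
      using bij ij by (simp add: BijGroup_def)
  qed
  then show ?thesis
    by (simp add: group_action_def group_hom_def group_hom_axioms_def group_BijGroup)
qed

lemma (in group) pow_conj:
  assumes "h \<in> carrier G" "x \<in> carrier G"
  shows "(h \<otimes> x \<otimes> inv h) [^] (k::nat) = h \<otimes> x [^] k \<otimes> inv h"
  using assms by (induction k) (simp_all add: m_assoc inv_mult_cancel)

context finite_group_algebra
begin

text \<open>The coefficients of a power are sums over words. Cyclic rotation of a word
  conjugates its product and leaves the product of coefficients unchanged.\<close>

lemma lookup_pow:
  assumes v: "v \<in> carrier FG" and g: "g \<in> carrier G"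
  shows "Poly_Mapping.lookup (v [^]\<^bsub>FG\<^esub> n) g =
    (\<Sum>xs\<in>{xs. set xs \<subseteq> carrier G \<and> length xs = n}.
      if foldr (\<otimes>) xs \<one> = g then prod_list (map (Poly_Mapping.lookup v) xs) else 0)"
  using g
proof (induction n arbitrary: g)
  case 0
  have *: "{xs. set xs \<subseteq> carrier G \<and> length xs = 0} = {[]}" by auto
  show ?case unfolding * using 0 by (simp add: one_FG lookup_single when_def)
next
  case (Suc n)
  let ?L = "{xs. set xs \<subseteq> carrier G \<and> length xs = n}"
  have fold_closed: "foldr (\<otimes>) xs \<one> \<in> carrier G" if "set xs \<subseteq> carrier G" for xs
    using that by (induction xs) auto
  have "Poly_Mapping.lookup (v [^]\<^bsub>FG\<^esub> Suc n) g = Poly_Mapping.lookup (v \<otimes>\<^bsub>FG\<^esub> v [^]\<^bsub>FG\<^esub> n) g"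
    using FG.nat_pow_Suc2[OF v] by simp
  also have "\<dots> = (\<Sum>x\<in>carrier G. \<Sum>xs\<in>?L. if foldr (\<otimes>) xs \<one> = inv x \<otimes> g
       then Poly_Mapping.lookup v x * prod_list (map (Poly_Mapping.lookup v) xs) else 0)"
    unfolding lookup_mult_FG[OF v FG.nat_pow_closed[OF v] Suc.prems]
    by (intro sum.cong refl)
       (auto simp: Suc sum_distrib_left if_distrib[of "\<lambda>t. _ * t"] cong: if_cong)
  also have "\<dots> = (\<Sum>xs\<in>?L. \<Sum>x\<in>carrier G. if foldr (\<otimes>) (x # xs) \<one> = g
       then prod_list (map (Poly_Mapping.lookup v) (x # xs)) else 0)"
    by (subst sum.swap, intro sum.cong refl)
       (use fold_closed Suc.prems in \<open>auto simp: inv_mult_cancel\<close>)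
  also have "\<dots> = (\<Sum>(xs, x)\<in>?L \<times> carrier G. if foldr (\<otimes>) (x # xs) \<one> = g
       then prod_list (map (Poly_Mapping.lookup v) (x # xs)) else 0)"
    by (rule sum.cartesian_product)
  also have "\<dots> = (\<Sum>xs\<in>{xs. set xs \<subseteq> carrier G \<and> length xs = Suc n}.
      if foldr (\<otimes>) xs \<one> = g then prod_list (map (Poly_Mapping.lookup v) xs) else 0)"
    unfolding lists_length_Suc_eq
    by (subst sum.reindex) (auto intro!: inj_onI sum.cong simp: case_prod_beta)
  finally show ?case .
qed

end

context p_group_algebra
begin

text \<open>The words of length \<open>p\<close> are permuted by rotation, and only the constant
  words are fixed. The set \<open>S\<close> is invariant under conjugation, so the contribution
  of a word to the trace is invariant under rotation and only the constant words count.\<close>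

lemma tr_prime_power_map:
  assumes v: "v \<in> carrier FG" and S: "conj_closed S" "S \<subseteq> carrier G"
  shows "tr S (v [^]\<^bsub>FG\<^esub> p) = tr {x \<in> carrier G. x [^] p \<in> S} v ^ p"
proof -
  let ?L = "{xs. set xs \<subseteq> carrier G \<and> length xs = p}"
  define f where "f xs = (if foldr (\<otimes>) xs \<one> \<in> S then prod_list (map (Poly_Mapping.lookup v) xs) else 0)" for xs
  have p1: "p > 1" "p > 0" using prime_gt_1_nat[OF prime_p] by auto
  have finS: "finite S" using S(2) finite_carrier finite_subset by blast
  have finL: "finite ?L" using finite_lists_length_eq[OF finite_carrier] by simp
  have fold_closed: "foldr (\<otimes>) xs \<one> \<in> carrier G" if "set xs \<subseteq> carrier G" for xs
    using that by (induction xs) auto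
  have fold_snoc: "foldr (\<otimes>) (xs @ [x]) \<one> = foldr (\<otimes>) xs \<one> \<otimes> x" if "set xs \<subseteq> carrier G" "x \<in> carrier G" for xs x
    using that by (induction xs) (auto simp: m_assoc fold_closed)
  have f_rotate1: "f (rotate1 xs) = f xs" if "set xs \<subseteq> carrier G" for xs
  proof (cases xs)
    case (Cons x ys)
    then have "foldr (\<otimes>) ys \<one> \<otimes> x \<in> S \<longleftrightarrow> x \<otimes> foldr (\<otimes>) ys \<one> \<in> S"
    proof -
      have "x \<in> carrier G" "foldr (\<otimes>) ys \<one> \<in> carrier G" using that Cons fold_closed[of ys] by auto
      then show ?thesis using conj_closed_comm[OF S(1)] by blast
    qed
    then show ?thesis using Cons that by (auto simp: f_def fold_snoc simp del: foldr_append)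
  qed simp
  have f_rotate: "f (rotate k xs) = f xs" if "set xs \<subseteq> carrier G" for k xs
    using that by (induction k) (auto simp: f_rotate1)
  have "tr S (v [^]\<^bsub>FG\<^esub> p) = (\<Sum>g\<in>S. \<Sum>xs\<in>?L.
      if foldr (\<otimes>) xs \<one> = g then prod_list (map (Poly_Mapping.lookup v) xs) else 0)"
    unfolding tr_def by (intro sum.cong refl lookup_pow v) (use S in auto)
  also have "\<dots> = sum f ?L"
    by (subst sum.swap) (use finS in \<open>simp add: f_def\<close>)
  also have "\<dots> = sum f {xs\<in>?L. \<forall>i\<in>carrier (integer_mod_group p). (\<lambda>xs\<in>?L. rotate (nat i) xs) xs = xs}"
    by (rule group_action.sum_invariant_eq_sum_fixed[OF rotate_action[OF p1(2)] prime_p char_p, of 1])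
       (use finL p1 f_rotate in \<open>auto simp: order_def carrier_integer_mod_group\<close>)
  also have "{xs\<in>?L. \<forall>i\<in>carrier (integer_mod_group p). (\<lambda>xs\<in>?L. rotate (nat i) xs) xs = xs} = replicate p ` carrier G"
  proof (intro equalityI subsetI)
    fix xs assume xs: "xs \<in> {xs\<in>?L. \<forall>i\<in>carrier (integer_mod_group p). (\<lambda>xs\<in>?L. rotate (nat i) xs) xs = xs}"
    have "1 \<in> carrier (integer_mod_group p)" using p1 by (auto simp: carrier_integer_mod_group)
    then have "(\<lambda>xs\<in>?L. rotate (nat 1) xs) xs = xs" using xs by blast
    then have "rotate1 xs = xs" using xs by (simp add: rotate_def)
    moreover obtain y ys where "xs = y # ys" using xs p1 by (cases xs) auto
    ultimately show "xs \<in> replicate p ` carrier G"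
      using rotate1_fixed_imp_constant[of y ys] xs by auto
  next
    fix xs assume "xs \<in> replicate p ` carrier G"
    then obtain x where x: "x \<in> carrier G" "xs = replicate p x" by blast
    have "rotate k (replicate p x) = replicate p x" for k
    proof (induction k)
      case (Suc k)
      have "rotate1 (replicate m x) = replicate m x" for m
        by (cases m) (auto simp: replicate_append_same)
      then show ?case using Suc by simp
    qed simp
    then show "xs \<in> {xs\<in>?L. \<forall>i\<in>carrier (integer_mod_group p). (\<lambda>xs\<in>?L. rotate (nat i) xs) xs = xs}"
      using x by auto
  qed
  also have "sum f (replicate p ` carrier G) = (\<Sum>x\<in>carrier G. f (replicate p x))"
    using p1 by (subst sum.reindex) (auto intro!: inj_onI simp: replicate_eq_replicate)
  also have "\<dots> = (\<Sum>x\<in>carrier G. if x [^] p \<in> S then Poly_Mapping.lookup v x ^ p else 0)"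
  proof (intro sum.cong refl)
    fix x assume x: "x \<in> carrier G"
    have "foldr (\<otimes>) (replicate m x) \<one> = x [^] m" for m
    proof (induction m)
      case (Suc m)
      then show ?case using nat_pow_Suc2[OF x, of m] by simp
    qed simp
    moreover have "prod_list (map (Poly_Mapping.lookup v) (replicate m x)) = Poly_Mapping.lookup v x ^ m" for m
      by (induction m) auto
    ultimately show "f (replicate p x) = (if x [^] p \<in> S then Poly_Mapping.lookup v x ^ p else 0)"
      by (simp add: f_def)
  qed
  also have "\<dots> = (\<Sum>x\<in>{x \<in> carrier G. x [^] p \<in> S}. Poly_Mapping.lookup v x ^ p)"
    using finite_carrier by (simp add: sum.inter_filter)
  also have "\<dots> = tr {x \<in> carrier G. x [^] p \<in> S} v ^ p"
    unfolding tr_def using prime_p char_p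
    by (subst freshmans_dream_sum[of p]) auto
  finally show ?thesis .
qed

text \<open>Iterating needs no further combinatorics, because the set of elements with
  \<open>p\<close>-th power in \<open>S\<close> is again invariant under conjugation.\<close>

lemma tr_p_power_map:
  assumes v: "v \<in> carrier FG" and S: "conj_closed S" "S \<subseteq> carrier G"
  shows "tr S (v [^]\<^bsub>FG\<^esub> (p ^ k)) = tr {x \<in> carrier G. x [^] (p ^ k) \<in> S} v ^ (p ^ k)"
  using S
proof (induction k arbitrary: S)
  case 0
  then have "{x \<in> carrier G. x [^] (p ^ 0) \<in> S} = S" by auto
  then show ?case using v by (simp only:) simp
next
  case (Suc k)
  let ?S = "{x \<in> carrier G. x [^] p \<in> S}"
  have cl: "conj_closed ?S" "?S \<subseteq> carrier G"
    using Suc.prems by (auto simp: conj_closed_def pow_conj)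
  have "{x \<in> carrier G. x [^] (p ^ k) \<in> ?S} = {x \<in> carrier G. x [^] (p ^ Suc k) \<in> S}"
    by (auto simp: nat_pow_pow mult.commute)
  moreover have "tr S ((v [^]\<^bsub>FG\<^esub> (p ^ k)) [^]\<^bsub>FG\<^esub> p) = tr ?S (v [^]\<^bsub>FG\<^esub> (p ^ k)) ^ p"
    using Suc.prems v by (intro tr_prime_power_map) auto
  ultimately show ?case using Suc.IH[OF cl] v
    by (simp add: FG.nat_pow_pow power_mult[symmetric] mult.commute)
qed

end

section \<open>Ideals of central cyclic subgroups\<close>

text \<open>The recursion of the signed binomial coefficients, for an arbitrary sequence in
  place of powers.\<close>

lemma signed_binomial_step:
  fixes d :: "nat \<Rightarrow> 'f::comm_ring_1"
  defines "c \<equiv> \<lambda>n k. of_nat (n choose k) * (- 1) ^ (n - k) :: 'f"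
  shows "(\<Sum>k\<le>Suc n. c (Suc n) k * d k) = (\<Sum>k\<le>n. c n k * d (Suc k)) - (\<Sum>k\<le>n. c n k * d k)"
proof -
  have step: "c (Suc n) (Suc k) = c n k - c n (Suc k)" if "k \<le> n" for k
  proof (cases "k = n")
    case False
    then have "n - k = Suc (n - Suc k)" using that by simp
    then show ?thesis by (simp add: c_def algebra_simps)
  qed (simp add: c_def binomial_eq_0)
  have "(\<Sum>k\<le>Suc n. c (Suc n) k * d k) = c (Suc n) 0 * d 0 + (\<Sum>k\<le>n. c (Suc n) (Suc k) * d (Suc k))"
    by (rule sum.atMost_Suc_shift)
  also have "(\<Sum>k\<le>n. c (Suc n) (Suc k) * d (Suc k)) = (\<Sum>k\<le>n. c n k * d (Suc k)) - (\<Sum>k\<le>n. c n (Suc k) * d (Suc k))"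
    by (simp add: step left_diff_distrib sum_subtractf)
  also have "(\<Sum>k\<le>n. c n (Suc k) * d (Suc k)) = (\<Sum>k\<le>n. c n k * d k) - c n 0 * d 0"
  proof -
    have "(\<Sum>k\<le>Suc n. c n k * d k) = c n 0 * d 0 + (\<Sum>k\<le>n. c n (Suc k) * d (Suc k))"
      by (rule sum.atMost_Suc_shift)
    moreover have "(\<Sum>k\<le>Suc n. c n k * d k) = (\<Sum>k\<le>n. c n k * d k)"
      by (simp add: c_def binomial_eq_0)
    ultimately show ?thesis by (simp add: algebra_simps)
  qed
  finally show ?thesis by (simp add: c_def)
qed

context finite_group_algebra
begin

lemma subsp_singles:
  assumes U: "subsp U" and "\<And>y. y \<in> carrier G \<Longrightarrow> Poly_Mapping.single y 1 \<in> U" and v: "v \<in> carrier FG"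
  shows "v \<in> U"
  by (subst expansion[OF v]) (use assms in \<open>auto intro!: subsp_sum[OF U] simp: subsp_def\<close>)

lemma subsp_algebra_center_mod: "subsp (algebra_center_mod N)"
proof -
  have "(a + b) \<otimes>\<^bsub>FG\<^esub> u - u \<otimes>\<^bsub>FG\<^esub> (a + b) = (a \<otimes>\<^bsub>FG\<^esub> u - u \<otimes>\<^bsub>FG\<^esub> a) + (b \<otimes>\<^bsub>FG\<^esub> u - u \<otimes>\<^bsub>FG\<^esub> b)"
    if "a \<in> carrier FG" "b \<in> carrier FG" "u \<in> carrier FG" for a b u
    using FG.l_distr[of a b u] FG.r_distr[of a b u] that by (simp add: add_FG)
  moreover have "(c \<odot>\<^bsub>FG\<^esub> a) \<otimes>\<^bsub>FG\<^esub> u - u \<otimes>\<^bsub>FG\<^esub> (c \<odot>\<^bsub>FG\<^esub> a) = c \<odot>\<^bsub>FG\<^esub> (a \<otimes>\<^bsub>FG\<^esub> u - u \<otimes>\<^bsub>FG\<^esub> a)"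
    if "a \<in> carrier FG" "u \<in> carrier FG" for a c u
    using that by (intro poly_mapping_eqI) (simp add: smult_mult_FG lookup_minus lookup_smult algebra_simps)
  moreover have "0 \<otimes>\<^bsub>FG\<^esub> u - u \<otimes>\<^bsub>FG\<^esub> 0 = 0" if "u \<in> carrier FG" for u
    using that FG.l_null FG.r_null by (simp add: zero_FG)
  ultimately show ?thesis using subsp_aug_ideal[of N]
    by (auto simp: subsp_def algebra_center_mod_def)
qed

text \<open>The commutator of \<open>x\<close> with \<open>y\<close> is a difference of two
  elements of the same coset.\<close>

lemma single_in_algebra_center_mod:
  assumes N: "subgroup N G" and x: "x \<in> center_mod N"
  shows "Poly_Mapping.single x 1 \<in> algebra_center_mod N"
proof -
  have xG: "x \<in> carrier G" using x by (simp add: center_mod_def)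
  have s: "subsp (aug_ideal N)" by (rule subsp_aug_ideal)
  let ?x = "Poly_Mapping.single x (1::'f)"
  define U where "U = {u \<in> carrier FG. ?x \<otimes>\<^bsub>FG\<^esub> u - u \<otimes>\<^bsub>FG\<^esub> ?x \<in> aug_ideal N}"
  have "?x \<otimes>\<^bsub>FG\<^esub> (a + b) - (a + b) \<otimes>\<^bsub>FG\<^esub> ?x = (?x \<otimes>\<^bsub>FG\<^esub> a - a \<otimes>\<^bsub>FG\<^esub> ?x) + (?x \<otimes>\<^bsub>FG\<^esub> b - b \<otimes>\<^bsub>FG\<^esub> ?x)"
    if "a \<in> carrier FG" "b \<in> carrier FG" for a b
    using FG.l_distr[of a b ?x] FG.r_distr[of a b ?x] that xG by (simp add: add_FG)
  moreover have "?x \<otimes>\<^bsub>FG\<^esub> (c \<odot>\<^bsub>FG\<^esub> a) - (c \<odot>\<^bsub>FG\<^esub> a) \<otimes>\<^bsub>FG\<^esub> ?x = c \<odot>\<^bsub>FG\<^esub> (?x \<otimes>\<^bsub>FG\<^esub> a - a \<otimes>\<^bsub>FG\<^esub> ?x)"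
    if "a \<in> carrier FG" for a c
    using that xG by (intro poly_mapping_eqI) (simp add: smult_mult_FG lookup_minus lookup_smult algebra_simps)
  moreover have "?x \<otimes>\<^bsub>FG\<^esub> 0 - 0 \<otimes>\<^bsub>FG\<^esub> ?x = 0"
    using xG FG.l_null[of ?x] FG.r_null[of ?x] by (simp add: zero_FG)
  ultimately have U: "subsp U" using s by (auto simp: subsp_def U_def)
  have "Poly_Mapping.single y 1 \<in> U" if y: "y \<in> carrier G" for y
  proof -
    have n: "inv x \<otimes> (inv y \<otimes> x \<otimes> inv (inv y)) \<in> N"
      using x inv_closed[OF y] unfolding center_mod_def by blast
    have "(y \<otimes> x) \<otimes> (inv x \<otimes> (inv y \<otimes> x \<otimes> inv (inv y))) = x \<otimes> y"
      using xG y by (simp add: m_assoc inv_mult_cancel)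
    then show ?thesis using single_diff_in_aug_ideal[OF N _ n, of "y \<otimes> x"] xG y
      by (simp add: U_def single_mult_single)
  qed
  then have "u \<in> U" if "u \<in> carrier FG" for u using subsp_singles[OF U] that by blast
  then show ?thesis using xG by (auto simp: algebra_center_mod_def U_def)
qed

lemma aug_ideal_one: "aug_ideal {\<one>} = {0}"
proof -
  have "v = 0" if v: "v \<in> aug_ideal {\<one>}" for v
  proof (rule FG_eqI)
    show "v \<in> carrier FG" using v by (simp add: aug_ideal_def)
    fix g assume "g \<in> carrier G"
    then have "sat {\<one>} {g}" by (simp add: sat_def)
    then have "tr {g} v = 0" using v by (simp add: aug_ideal_def)
    then show "Poly_Mapping.lookup v g = Poly_Mapping.lookup 0 g" by (simp add: tr_def)
  qed simp
  then show ?thesis by (auto simp: aug_ideal_def tr_zero)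
qed

text \<open>The conjugacy class of \<open>x\<close> modulo \<open>M\<close> is a single coset,
  since \<open>x\<close> is central modulo \<open>N\<close>. These are the traces that detect
  the central elements.\<close>

lemma coset_sat_conj_closed:
  assumes N: "subgroup N G" and M: "M \<lhd> G" and NM: "N \<subseteq> M" and x: "x \<in> center_mod N"
  shows "sat M (x <# M)" "conj_closed (x <# M)"
proof -
  have sM: "subgroup M G" using M by (rule normal_imp_subgroup)
  have MG: "M \<subseteq> carrier G" by (rule subgroup.subset[OF sM])
  have xG: "x \<in> carrier G" using x by (simp add: center_mod_def)
  have "y \<otimes> n \<in> x <# M" if y: "y \<in> x <# M" and n: "n \<in> M" for y n
  proof -
    obtain m where m: "m \<in> M" "y = x \<otimes> m" using y unfolding l_coset_def by blast
    then have "y \<otimes> n = x \<otimes> (m \<otimes> n)" using xG n MG by (simp add: m_assoc subset_iff)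
    then show ?thesis using m n subgroup.m_closed[OF sM] unfolding l_coset_def by blast
  qed
  then show "sat M (x <# M)" using l_coset_subset_G[OF MG xG] by (simp add: sat_def)
  have "h \<otimes> y \<otimes> inv h \<in> x <# M" if y: "y \<in> x <# M" and h: "h \<in> carrier G" for y h
  proof -
    obtain m where m: "m \<in> M" "y = x \<otimes> m" using y unfolding l_coset_def by blast
    have "h \<otimes> y \<otimes> inv h = x \<otimes> (inv x \<otimes> (h \<otimes> x \<otimes> inv h) \<otimes> (h \<otimes> m \<otimes> inv h))"
      using m xG h MG by (simp add: m_assoc inv_mult_cancel subset_iff)
    moreover have "inv x \<otimes> (h \<otimes> x \<otimes> inv h) \<in> M" using x h NM by (auto simp: center_mod_def)
    ultimately show ?thesis using subgroup.m_closed[OF sM] normal_conj(1)[OF M m(1) h]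
      unfolding l_coset_def by blast
  qed
  then show "conj_closed (x <# M)" by (simp add: conj_closed_def)
qed

lemma single_minus_one_pow:
  assumes g: "g \<in> carrier G"
  shows "(Poly_Mapping.single g 1 - \<one>\<^bsub>FG\<^esub>) [^]\<^bsub>FG\<^esub> n =
    (\<Sum>k\<le>n. (of_nat (n choose k) * (- 1) ^ (n - k)) \<odot>\<^bsub>FG\<^esub> Poly_Mapping.single (g [^] k) (1::'f))"
proof (induction n)
  case 0
  show ?case by (simp add: one_FG) (rule poly_mapping_eqI, simp add: lookup_smult)
next
  case (Suc n)
  let ?d = "Poly_Mapping.single g 1 - \<one>\<^bsub>FG\<^esub>"
  let ?E = "\<Sum>k\<le>n. (of_nat (n choose k) * (- 1) ^ (n - k)) \<odot>\<^bsub>FG\<^esub> Poly_Mapping.single (g [^] k) (1::'f)"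
  have "subsp (carrier FG)" by (simp add: subsp_def)
  then have E: "?E \<in> carrier FG" using g by (intro subsp_sum smult_FG_closed single_FG) auto
  have "?E \<otimes>\<^bsub>FG\<^esub> ?d = ?E \<otimes>\<^bsub>FG\<^esub> Poly_Mapping.single g 1 - ?E"
    using E g by (simp add: diff_mult_FG)
  moreover have "Poly_Mapping.lookup (?E \<otimes>\<^bsub>FG\<^esub> Poly_Mapping.single g 1) x =
     (\<Sum>k\<le>n. (of_nat (n choose k) * (- 1) ^ (n - k)) * Poly_Mapping.lookup (Poly_Mapping.single (g [^] Suc k) 1) x)" for x
  proof (cases "x \<in> carrier G")
    case True
    then have "g [^] k = x \<otimes> inv g \<longleftrightarrow> g [^] k \<otimes> g = x" for k :: nat
      using inv_solve_right[of "g [^] k" x g] g True by (metis nat_pow_closed)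
    then have "Poly_Mapping.lookup (Poly_Mapping.single (g [^] k) (1::'f)) (x \<otimes> inv g) =
      Poly_Mapping.lookup (Poly_Mapping.single (g [^] Suc k) 1) x" for k :: nat
      by (simp add: lookup_single when_def)
    then show ?thesis unfolding lookup_mult_single_right[OF E g True] lookup_sum lookup_smult by simp
  next
    case False
    then have "g [^] k \<otimes> g \<noteq> x" for k :: nat using g by auto
    then show ?thesis using lookup_outside[OF mult_FG_closed[OF E single_FG[OF g]] False]
      by (simp add: lookup_single)
  qed
  ultimately have "Poly_Mapping.lookup (?E \<otimes>\<^bsub>FG\<^esub> ?d) x = Poly_Mapping.lookup (\<Sum>k\<le>Suc n.
     (of_nat (Suc n choose k) * (- 1) ^ (Suc n - k)) \<odot>\<^bsub>FG\<^esub> Poly_Mapping.single (g [^] k) (1::'f)) x" for x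
    using signed_binomial_step[of n "\<lambda>k. Poly_Mapping.lookup (Poly_Mapping.single (g [^] k) (1::'f)) x"]
    by (simp only: lookup_minus lookup_sum lookup_smult)
  then show ?case using Suc by (simp add: poly_mapping_eqI)
qed


lemma central_generate:
  assumes g: "g \<in> carrier G" and central: "\<And>x. x \<in> carrier G \<Longrightarrow> g \<otimes> x = x \<otimes> g"
  shows "generate G {g} \<lhd> G" and "\<And>x n. x \<in> carrier G \<Longrightarrow> n \<in> generate G {g} \<Longrightarrow> n \<otimes> x = x \<otimes> n"
proof -
  show c: "n \<otimes> x = x \<otimes> n" if x: "x \<in> carrier G" and n: "n \<in> generate G {g}" for x n
  proof -
    obtain k :: nat where k: "n = g [^] k"
      using n generate_pow_on_finite_carrier[OF finite_carrier g] by blast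
    have "g [^] k \<otimes> x = x \<otimes> g [^] k" using g x
      by (induction k) (simp_all add: m_assoc central[OF x], simp add: m_assoc[symmetric])
    then show ?thesis using k by simp
  qed
  have s: "subgroup (generate G {g}) G" using g by (simp add: generate_is_subgroup)
  have "x \<otimes> n \<otimes> inv x = n" if "x \<in> carrier G" "n \<in> generate G {g}" for x n
    using c[OF that] that subgroup.mem_carrier[OF s that(2)] by (metis inv_solve_right m_closed)
  then show "generate G {g} \<lhd> G" using s by (simp add: normal_inv_iff)
qed

text \<open>A telescoping sum: \<open>x g^k - x\<close> is a left multiple of \<open>g -
  1\<close>.\<close>

lemma single_pow_diff_in_subsp:
  assumes U: "subsp U" and ideal: "\<And>v u. v \<in> U \<Longrightarrow> u \<in> carrier FG \<Longrightarrow> u \<otimes>\<^bsub>FG\<^esub> v \<in> U"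
    and g: "g \<in> carrier G" and gU: "Poly_Mapping.single g 1 - \<one>\<^bsub>FG\<^esub> \<in> U" and x: "x \<in> carrier G"
  shows "Poly_Mapping.single (x \<otimes> g [^] (k::nat)) 1 - Poly_Mapping.single x 1 \<in> U"
proof (induction k)
  case 0
  then show ?case using x U by (simp add: subsp_def)
next
  case (Suc k)
  let ?y = "Poly_Mapping.single (x \<otimes> g [^] k) (1::'f)"
  have "?y \<otimes>\<^bsub>FG\<^esub> (Poly_Mapping.single g 1 - \<one>\<^bsub>FG\<^esub>) \<in> U" using ideal[OF gU] x g by simp
  then have "?y \<otimes>\<^bsub>FG\<^esub> (Poly_Mapping.single g 1 - \<one>\<^bsub>FG\<^esub>) + (?y - Poly_Mapping.single x 1) \<in> U"
    using Suc U unfolding subsp_def by blast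
  moreover have "?y \<otimes>\<^bsub>FG\<^esub> (Poly_Mapping.single g 1 - \<one>\<^bsub>FG\<^esub>) = Poly_Mapping.single (x \<otimes> g [^] Suc k) 1 - ?y"
    using x g by (simp add: diff_mult_FG single_mult_single m_assoc)
  ultimately show ?case by simp
qed

lemma central_single_commute:
  assumes g: "g \<in> carrier G" and central: "\<And>x. x \<in> carrier G \<Longrightarrow> g \<otimes> x = x \<otimes> g" and u: "u \<in> carrier FG"
  shows "Poly_Mapping.single g 1 \<otimes>\<^bsub>FG\<^esub> u = u \<otimes>\<^bsub>FG\<^esub> Poly_Mapping.single g 1"
proof (rule FG_eqI)
  fix x assume x: "x \<in> carrier G"
  have "inv g \<otimes> x = inv g \<otimes> (x \<otimes> g) \<otimes> inv g" using g x by (simp add: m_assoc)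
  also have "\<dots> = x \<otimes> inv g" unfolding central[OF x, symmetric] using g x by (simp add: m_assoc inv_mult_cancel)
  finally show "Poly_Mapping.lookup (Poly_Mapping.single g 1 \<otimes>\<^bsub>FG\<^esub> u) x =
      Poly_Mapping.lookup (u \<otimes>\<^bsub>FG\<^esub> Poly_Mapping.single g 1) x"
    by (simp add: lookup_mult_single g u x)
qed (simp_all add: g u mult_FG_closed)

text \<open>For central \<open>g\<close> the ideal is principal. The multiples of \<open>g -
  1\<close> form an ideal, which contains the generators of \<open>aug_ideal\<close> and is
  therefore not smaller.\<close>

lemma aug_ideal_generate:
  assumes g: "g \<in> carrier G" and central: "\<And>x. x \<in> carrier G \<Longrightarrow> g \<otimes> x = x \<otimes> g"
    and w: "w \<in> aug_ideal (generate G {g})"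
  obtains u where "u \<in> carrier FG" "w = (Poly_Mapping.single g 1 - \<one>\<^bsub>FG\<^esub>) \<otimes>\<^bsub>FG\<^esub> u"
proof -
  let ?d = "Poly_Mapping.single g 1 - \<one>\<^bsub>FG\<^esub>"
  define U where "U = {?d \<otimes>\<^bsub>FG\<^esub> u | u. u \<in> carrier FG}"
  have d: "?d \<in> carrier FG" using g by simp
  have comm: "u \<otimes>\<^bsub>FG\<^esub> ?d = ?d \<otimes>\<^bsub>FG\<^esub> u" if "u \<in> carrier FG" for u
    using central_single_commute[OF g central that] that g by (simp add: diff_mult_FG)
  have UI: "?d \<otimes>\<^bsub>FG\<^esub> u \<in> U" if "u \<in> carrier FG" for u using that unfolding U_def by blast
  have U: "subsp U"
    unfolding subsp_def
  proof (intro conjI ballI allI)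
    show "U \<subseteq> carrier FG" unfolding U_def using mult_FG_closed[OF d] by blast
    show "0 \<in> U" using UI[OF zero_in_FG] FG.r_null[OF d] by (simp add: zero_FG)
  next
    fix a b assume "a \<in> U" "b \<in> U"
    then obtain s t where st: "s \<in> carrier FG" "t \<in> carrier FG" "a = ?d \<otimes>\<^bsub>FG\<^esub> s" "b = ?d \<otimes>\<^bsub>FG\<^esub> t"
      unfolding U_def by blast
    then have "a + b = ?d \<otimes>\<^bsub>FG\<^esub> (s + t)" using FG.r_distr[of s t ?d] d by (simp add: add_FG)
    then show "a + b \<in> U" using UI[of "s + t"] st by simp
  next
    fix c a assume "a \<in> U"
    then obtain t where t: "t \<in> carrier FG" "a = ?d \<otimes>\<^bsub>FG\<^esub> t" unfolding U_def by blast
    then have "c \<odot>\<^bsub>FG\<^esub> a = ?d \<otimes>\<^bsub>FG\<^esub> (c \<odot>\<^bsub>FG\<^esub> t)" using smult_mult_FG(2)[OF d t(1)] by simp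
    then show "c \<odot>\<^bsub>FG\<^esub> a \<in> U" using UI[OF smult_FG_closed[OF t(1)]] by simp
  qed
  have ideal: "u \<otimes>\<^bsub>FG\<^esub> v \<in> U" if "v \<in> U" "u \<in> carrier FG" for u v
  proof -
    obtain t where t: "t \<in> carrier FG" "v = ?d \<otimes>\<^bsub>FG\<^esub> t" using \<open>v \<in> U\<close> unfolding U_def by blast
    have "u \<otimes>\<^bsub>FG\<^esub> v = ?d \<otimes>\<^bsub>FG\<^esub> (u \<otimes>\<^bsub>FG\<^esub> t)"
      unfolding t(2) FG.m_assoc[OF that(2) d t(1), symmetric] FG.m_assoc[OF d that(2) t(1), symmetric] comm[OF that(2)]
      by (rule refl)
    then show ?thesis using UI[OF mult_FG_closed[OF that(2) t(1)]] by (simp only:)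
  qed
  have "?d \<in> U" using UI[OF FG.one_closed] unfolding FG.r_one[OF d] .
  moreover have "subgroup (generate G {g}) G" using g by (simp add: generate_is_subgroup)
  ultimately have "aug_ideal (generate G {g}) \<subseteq> U"
  proof (intro aug_ideal_least[OF U])
    fix x n assume x: "x \<in> carrier G" and n: "n \<in> generate G {g}"
    obtain k :: nat where "n = g [^] k"
      using n generate_pow_on_finite_carrier[OF finite_carrier g] by blast
    then show "Poly_Mapping.single (x \<otimes> n) 1 - Poly_Mapping.single x 1 \<in> U"
      using single_pow_diff_in_subsp[OF U ideal g \<open>?d \<in> U\<close> x] by blast
  qed
  then show thesis using w that unfolding U_def by blast
qed

end

context p_group_algebra
begin

text \<open>In characteristic \<open>p\<close> only the two extreme terms of the binomial
  expansion remain.\<close>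

lemma single_minus_one_p_pow:
  assumes g: "g \<in> carrier G"
  shows "(Poly_Mapping.single g 1 - \<one>\<^bsub>FG\<^esub>) [^]\<^bsub>FG\<^esub> (p ^ j) = Poly_Mapping.single (g [^] (p ^ j)) 1 - \<one>\<^bsub>FG\<^esub>"
proof (induction j)
  case 0
  then show ?case using g by simp
next
  case (Suc j)
  have *: "(Poly_Mapping.single h 1 - \<one>\<^bsub>FG\<^esub>) [^]\<^bsub>FG\<^esub> p = Poly_Mapping.single (h [^] p) 1 - \<one>\<^bsub>FG\<^esub>"
    if h: "h \<in> carrier G" for h
  proof (rule poly_mapping_eqI)
    fix x
    let ?l = "\<lambda>k. Poly_Mapping.lookup (Poly_Mapping.single (h [^] k) (1::'f)) x"
    have p1: "p > 1" by (rule prime_gt_1_nat[OF prime_p])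
    have c0: "of_nat (p choose k) = (0::'f)" if "k \<in> {1..<p}" for k
      using that dvd_choose_prime[of k p] prime_p char_p by (simp add: of_nat_eq_0_iff_char_dvd)
    have "{..p} = insert 0 (insert p {1..<p})" using p1 by auto
    then have "(\<Sum>k\<le>p. of_nat (p choose k) * (- 1) ^ (p - k) * ?l k) =
      (\<Sum>k\<in>insert 0 (insert p {1..<p}). of_nat (p choose k) * (- 1) ^ (p - k) * ?l k)"
      by (rule sum.cong) (rule refl)
    also have "\<dots> = (- 1) ^ p * ?l (0::nat) + (?l p + (\<Sum>k\<in>{1..<p}. of_nat (p choose k) * (- 1) ^ (p - k) * ?l k))"
      using p1 by (subst sum.insert, simp, simp, subst sum.insert) simp_all
    also have "(\<Sum>k\<in>{1..<p}. of_nat (p choose k) * (- 1) ^ (p - k) * ?l k) = 0"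
      by (intro sum.neutral ballI) (simp only: c0 mult_zero_left)
    also have "(- 1 :: 'f) ^ p = - 1"
    proof -
      have "Factorial_Ring.prime CHAR('f)" using prime_p char_p by simp
      then have "(1 + (- 1 :: 'f)) ^ p = 1 ^ p + (- 1) ^ p"
        using char_p by (intro freshmans_dream) auto
      then have "1 + (- 1 :: 'f) ^ p = 0" using p1 by (simp add: power_0_left)
      then show ?thesis by (simp add: eq_neg_iff_add_eq_0 add.commute)
    qed
    finally have "(\<Sum>k\<le>p. of_nat (p choose k) * (- 1) ^ (p - k) * ?l k) = ?l p - ?l (0::nat)" by simp
    then show "Poly_Mapping.lookup ((Poly_Mapping.single h 1 - \<one>\<^bsub>FG\<^esub>) [^]\<^bsub>FG\<^esub> p) x =
        Poly_Mapping.lookup (Poly_Mapping.single (h [^] p) 1 - \<one>\<^bsub>FG\<^esub>) x"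
      by (simp only: single_minus_one_pow[OF h] lookup_sum lookup_smult lookup_minus) (simp add: one_FG)
  qed
  let ?d = "Poly_Mapping.single g 1 - \<one>\<^bsub>FG\<^esub>"
  have "?d [^]\<^bsub>FG\<^esub> (p ^ Suc j) = (?d [^]\<^bsub>FG\<^esub> (p ^ j)) [^]\<^bsub>FG\<^esub> p"
    using FG.nat_pow_pow[of ?d "p ^ j" p] g by (simp add: mult.commute)
  also have "\<dots> = Poly_Mapping.single ((g [^] (p ^ j)) [^] p) 1 - \<one>\<^bsub>FG\<^esub>"
    unfolding Suc using g by (intro *) simp
  also have "(g [^] (p ^ j)) [^] p = g [^] (p ^ Suc j)"
    using nat_pow_pow[OF g, of "p ^ j" p] by (simp add: mult.commute)
  finally show ?case .
qed

text \<open>Writing \<open>w = (g - 1) u\<close> with \<open>g - 1\<close> central gives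
  \<open>w^(p^j) = (g^(p^j) - 1) u^(p^j)\<close>. Raising to a power of \<open>p\<close> is thus
  a purely ring-theoretic way from the ideal of a central cyclic group to that of its subgroups.\<close>

lemma aug_ideal_generate_pow:
  assumes g: "g \<in> carrier G" and central: "\<And>x. x \<in> carrier G \<Longrightarrow> g \<otimes> x = x \<otimes> g"
    and w: "w \<in> aug_ideal (generate G {g})"
  shows "w [^]\<^bsub>FG\<^esub> (p ^ j) \<in> aug_ideal (generate G {g [^] (p ^ j)})"
proof -
  obtain u where u: "u \<in> carrier FG" "w = (Poly_Mapping.single g 1 - \<one>\<^bsub>FG\<^esub>) \<otimes>\<^bsub>FG\<^esub> u"
    using aug_ideal_generate[OF g central w] by blast
  let ?d = "Poly_Mapping.single g 1 - \<one>\<^bsub>FG\<^esub>"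
  let ?c = "g [^] (p ^ j)"
  have c: "?c \<in> carrier G" using g by simp
  have cc: "?c \<in> generate G {?c}" by (simp add: generate.incl)
  have cg: "?c \<in> generate G {g}" using generate_pow_on_finite_carrier[OF finite_carrier g] by blast
  have ccent: "?c \<otimes> x = x \<otimes> ?c" if "x \<in> carrier G" for x
    by (rule central_generate(2)[OF g central that cg])
  have du: "?d \<otimes>\<^bsub>FG\<^esub> u = u \<otimes>\<^bsub>FG\<^esub> ?d"
    using central_single_commute[OF g central u(1)] u(1) g by (simp add: diff_mult_FG)
  have "w [^]\<^bsub>FG\<^esub> (p ^ j) = (?d [^]\<^bsub>FG\<^esub> (p ^ j)) \<otimes>\<^bsub>FG\<^esub> (u [^]\<^bsub>FG\<^esub> (p ^ j))"
    unfolding u(2) by (rule FG.pow_mult_distrib[OF du _ u(1)]) (use g in simp)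
  also have "?d [^]\<^bsub>FG\<^esub> (p ^ j) = Poly_Mapping.single (\<one> \<otimes> ?c) 1 - Poly_Mapping.single \<one> 1"
    using single_minus_one_p_pow[OF g] g by (simp add: one_FG)
  also have "\<dots> \<otimes>\<^bsub>FG\<^esub> (u [^]\<^bsub>FG\<^esub> (p ^ j)) \<in> aug_ideal (generate G {?c})"
    by (intro aug_ideal_mult(1)[OF central_generate(1)[OF c ccent]] single_diff_in_aug_ideal
      generate_is_subgroup cc FG.nat_pow_closed u) (use c in auto)
  finally show ?thesis .
qed

text \<open>The traces of \<open>v\<close> over classes outside the preimage of the centre
  vanish by \<open>tr_noncentral_eq_0\<close>, and inside it the classes are the cosets in the
  hypothesis.\<close>

lemma trace_kernel_from_cosets:
  assumes N: "N \<lhd> G" and M: "M \<lhd> G" and NM: "N \<subseteq> M" and v: "v \<in> algebra_center_mod N"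
    and z: "\<And>x. x \<in> center_mod N \<Longrightarrow> tr (x <# M) v = 0"
  shows "v \<in> trace_kernel M"
proof -
  have sN: "subgroup N G" and sM: "subgroup M G" using N M by (auto dest: normal_imp_subgroup)
  have "tr S v = 0" if S: "sat M S" "conj_closed S" for S
  proof -
    have SG: "S \<subseteq> carrier G" using S by (simp add: sat_def)
    define R where "R = (\<Union>x\<in>center_mod N \<inter> S. x <# M)"
    have cG: "x \<in> carrier G" if "x \<in> center_mod N" for x using that by (simp add: center_mod_def)
    have RS: "R \<subseteq> S" using S(1) unfolding R_def l_coset_def sat_def by blast
    have Rsat: "sat M R"
      using coset_sat_conj_closed(1)[OF sN M NM] unfolding R_def sat_def by blast
    have Rconj: "conj_closed R"
      using coset_sat_conj_closed(2)[OF sN M NM] unfolding R_def conj_closed_def by blast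
    have "(\<lambda>x. x <# M) ` R \<subseteq> (\<lambda>x. x <# M) ` center_mod N"
    proof
      fix A assume "A \<in> (\<lambda>x. x <# M) ` R"
      then obtain y x where "x \<in> center_mod N" "y \<in> x <# M" "A = y <# M" unfolding R_def by blast
      then show "A \<in> (\<lambda>x. x <# M) ` center_mod N"
        using l_repr_independence[OF _ cG sM] by blast
    qed
    then have "tr R v = 0" using tr_coset_sum[OF sM Rsat, of v] z by (auto intro!: sum.neutral)
    moreover have "tr (S - R) v = 0"
    proof (rule tr_noncentral_eq_0[OF N v])
      have "x \<otimes> n \<in> S - R" if "x \<in> S - R" "n \<in> N" for x n
      proof -
        have "n \<in> M" "x \<in> carrier G" using that NM SG by auto
        then have "x \<otimes> n \<in> S" "x \<otimes> n \<notin> R"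
          using that S(1) sat_iff[OF sM Rsat \<open>x \<in> carrier G\<close> \<open>n \<in> M\<close>] by (auto simp: sat_def)
        then show ?thesis by blast
      qed
      then show "sat N (S - R)" using SG unfolding sat_def by blast
      have "h \<otimes> x \<otimes> inv h \<in> S - R" if x: "x \<in> S - R" and h: "h \<in> carrier G" for x h
      proof -
        have xG: "x \<in> carrier G" using x SG by blast
        have "h \<otimes> x \<otimes> inv h \<notin> R"
        proof
          assume "h \<otimes> x \<otimes> inv h \<in> R"
          then have "inv h \<otimes> (h \<otimes> x \<otimes> inv h) \<otimes> inv (inv h) \<in> R"
            using Rconj h unfolding conj_closed_def by blast
          then show False using x xG h by (simp add: m_assoc inv_mult_cancel)
        qed
        then show ?thesis using x h S(2) unfolding conj_closed_def by blast
      qed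
      then show "conj_closed (S - R)" unfolding conj_closed_def by blast
      have "x \<in> R" if "x \<in> center_mod N" "x \<in> S" for x
        using that lcos_self[OF cG sM] unfolding R_def by blast
      then show "(S - R) \<inter> center_mod N = {}" by blast
    qed
    ultimately show ?thesis
      using tr_disjoint_union[of R "S - R" v] RS SG by (simp add: Un_absorb1 Diff_subset subset_trans[OF _ SG])
  qed
  then show ?thesis using v by (simp add: trace_kernel_def algebra_center_mod_def)
qed

text \<open>Let \<open>v\<close> be central modulo \<open>N\<close>. Traces of
  \<open>v^(p^k)\<close> are powers of traces of \<open>v\<close> over sets of elements with a
  given \<open>p^k\<close>-th power. Such a set is a union of cosets of \<open>N\<close>,
  because \<open>N\<close> is central and killed by \<open>p^k\<close>. If its power is not 1 it
  contains no element that is central modulo \<open>N\<close>, and the trace is zero. Conversely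
  a central \<open>x\<close> is itself a test element: if \<open>x^(p^k) \<noteq> 1\<close>,
  then the trace over the nontrivial elements separates \<open>x^(p^k)\<close> from the scalars.\<close>

lemma center_mod_power_iff:
  assumes N: "N \<lhd> G" and central: "\<And>x n. x \<in> carrier G \<Longrightarrow> n \<in> N \<Longrightarrow> n \<otimes> x = x \<otimes> n"
    and ex: "\<And>n. n \<in> N \<Longrightarrow> n [^] (p ^ k) = \<one>"
  shows "(\<forall>x\<in>center_mod N. x [^] (p ^ k) = \<one>) \<longleftrightarrow>
    (\<forall>v\<in>algebra_center_mod N. \<exists>c. v [^]\<^bsub>FG\<^esub> (p ^ k) - c \<odot>\<^bsub>FG\<^esub> \<one>\<^bsub>FG\<^esub> \<in> trace_kernel {\<one>})"
proof (intro iffI ballI)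
  have sN: "subgroup N G" using N by (rule normal_imp_subgroup)
  have NG: "N \<subseteq> carrier G" by (rule subgroup.subset[OF sN])
  fix v assume all: "\<forall>x\<in>center_mod N. x [^] (p ^ k) = \<one>" and v: "v \<in> algebra_center_mod N"
  have vFG: "v \<in> carrier FG" using v by (simp add: algebra_center_mod_def)
  define c where "c = tr {\<one>} (v [^]\<^bsub>FG\<^esub> (p ^ k))"
  have tr0: "tr S (v [^]\<^bsub>FG\<^esub> (p ^ k)) = 0" if S: "conj_closed S" "S \<subseteq> carrier G" "\<one> \<notin> S" for S
  proof -
    define R where "R = {x \<in> carrier G. x [^] (p ^ k) \<in> S}"
    have "tr R v = 0"
    proof (rule tr_noncentral_eq_0[OF N v])
      have "(x \<otimes> n) [^] (p ^ k) = x [^] (p ^ k)" if "x \<in> carrier G" "n \<in> N" for x n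
        using pow_mult_distrib[of x n "p ^ k"] central[OF that] ex[OF that(2)] that NG by (auto simp: subset_iff)
      then show "sat N R" using NG by (auto simp: R_def sat_def)
      show "conj_closed R" using S by (auto simp: R_def conj_closed_def pow_conj)
      show "R \<inter> center_mod N = {}" using all S(3) by (auto simp: R_def)
    qed
    then show ?thesis using tr_p_power_map[OF vFG S(1,2), of k] prime_gt_0_nat[OF prime_p]
      by (simp add: R_def)
  qed
  have "tr S (v [^]\<^bsub>FG\<^esub> (p ^ k) - c \<odot>\<^bsub>FG\<^esub> \<one>\<^bsub>FG\<^esub>) = 0" if S: "conj_closed S" "S \<subseteq> carrier G" for S
  proof (cases "\<one> \<in> S")
    case False
    then show ?thesis using tr0[OF S] S by (simp add: tr_diff tr_smult one_FG tr_single)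
  next
    case True
    have "conj_closed (S - {\<one>})"
    proof -
      have "x = \<one>" if "h \<otimes> x \<otimes> inv h = \<one>" "h \<in> carrier G" "x \<in> carrier G" for x h
        using that by (metis inv_solve_right' l_cancel_one one_closed m_closed l_one)
      then show ?thesis using S unfolding conj_closed_def by blast
    qed
    then have "tr (S - {\<one>}) (v [^]\<^bsub>FG\<^esub> (p ^ k)) = 0" using S by (intro tr0) auto
    moreover have "tr S w = tr {\<one>} w + tr (S - {\<one>}) w" for w
      using tr_disjoint_union[of "{\<one>}" "S - {\<one>}" w] True S by (simp add: insert_absorb subset_iff)
    moreover have "S - {\<one>} \<subseteq> carrier G" using S by blast
    ultimately show ?thesis using S True by (simp add: c_def tr_diff tr_smult one_FG tr_single)
  qed
  then show "\<exists>c. v [^]\<^bsub>FG\<^esub> (p ^ k) - c \<odot>\<^bsub>FG\<^esub> \<one>\<^bsub>FG\<^esub> \<in> trace_kernel {\<one>}"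
    using vFG by (intro exI[of _ c]) (auto simp: trace_kernel_def sat_def)
next
  have sN: "subgroup N G" using N by (rule normal_imp_subgroup)
  fix x assume all: "\<forall>v\<in>algebra_center_mod N. \<exists>c. v [^]\<^bsub>FG\<^esub> (p ^ k) - c \<odot>\<^bsub>FG\<^esub> \<one>\<^bsub>FG\<^esub> \<in> trace_kernel {\<one>}"
    and x: "x \<in> center_mod N"
  have xG: "x \<in> carrier G" using x by (simp add: center_mod_def)
  obtain c where c: "Poly_Mapping.single (x [^] (p ^ k)) 1 - c \<odot>\<^bsub>FG\<^esub> \<one>\<^bsub>FG\<^esub> \<in> trace_kernel {\<one>}"
    using all single_in_algebra_center_mod[OF sN x] single_pow[OF xG] by metis
  show "x [^] (p ^ k) = \<one>"
  proof (rule ccontr)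
    assume ne: "x [^] (p ^ k) \<noteq> \<one>"
    let ?S = "carrier G - {\<one>}"
    have "sat {\<one>} ?S" by (auto simp: sat_def)
    moreover have "conj_closed ?S"
    proof -
      have "x = \<one>" if "h \<otimes> x \<otimes> inv h = \<one>" "h \<in> carrier G" "x \<in> carrier G" for x h
        using that by (metis inv_solve_right' l_cancel_one one_closed m_closed l_one)
      then show ?thesis unfolding conj_closed_def by blast
    qed
    ultimately have "tr ?S (Poly_Mapping.single (x [^] (p ^ k)) 1 - c \<odot>\<^bsub>FG\<^esub> \<one>\<^bsub>FG\<^esub>) = 0"
      using c by (simp add: trace_kernel_def)
    moreover have "tr ?S (Poly_Mapping.single (x [^] (p ^ k)) 1 - c \<odot>\<^bsub>FG\<^esub> \<one>\<^bsub>FG\<^esub>) = 1"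
      using ne xG by (simp add: tr_diff tr_smult one_FG tr_single)
    ultimately show False by simp
  qed
qed

end

section \<open>Isomorphisms of group algebras\<close>

locale algebra_isomorphism =
  fixes G :: "('g, 'm) monoid_scheme" and H :: "('h, 'n) monoid_scheme"
    and F :: "'f::field itself" and \<phi> :: "('g \<Rightarrow>\<^sub>0 'f) \<Rightarrow> ('h \<Rightarrow>\<^sub>0 'f)"
  assumes iso: "\<phi> \<in> algebra_iso (group_algebra F G) (group_algebra F H)"
begin

abbreviation "AG \<equiv> group_algebra F G"
abbreviation "AH \<equiv> group_algebra F H"

lemma phi_bij: "bij_betw \<phi> (carrier AG) (carrier AH)"
  and phi_closed: "a \<in> carrier AG \<Longrightarrow> \<phi> a \<in> carrier AH"
  and phi_mult: "a \<in> carrier AG \<Longrightarrow> b \<in> carrier AG \<Longrightarrow> \<phi> (a \<otimes>\<^bsub>AG\<^esub> b) = \<phi> a \<otimes>\<^bsub>AH\<^esub> \<phi> b"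
  and phi_add': "a \<in> carrier AG \<Longrightarrow> b \<in> carrier AG \<Longrightarrow> \<phi> (a \<oplus>\<^bsub>AG\<^esub> b) = \<phi> a \<oplus>\<^bsub>AH\<^esub> \<phi> b"
  and phi_one: "\<phi> \<one>\<^bsub>AG\<^esub> = \<one>\<^bsub>AH\<^esub>"
  and phi_smult: "a \<in> carrier AG \<Longrightarrow> \<phi> (c \<odot>\<^bsub>AG\<^esub> a) = c \<odot>\<^bsub>AH\<^esub> \<phi> a"
  using iso by (auto simp: algebra_iso_def ring_iso_def ring_hom_def)

lemma carrier_iff: "a \<in> carrier AG \<longleftrightarrow> (\<forall>g. g \<notin> carrier G \<longrightarrow> Poly_Mapping.lookup a g = 0)"
  by (auto simp: group_algebra_def in_keys_iff subset_iff)

lemma lookup_smult_general: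
  "Poly_Mapping.lookup (c \<odot>\<^bsub>group_algebra F K\<^esub> a) g = c * Poly_Mapping.lookup a g"
  by (simp add: group_algebra_def Poly_Mapping.map.rep_eq when_def)

lemma carrier_closed:
  "a \<in> carrier AG \<Longrightarrow> b \<in> carrier AG \<Longrightarrow> a + b \<in> carrier AG"
  "a \<in> carrier AG \<Longrightarrow> b \<in> carrier AG \<Longrightarrow> a - b \<in> carrier AG"
  "a \<in> carrier AG \<Longrightarrow> c \<odot>\<^bsub>AG\<^esub> a \<in> carrier AG"
  "0 \<in> carrier AG"
  by (simp_all add: carrier_iff lookup_add lookup_minus lookup_smult_general)

lemma phi_add: "a \<in> carrier AG \<Longrightarrow> b \<in> carrier AG \<Longrightarrow> \<phi> (a + b) = \<phi> a + \<phi> b"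
  using phi_add' by (simp add: group_algebra_def)

lemma phi_diff: "a \<in> carrier AG \<Longrightarrow> b \<in> carrier AG \<Longrightarrow> \<phi> (a - b) = \<phi> a - \<phi> b"
  using phi_add[of "a - b" b] carrier_closed(2)[of a b] by simp

lemma phi_zero: "\<phi> 0 = 0"
  using phi_diff[of 0 0] carrier_closed(4) by simp

lemma phi_eq_iff: "a \<in> carrier AG \<Longrightarrow> b \<in> carrier AG \<Longrightarrow> \<phi> a = \<phi> b \<longleftrightarrow> a = b"
  using phi_bij by (auto simp: bij_betw_def inj_on_def)

lemma phi_surj: "b \<in> carrier AH \<Longrightarrow> \<exists>a\<in>carrier AG. \<phi> a = b"
  by (metis bij_betw_imp_surj_on[OF phi_bij] imageE)

lemma sum_closed:
  assumes "\<And>t. t \<in> T \<Longrightarrow> u t \<in> carrier AG"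
  shows "(\<Sum>t\<in>T. c t \<odot>\<^bsub>AG\<^esub> u t) \<in> carrier AG"
  using assms by (induction T rule: infinite_finite_induct) (simp_all add: carrier_closed)

lemma phi_sum:
  assumes "\<And>t. t \<in> T \<Longrightarrow> u t \<in> carrier AG"
  shows "\<phi> (\<Sum>t\<in>T. c t \<odot>\<^bsub>AG\<^esub> u t) = (\<Sum>t\<in>T. c t \<odot>\<^bsub>AH\<^esub> \<phi> (u t))"
  using assms
proof (induction T rule: infinite_finite_induct)
  case (insert t T)
  then have "\<phi> (c t \<odot>\<^bsub>AG\<^esub> u t + (\<Sum>t\<in>T. c t \<odot>\<^bsub>AG\<^esub> u t)) =
      \<phi> (c t \<odot>\<^bsub>AG\<^esub> u t) + \<phi> (\<Sum>t\<in>T. c t \<odot>\<^bsub>AG\<^esub> u t)"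
    by (intro phi_add carrier_closed(3) sum_closed) auto
  with insert show ?case by (simp add: phi_smult)
qed (simp_all add: phi_zero)

lemma lookup_combination_of_singles:
  assumes "finite T" "t \<in> T"
  shows "Poly_Mapping.lookup (\<Sum>t\<in>T. c t \<odot>\<^bsub>group_algebra F K\<^esub> Poly_Mapping.single t 1) t = c t"
proof -
  have "Poly_Mapping.lookup (\<Sum>t\<in>T. c t \<odot>\<^bsub>group_algebra F K\<^esub> Poly_Mapping.single t 1) t =
    (\<Sum>s\<in>T. if s = t then c s else 0)"
    unfolding lookup_sum lookup_smult_general by (intro sum.cong) (auto simp: lookup_single)
  then show ?thesis using assms by simp
qed

text \<open>The preimages of the group elements in \<open>T\<close> are linearly independent in
  \<open>FG\<close>. Only \<open>G\<close> is assumed to be finite, so that this also bounds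
  \<open>H\<close>.\<close>

lemma card_le_of_finite:
  assumes "finite (carrier G)" "T \<subseteq> carrier H" "finite T"
  shows "card T \<le> card (carrier G)"
proof -
  have "\<exists>u\<in>carrier AG. \<phi> u = Poly_Mapping.single t 1" if "t \<in> T" for t
    by (rule phi_surj) (use that assms(2) in \<open>auto simp: group_algebra_def\<close>)
  then obtain u where u: "\<And>t. t \<in> T \<Longrightarrow> u t \<in> carrier AG" "\<And>t. t \<in> T \<Longrightarrow> \<phi> (u t) = Poly_Mapping.single t 1"
    by metis
  show ?thesis
  proof (rule steinitz_functions[of _ _ "\<lambda>t g. Poly_Mapping.lookup (u t) g", OF assms(1,3)])
    fix c assume c: "\<And>g. g \<in> carrier G \<Longrightarrow> (\<Sum>t\<in>T. c t * Poly_Mapping.lookup (u t) g) = 0"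
    have "(\<Sum>t\<in>T. c t \<odot>\<^bsub>AG\<^esub> u t) = 0"
    proof (rule poly_mapping_eqI)
      fix g
      show "Poly_Mapping.lookup (\<Sum>t\<in>T. c t \<odot>\<^bsub>AG\<^esub> u t) g = Poly_Mapping.lookup 0 g"
      proof (cases "g \<in> carrier G")
        case False
        then have "Poly_Mapping.lookup (u t) g = 0" if "t \<in> T" for t
          using u(1)[OF that] by (auto simp: group_algebra_def in_keys_iff)
        then show ?thesis by (simp add: lookup_sum lookup_smult_general)
      qed (simp add: lookup_sum lookup_smult_general c)
    qed
    then have "(\<Sum>t\<in>T. c t \<odot>\<^bsub>AH\<^esub> Poly_Mapping.single t 1) = 0"
      using phi_sum[of T u c] u phi_zero by simp
    then show "\<forall>t\<in>T. c t = 0"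
      using lookup_combination_of_singles[OF assms(3), where c = c and K = H] by simp
  qed
qed

lemma finite_H:
  assumes "finite (carrier G)"
  shows "finite (carrier H)"
proof (rule ccontr)
  assume "infinite (carrier H)"
  then obtain T where T: "finite T" "card T = Suc (card (carrier G))" "T \<subseteq> carrier H"
    using infinite_arbitrarily_large by blast
  have "card T \<le> card (carrier G)" by (rule card_le_of_finite[OF assms T(3,1)])
  then show False using T(2) by simp
qed

end

lemma algebra_isomorphism_inverse:
  assumes "algebra_isomorphism G H F \<phi>" "group G" "finite (carrier G)"
  shows "algebra_isomorphism H G F (inv_into (carrier (group_algebra F G)) \<phi>)"
proof -
  interpret algebra_isomorphism G H F \<phi> by fact
  interpret finite_group_algebra G F using assms by (simp add: finite_group_algebra_def finite_group_algebra_axioms_def)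
  let ?\<psi> = "inv_into (carrier (group_algebra F G)) \<phi>"
  have "\<phi> \<in> ring_iso AG AH" using iso by (simp add: algebra_iso_def)
  then have r: "?\<psi> \<in> ring_iso AH AG" by (rule ring_iso_set_sym[OF FG.ring_axioms])
  have "?\<psi> (c \<odot>\<^bsub>AH\<^esub> b) = c \<odot>\<^bsub>AG\<^esub> ?\<psi> b" if b: "b \<in> carrier AH" for b c
  proof -
    obtain a where a: "a \<in> carrier AG" "b = \<phi> a" using phi_surj[OF b] by blast
    have inj: "inj_on \<phi> (carrier AG)" using phi_bij by (simp add: bij_betw_def)
    have "c \<odot>\<^bsub>AH\<^esub> b = \<phi> (c \<odot>\<^bsub>AG\<^esub> a)" using a phi_smult by simp
    then show ?thesis using inv_into_f_f[OF inj] a carrier_closed(3)[OF a(1)] by simp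
  qed
  then show ?thesis using r by (simp add: algebra_isomorphism_def algebra_iso_def)
qed

locale p_group_algebra_isomorphism = algebra_isomorphism G H F \<phi> +
    A: p_group_algebra G F p e + B: p_group_algebra H F p e'
  for G :: "('g, 'm) monoid_scheme" and H :: "('h, 'n) monoid_scheme" and F :: "'f::field itself" and \<phi> p e e'
begin

text \<open>The isomorphism induces an isomorphism between the group algebras of
  \<open>G/N\<close> and \<open>H/N'\<close>.\<close>

definition matched :: "'g set \<Rightarrow> 'h set \<Rightarrow> bool" where
  "matched N N' \<longleftrightarrow> (\<forall>v\<in>carrier AG. v \<in> A.aug_ideal N \<longleftrightarrow> \<phi> v \<in> B.aug_ideal N')"

lemma inverse: "p_group_algebra_isomorphism H G F (inv_into (carrier AG) \<phi>) p e' e"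
  using algebra_isomorphism_inverse[OF algebra_isomorphism_axioms A.is_group A.finite_carrier]
    A.p_group_algebra_axioms B.p_group_algebra_axioms
  by (simp add: p_group_algebra_isomorphism_def)

lemma inverse_phi: "v \<in> carrier AG \<Longrightarrow> inv_into (carrier AG) \<phi> (\<phi> v) = v"
  and phi_inverse: "w \<in> carrier AH \<Longrightarrow> \<phi> (inv_into (carrier AG) \<phi> w) = w"
  and inverse_closed: "w \<in> carrier AH \<Longrightarrow> inv_into (carrier AG) \<phi> w \<in> carrier AG"
  using bij_betw_inv_into_left[OF phi_bij] bij_betw_inv_into_right[OF phi_bij]
    bij_betw_imp_surj_on[OF bij_betw_inv_into[OF phi_bij]] by auto

lemma matched_inverse:
  assumes "matched N N'"
  shows "p_group_algebra_isomorphism.matched H G F (inv_into (carrier AG) \<phi>) N' N"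
proof -
  interpret I: p_group_algebra_isomorphism H G F "inv_into (carrier AG) \<phi>" p e' e by (rule inverse)
  show ?thesis using assms phi_inverse inverse_closed by (auto simp: matched_def I.matched_def)
qed

lemma preimage_subsp:
  assumes "B.subsp U"
  shows "A.subsp {v \<in> carrier AG. \<phi> v \<in> U}"
  using assms by (auto simp: A.subsp_def B.subsp_def phi_add phi_smult phi_zero)

lemma matched_one: "matched {\<one>\<^bsub>G\<^esub>} {\<one>\<^bsub>H\<^esub>}"
  using phi_eq_iff[OF _ carrier_closed(4)] phi_zero
  by (auto simp: matched_def A.aug_ideal_one B.aug_ideal_one)

lemma phi_pow: "v \<in> carrier AG \<Longrightarrow> \<phi> (v [^]\<^bsub>AG\<^esub> (n::nat)) = \<phi> v [^]\<^bsub>AH\<^esub> n"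
  by (induction n) (auto simp: phi_one phi_mult)

end

context finite_group_algebra
begin

text \<open>The ideal of the derived subgroup is generated by the additive commutators. For a
  commutator of the group, \<open>x [a,b] - x\<close> is a multiple of the additive commutator
  of \<open>xa\<close> and \<open>ba\<inverse>\<close> plus the difference of \<open>x\<close>
  and one of its conjugates.\<close>

lemma aug_ideal_derived_least:
  assumes U: "subsp U" and ideal: "\<And>v u. v \<in> U \<Longrightarrow> u \<in> carrier FG \<Longrightarrow> v \<otimes>\<^bsub>FG\<^esub> u \<in> U"
    and comm: "\<And>a b. a \<in> carrier FG \<Longrightarrow> b \<in> carrier FG \<Longrightarrow> a \<otimes>\<^bsub>FG\<^esub> b - b \<otimes>\<^bsub>FG\<^esub> a \<in> U"
  shows "aug_ideal (derived G (carrier G)) \<subseteq> U"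
proof (rule aug_ideal_least[OF U])
  show "subgroup (derived G (carrier G)) G" by (rule derived_is_subgroup) simp
  have add: "a + b \<in> U" if "a \<in> U" "b \<in> U" for a b using U that by (simp add: subsp_def)
  have neg: "- a \<in> U" if a: "a \<in> U" for a
  proof -
    have "(- 1) \<odot>\<^bsub>FG\<^esub> a \<in> U" using U a by (simp add: subsp_def)
    moreover have "(- 1) \<odot>\<^bsub>FG\<^esub> a = - a" by (rule poly_mapping_eqI) (simp add: lookup_smult)
    ultimately show ?thesis by simp
  qed
  have gen: "Poly_Mapping.single (x \<otimes> (a \<otimes> b \<otimes> inv a \<otimes> inv b)) 1 - Poly_Mapping.single x 1 \<in> U"
    if x: "x \<in> carrier G" and a: "a \<in> carrier G" and b: "b \<in> carrier G" for x a b
  proof -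
    have "Poly_Mapping.single (x \<otimes> a) 1 \<otimes>\<^bsub>FG\<^esub> Poly_Mapping.single (b \<otimes> inv a) 1 -
        Poly_Mapping.single (b \<otimes> inv a) 1 \<otimes>\<^bsub>FG\<^esub> Poly_Mapping.single (x \<otimes> a) 1 \<in> U"
      using x a b by (intro comm) simp_all
    then have "(Poly_Mapping.single (x \<otimes> a \<otimes> (b \<otimes> inv a)) 1 - Poly_Mapping.single (b \<otimes> inv a \<otimes> (x \<otimes> a)) 1)
        \<otimes>\<^bsub>FG\<^esub> Poly_Mapping.single (inv b) 1 \<in> U"
      using x a b by (intro ideal) (simp_all add: single_mult_single)
    then have "Poly_Mapping.single (x \<otimes> (a \<otimes> b \<otimes> inv a \<otimes> inv b)) 1
        - Poly_Mapping.single (b \<otimes> inv a \<otimes> x \<otimes> inv (b \<otimes> inv a)) 1 \<in> U"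
      using x a b by (simp add: diff_mult_FG single_mult_single m_assoc inv_mult_group)
    moreover have "Poly_Mapping.single x 1 - Poly_Mapping.single (b \<otimes> inv a \<otimes> x \<otimes> inv (b \<otimes> inv a)) 1 \<in> U"
      using x a b by (intro single_conj_diff comm) simp_all
    ultimately show ?thesis using add[OF _ neg] by fastforce
  qed
  have G: "derived_set G (carrier G) \<subseteq> carrier G" by auto
  show "Poly_Mapping.single (x \<otimes> n) 1 - Poly_Mapping.single x 1 \<in> U"
    if "x \<in> carrier G" "n \<in> derived G (carrier G)" for x n
    using that(2,1) unfolding derived_def
  proof (induction n arbitrary: x rule: generate.induct)
    case one
    then show ?case using U by (simp add: subsp_def)
  next
    case (incl h)
    then show ?case using gen by auto
  next
    case (inv h)
    then have h: "h \<in> carrier G" by auto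
    have "Poly_Mapping.single (x \<otimes> inv h \<otimes> h) 1 - Poly_Mapping.single (x \<otimes> inv h) 1 \<in> U"
      using inv gen[of "x \<otimes> inv h"] h by auto
    then show ?case using neg[of "Poly_Mapping.single (x \<otimes> inv h \<otimes> h) 1 - Poly_Mapping.single (x \<otimes> inv h) 1"] h inv(2)
      by (simp add: m_assoc)
  next
    case (eng h1 h2)
    have h: "h1 \<in> carrier G" "h2 \<in> carrier G" using eng.hyps generate_in_carrier[OF G] by auto
    have "Poly_Mapping.single (x \<otimes> h1 \<otimes> h2) 1 - Poly_Mapping.single (x \<otimes> h1) 1 \<in> U"
      by (rule eng.IH(2)) (use h eng.prems in simp)
    from add[OF this eng.IH(1)[OF eng.prems]] show ?case using h eng.prems by (simp add: m_assoc)
  qed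
qed

lemma sat_derived_conj_closed:
  assumes "sat (derived G (carrier G)) S"
  shows "conj_closed S"
  unfolding conj_closed_def
proof (intro ballI)
  fix x h assume x: "x \<in> S" and h: "h \<in> carrier G"
  have xG: "x \<in> carrier G" using assms x by (auto simp: sat_def)
  have "inv x \<otimes> h \<otimes> inv (inv x) \<otimes> inv h \<in> derived G (carrier G)"
    unfolding derived_def by (rule generate.incl) (use xG h in blast)
  then have "x \<otimes> (inv x \<otimes> h \<otimes> inv (inv x) \<otimes> inv h) \<in> S" using assms x by (simp add: sat_def)
  then show "h \<otimes> x \<otimes> inv h \<in> S" using xG h by (simp add: m_assoc inv_mult_cancel)
qed

lemma trace_kernel_derived: "trace_kernel (derived G (carrier G)) = aug_ideal (derived G (carrier G))"
  using sat_derived_conj_closed by (auto simp: trace_kernel_def aug_ideal_def)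

end

context p_group_algebra_isomorphism
begin

lemma phi_aug_ideal_derived:
  assumes "v \<in> A.aug_ideal (derived G (carrier G))"
  shows "\<phi> v \<in> B.aug_ideal (derived H (carrier H))"
proof -
  let ?I = "B.aug_ideal (derived H (carrier H))"
  have "A.aug_ideal (derived G (carrier G)) \<subseteq> {v \<in> carrier AG. \<phi> v \<in> ?I}"
  proof (rule A.aug_ideal_derived_least[OF preimage_subsp[OF B.subsp_aug_ideal]])
    fix v u assume "v \<in> {v \<in> carrier AG. \<phi> v \<in> ?I}" "u \<in> carrier AG"
    then show "v \<otimes>\<^bsub>AG\<^esub> u \<in> {v \<in> carrier AG. \<phi> v \<in> ?I}"
      using B.aug_ideal_mult(1)[OF B.derived_self_is_normal] phi_closed phi_mult A.mult_FG_closed by simp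
  next
    fix a b assume "a \<in> carrier AG" "b \<in> carrier AG"
    then show "a \<otimes>\<^bsub>AG\<^esub> b - b \<otimes>\<^bsub>AG\<^esub> a \<in> {v \<in> carrier AG. \<phi> v \<in> ?I}"
      using B.commutator_in_trace_kernel[of "\<phi> a" "\<phi> b" "derived H (carrier H)"]
      by (simp add: B.trace_kernel_derived phi_diff phi_mult phi_closed A.mult_FG_closed)
  qed
  then show ?thesis using assms by blast
qed

text \<open>It suffices to treat the generator \<open>g^(p^j) - 1\<close>, which is the
  \<open>p^j\<close>-th power of \<open>g - 1\<close>; the image of \<open>g - 1\<close> lies in
  the ideal of \<open>h\<close>, and powers of elements of that ideal are known.\<close>

lemma phi_aug_ideal_generate_pow:
  assumes g: "g \<in> carrier G" and h: "h \<in> carrier H"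
    and central: "\<And>x. x \<in> carrier G \<Longrightarrow> g \<otimes>\<^bsub>G\<^esub> x = x \<otimes>\<^bsub>G\<^esub> g"
      "\<And>x. x \<in> carrier H \<Longrightarrow> h \<otimes>\<^bsub>H\<^esub> x = x \<otimes>\<^bsub>H\<^esub> h"
    and m: "matched (generate G {g}) (generate H {h})"
    and v: "v \<in> A.aug_ideal (generate G {g [^]\<^bsub>G\<^esub> (p ^ j)})"
  shows "\<phi> v \<in> B.aug_ideal (generate H {h [^]\<^bsub>H\<^esub> (p ^ j)})"
proof -
  let ?I = "B.aug_ideal (generate H {h [^]\<^bsub>H\<^esub> (p ^ j)})"
  let ?U = "{v \<in> carrier AG. \<phi> v \<in> ?I}"
  let ?c = "g [^]\<^bsub>G\<^esub> (p ^ j)"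
  let ?d = "Poly_Mapping.single g 1 - \<one>\<^bsub>AG\<^esub>"
  have U: "A.subsp ?U" by (rule preimage_subsp[OF B.subsp_aug_ideal])
  have c: "?c \<in> carrier G" using g by simp
  have hp: "h [^]\<^bsub>H\<^esub> (p ^ j) \<in> carrier H" using h by simp
  have hg: "h [^]\<^bsub>H\<^esub> (p ^ j) \<in> generate H {h}"
    using B.generate_pow_on_finite_carrier[OF B.finite_carrier h] by blast
  have hcent: "h [^]\<^bsub>H\<^esub> (p ^ j) \<otimes>\<^bsub>H\<^esub> x = x \<otimes>\<^bsub>H\<^esub> h [^]\<^bsub>H\<^esub> (p ^ j)" if "x \<in> carrier H" for x
    by (rule B.central_generate(2)[OF h central(2) that hg])
  have ideal: "u \<otimes>\<^bsub>AG\<^esub> v \<in> ?U" if "v \<in> ?U" "u \<in> carrier AG" for u v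
    using that B.aug_ideal_mult(2)[OF B.central_generate(1)[OF hp hcent], of "\<phi> v" "\<phi> u"]
    by (simp add: phi_mult phi_closed A.mult_FG_closed)
  have d: "?d \<in> carrier AG" using g by simp
  have "Poly_Mapping.single (\<one>\<^bsub>G\<^esub> \<otimes>\<^bsub>G\<^esub> g) 1 - Poly_Mapping.single \<one>\<^bsub>G\<^esub> 1 \<in> A.aug_ideal (generate G {g})"
    by (rule A.single_diff_in_aug_ideal) (use g in \<open>auto intro: A.generate_is_subgroup generate.incl\<close>)
  then have dh: "\<phi> ?d \<in> B.aug_ideal (generate H {h})"
    using m g d by (simp add: matched_def A.one_FG)
  have "\<phi> ?d [^]\<^bsub>AH\<^esub> (p ^ j) \<in> ?I"
    by (rule B.aug_ideal_generate_pow[OF h central(2) dh])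
  then have "?d [^]\<^bsub>AG\<^esub> (p ^ j) \<in> ?U" using d by (simp add: phi_pow)
  then have cU: "Poly_Mapping.single ?c 1 - \<one>\<^bsub>AG\<^esub> \<in> ?U"
    by (simp only: A.single_minus_one_p_pow[OF g])
  have "A.aug_ideal (generate G {?c}) \<subseteq> ?U"
  proof (rule A.aug_ideal_least[OF U])
    show "subgroup (generate G {?c}) G" using c by (simp add: A.generate_is_subgroup)
    fix x n assume x: "x \<in> carrier G" and n: "n \<in> generate G {?c}"
    obtain k :: nat where "n = ?c [^]\<^bsub>G\<^esub> k"
      using n A.generate_pow_on_finite_carrier[OF A.finite_carrier c] by blast
    then show "Poly_Mapping.single (x \<otimes>\<^bsub>G\<^esub> n) 1 - Poly_Mapping.single x 1 \<in> ?U"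
      using A.single_pow_diff_in_subsp[OF U ideal c cU x] by blast
  qed
  then show ?thesis using v by blast
qed

lemma phi_algebra_center_mod:
  assumes "matched N N'" "v \<in> carrier AG"
  shows "v \<in> A.algebra_center_mod N \<longleftrightarrow> \<phi> v \<in> B.algebra_center_mod N'"
proof -
  have "(\<forall>u\<in>carrier AH. \<phi> v \<otimes>\<^bsub>AH\<^esub> u - u \<otimes>\<^bsub>AH\<^esub> \<phi> v \<in> B.aug_ideal N') \<longleftrightarrow>
    (\<forall>u\<in>carrier AG. \<phi> v \<otimes>\<^bsub>AH\<^esub> \<phi> u - \<phi> u \<otimes>\<^bsub>AH\<^esub> \<phi> v \<in> B.aug_ideal N')"
    by (metis phi_closed phi_surj)
  also have "\<dots> \<longleftrightarrow> (\<forall>u\<in>carrier AG. v \<otimes>\<^bsub>AG\<^esub> u - u \<otimes>\<^bsub>AG\<^esub> v \<in> A.aug_ideal N)"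
    using assms by (auto simp: matched_def phi_diff phi_mult A.mult_FG_closed)
  finally show ?thesis using assms phi_closed by (simp add: A.algebra_center_mod_def B.algebra_center_mod_def)
qed

lemma phi_trace_kernel:
  assumes m: "matched N N'" and N: "N \<lhd> G" and v: "v \<in> A.trace_kernel N"
  shows "\<phi> v \<in> B.trace_kernel N'"
proof -
  have "A.trace_kernel N \<subseteq> {v \<in> carrier AG. \<phi> v \<in> B.trace_kernel N'}"
  proof (rule A.trace_kernel_least[OF preimage_subsp[OF B.subsp_trace_kernel] N])
    fix a b assume "a \<in> carrier AG" "b \<in> carrier AG"
    then show "a \<otimes>\<^bsub>AG\<^esub> b - b \<otimes>\<^bsub>AG\<^esub> a \<in> {v \<in> carrier AG. \<phi> v \<in> B.trace_kernel N'}"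
      using B.commutator_in_trace_kernel[of "\<phi> a" "\<phi> b" N']
      by (simp add: phi_diff phi_mult phi_closed A.mult_FG_closed)
  next
    show "A.aug_ideal N \<subseteq> {v \<in> carrier AG. \<phi> v \<in> B.trace_kernel N'}"
      using m B.aug_ideal_subset_trace_kernel by (auto simp: matched_def A.aug_ideal_def)
  qed
  then show ?thesis using v by blast
qed

lemma phi_trace_kernel_iff:
  assumes m: "matched N N'" and N: "N \<lhd> G" "N' \<lhd> H" and v: "v \<in> carrier AG"
  shows "v \<in> A.trace_kernel N \<longleftrightarrow> \<phi> v \<in> B.trace_kernel N'"
proof -
  interpret I: p_group_algebra_isomorphism H G F "inv_into (carrier AG) \<phi>" p e' e by (rule inverse)
  show ?thesis
    using phi_trace_kernel[OF m N(1)] I.phi_trace_kernel[OF matched_inverse[OF m] N(2)] inverse_phi[OF v] by metis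
qed

lemma matched_derived: "matched (derived G (carrier G)) (derived H (carrier H))"
proof -
  interpret I: p_group_algebra_isomorphism H G F "inv_into (carrier AG) \<phi>" p e' e by (rule inverse)
  show ?thesis unfolding matched_def
    using phi_aug_ideal_derived I.phi_aug_ideal_derived inverse_phi by metis
qed

lemma matched_generate_pow:
  assumes g: "g \<in> carrier G" and h: "h \<in> carrier H"
    and central: "\<And>x. x \<in> carrier G \<Longrightarrow> g \<otimes>\<^bsub>G\<^esub> x = x \<otimes>\<^bsub>G\<^esub> g"
      "\<And>x. x \<in> carrier H \<Longrightarrow> h \<otimes>\<^bsub>H\<^esub> x = x \<otimes>\<^bsub>H\<^esub> h"
    and m: "matched (generate G {g}) (generate H {h})"
  shows "matched (generate G {g [^]\<^bsub>G\<^esub> (p ^ j)}) (generate H {h [^]\<^bsub>H\<^esub> (p ^ j)})"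
proof -
  interpret I: p_group_algebra_isomorphism H G F "inv_into (carrier AG) \<phi>" p e' e by (rule inverse)
  have "v \<in> A.aug_ideal (generate G {g [^]\<^bsub>G\<^esub> (p ^ j)}) \<longleftrightarrow>
      \<phi> v \<in> B.aug_ideal (generate H {h [^]\<^bsub>H\<^esub> (p ^ j)})" if v: "v \<in> carrier AG" for v
  proof
    assume "\<phi> v \<in> B.aug_ideal (generate H {h [^]\<^bsub>H\<^esub> (p ^ j)})"
    from I.phi_aug_ideal_generate_pow[OF h g central(2) central(1) matched_inverse[OF m] this]
    show "v \<in> A.aug_ideal (generate G {g [^]\<^bsub>G\<^esub> (p ^ j)})" by (simp only: inverse_phi[OF v])
  qed (rule phi_aug_ideal_generate_pow[OF g h central m])
  then show ?thesis by (simp add: matched_def)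
qed

text \<open>The criterion of \<open>center_mod_power_iff\<close> refers to \<open>N\<close> only
  through its ideal, hence is preserved.\<close>

lemma center_mod_power_transfer:
  assumes m: "matched N N'" and N: "N \<lhd> G" "N' \<lhd> H"
    and central: "\<And>x n. x \<in> carrier G \<Longrightarrow> n \<in> N \<Longrightarrow> n \<otimes>\<^bsub>G\<^esub> x = x \<otimes>\<^bsub>G\<^esub> n"
      "\<And>x n. x \<in> carrier H \<Longrightarrow> n \<in> N' \<Longrightarrow> n \<otimes>\<^bsub>H\<^esub> x = x \<otimes>\<^bsub>H\<^esub> n"
    and ex: "\<And>n. n \<in> N \<Longrightarrow> n [^]\<^bsub>G\<^esub> (p ^ k) = \<one>\<^bsub>G\<^esub>" "\<And>n. n \<in> N' \<Longrightarrow> n [^]\<^bsub>H\<^esub> (p ^ k) = \<one>\<^bsub>H\<^esub>"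
  shows "(\<forall>x\<in>A.center_mod N. x [^]\<^bsub>G\<^esub> (p ^ k) = \<one>\<^bsub>G\<^esub>) \<longleftrightarrow> (\<forall>x\<in>B.center_mod N'. x [^]\<^bsub>H\<^esub> (p ^ k) = \<one>\<^bsub>H\<^esub>)"
proof -
  have tk: "v [^]\<^bsub>AG\<^esub> (p ^ k) - c \<odot>\<^bsub>AG\<^esub> \<one>\<^bsub>AG\<^esub> \<in> A.trace_kernel {\<one>\<^bsub>G\<^esub>} \<longleftrightarrow>
     \<phi> v [^]\<^bsub>AH\<^esub> (p ^ k) - c \<odot>\<^bsub>AH\<^esub> \<one>\<^bsub>AH\<^esub> \<in> B.trace_kernel {\<one>\<^bsub>H\<^esub>}" if v: "v \<in> carrier AG" for v c
    using phi_trace_kernel_iff[OF matched_one A.one_is_normal B.one_is_normal, of "v [^]\<^bsub>AG\<^esub> (p ^ k) - c \<odot>\<^bsub>AG\<^esub> \<one>\<^bsub>AG\<^esub>"] v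
    by (simp add: phi_diff phi_pow phi_smult phi_one)
  have sub: "A.algebra_center_mod N \<subseteq> carrier AG" "B.algebra_center_mod N' \<subseteq> carrier AH"
    by (auto simp: A.algebra_center_mod_def B.algebra_center_mod_def)
  have "(\<forall>v\<in>A.algebra_center_mod N. \<exists>c. v [^]\<^bsub>AG\<^esub> (p ^ k) - c \<odot>\<^bsub>AG\<^esub> \<one>\<^bsub>AG\<^esub> \<in> A.trace_kernel {\<one>\<^bsub>G\<^esub>}) \<longleftrightarrow>
    (\<forall>w\<in>B.algebra_center_mod N'. \<exists>c. w [^]\<^bsub>AH\<^esub> (p ^ k) - c \<odot>\<^bsub>AH\<^esub> \<one>\<^bsub>AH\<^esub> \<in> B.trace_kernel {\<one>\<^bsub>H\<^esub>})"
    (is "?l \<longleftrightarrow> ?r")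
  proof
    assume l: ?l
    show ?r
    proof
      fix w assume w: "w \<in> B.algebra_center_mod N'"
      obtain v where v: "v \<in> carrier AG" "\<phi> v = w" using phi_surj sub(2) w by blast
      then have "v \<in> A.algebra_center_mod N" using phi_algebra_center_mod[OF m v(1)] w by simp
      then show "\<exists>c. w [^]\<^bsub>AH\<^esub> (p ^ k) - c \<odot>\<^bsub>AH\<^esub> \<one>\<^bsub>AH\<^esub> \<in> B.trace_kernel {\<one>\<^bsub>H\<^esub>}"
        using l tk[OF v(1)] v(2) by blast
    qed
  next
    assume r: ?r
    show ?l
    proof
      fix v assume v: "v \<in> A.algebra_center_mod N"
      then have "v \<in> carrier AG" using sub(1) by blast
      then show "\<exists>c. v [^]\<^bsub>AG\<^esub> (p ^ k) - c \<odot>\<^bsub>AG\<^esub> \<one>\<^bsub>AG\<^esub> \<in> A.trace_kernel {\<one>\<^bsub>G\<^esub>}"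
        using r tk phi_algebra_center_mod[OF m, of v] v by blast
    qed
  qed
  then show ?thesis
    using A.center_mod_power_iff[OF N(1) central(1) ex(1)] B.center_mod_power_iff[OF N(2) central(2) ex(2)] by simp
qed

text \<open>Representatives of the cosets on the left are central modulo \<open>N\<close> and
  linearly independent modulo \<open>trace_kernel M\<close>. Their images are central modulo
  \<open>N'\<close>, and modulo \<open>trace_kernel M'\<close> such elements are determined by
  their traces over the cosets on the right. The matrix of these traces has independent rows.\<close>

lemma card_center_mod_cosets_le:
  assumes mN: "matched N N'" and mM: "matched M M'"
    and N: "N \<lhd> G" "N' \<lhd> H" and M: "M \<lhd> G" "M' \<lhd> H" and NM: "N \<subseteq> M" "N' \<subseteq> M'"
  shows "card ((\<lambda>x. x <#\<^bsub>G\<^esub> M) ` A.center_mod N) \<le> card ((\<lambda>x. x <#\<^bsub>H\<^esub> M') ` B.center_mod N')"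
proof -
  let ?T = "(\<lambda>x. x <#\<^bsub>G\<^esub> M) ` A.center_mod N"
  let ?S = "(\<lambda>x. x <#\<^bsub>H\<^esub> M') ` B.center_mod N'"
  have sN: "subgroup N G" and sM: "subgroup M G" using N M by (auto dest: normal_imp_subgroup)
  have cG: "A.center_mod N \<subseteq> carrier G" "B.center_mod N' \<subseteq> carrier H"
    by (auto simp: A.center_mod_def B.center_mod_def)
  have fin: "finite ?T" "finite ?S"
    using finite_subset[OF cG(1) A.finite_carrier] finite_subset[OF cG(2) B.finite_carrier] by auto
  have "\<exists>x. x \<in> A.center_mod N \<and> Q = x <#\<^bsub>G\<^esub> M" if "Q \<in> ?T" for Q using that by blast
  then obtain t where t: "\<And>Q. Q \<in> ?T \<Longrightarrow> t Q \<in> A.center_mod N" "\<And>Q. Q \<in> ?T \<Longrightarrow> Q = t Q <#\<^bsub>G\<^esub> M"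
    by metis
  define u where "u Q = (Poly_Mapping.single (t Q) 1 :: 'g \<Rightarrow>\<^sub>0 'f)" for Q
  have uZ: "u Q \<in> A.algebra_center_mod N" if "Q \<in> ?T" for Q
    unfolding u_def by (rule A.single_in_algebra_center_mod[OF sN t(1)[OF that]])
  have uA: "u Q \<in> carrier AG" if "Q \<in> ?T" for Q
    using uZ[OF that] by (simp add: A.algebra_center_mod_def)
  show ?thesis
  proof (rule steinitz_functions[OF fin(2) fin(1), of "\<lambda>Q R. B.tr R (\<phi> (u Q))"])
    fix c assume c: "\<And>R. R \<in> ?S \<Longrightarrow> (\<Sum>Q\<in>?T. c Q * B.tr R (\<phi> (u Q))) = 0"
    define v where "v = (\<Sum>Q\<in>?T. c Q \<odot>\<^bsub>AG\<^esub> u Q)"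
    have vZ: "v \<in> A.algebra_center_mod N"
      unfolding v_def using A.subsp_algebra_center_mod[of N] uZ
      by (intro A.subsp_sum[OF A.subsp_algebra_center_mod]) (simp add: A.subsp_def)
    then have vA: "v \<in> carrier AG" by (simp add: A.algebra_center_mod_def)
    have "\<phi> v = (\<Sum>Q\<in>?T. c Q \<odot>\<^bsub>AH\<^esub> \<phi> (u Q))"
      unfolding v_def by (rule phi_sum[OF uA])
    then have "B.tr R (\<phi> v) = 0" if "R \<in> ?S" for R
      using c[OF that] by (simp add: B.tr_sum B.tr_smult)
    then have "\<phi> v \<in> B.trace_kernel M'"
      using phi_algebra_center_mod[OF mN vA] vZ
      by (intro B.trace_kernel_from_cosets[OF N(2) M(2) NM(2)]) auto
    then have vK: "v \<in> A.trace_kernel M" using phi_trace_kernel_iff[OF mM M vA] by simp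
    show "\<forall>Q\<in>?T. c Q = 0"
    proof
      fix Q assume Q: "Q \<in> ?T"
      have QG: "Q \<subseteq> carrier G" "A.sat M Q" "A.conj_closed Q"
        using A.coset_sat_conj_closed[OF sN M(1) NM(1) t(1)[OF Q]] t(2)[OF Q] by (auto simp: A.sat_def)
      have "A.tr Q (u R) = (if R = Q then 1 else 0)" if R: "R \<in> ?T" for R
      proof -
        have tR: "t R \<in> carrier G" using t(1)[OF R] cG by blast
        have "t R \<in> Q \<longleftrightarrow> R = Q"
        proof
          assume "t R \<in> Q"
          then have "t R \<in> t Q <#\<^bsub>G\<^esub> M" using t(2)[OF Q] by blast
          then have "t Q <#\<^bsub>G\<^esub> M = t R <#\<^bsub>G\<^esub> M"
            using A.l_repr_independence[OF _ _ sM] t(1)[OF Q] cG by blast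
          then show "R = Q" using t(2)[OF R] t(2)[OF Q] by metis
        next
          assume "R = Q"
          then show "t R \<in> Q" using A.lcos_self[OF tR sM] t(2)[OF R] by blast
        qed
        then show ?thesis using QG(1) by (simp add: u_def A.tr_single)
      qed
      then have "A.tr Q v = (\<Sum>R\<in>?T. if R = Q then c R else 0)"
        unfolding v_def A.tr_sum A.tr_smult by (intro sum.cong refl) auto
      then have "A.tr Q v = c Q" using fin(1) Q by simp
      then show "c Q = 0" using vK QG by (simp add: A.trace_kernel_def)
    qed
  qed
qed

lemma card_center_mod_cosets:
  assumes mN: "matched N N'" and mM: "matched M M'"
    and N: "N \<lhd> G" "N' \<lhd> H" and M: "M \<lhd> G" "M' \<lhd> H" and NM: "N \<subseteq> M" "N' \<subseteq> M'"
  shows "card ((\<lambda>x. x <#\<^bsub>G\<^esub> M) ` A.center_mod N) = card ((\<lambda>x. x <#\<^bsub>H\<^esub> M') ` B.center_mod N')"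
proof -
  interpret I: p_group_algebra_isomorphism H G F "inv_into (carrier AG) \<phi>" p e' e by (rule inverse)
  show ?thesis
    using card_center_mod_cosets_le[OF assms]
      I.card_center_mod_cosets_le[OF matched_inverse[OF mN] matched_inverse[OF mM] N(2,1) M(2,1) NM(2,1)] by simp
qed

end

section \<open>Alternating forms on groups\<close>

text \<open>Homomorphisms to the integers modulo \<open>q\<close>, represented by integer-valued
  functions that are additive only up to congruence.\<close>

definition (in group) hom_mod :: "int \<Rightarrow> 'a set \<Rightarrow> ('a \<Rightarrow> int) \<Rightarrow> bool" where
  "hom_mod q C h \<longleftrightarrow> (\<forall>x\<in>C. \<forall>y\<in>C. [h (x \<otimes> y) = h x + h y] (mod q))"

context group
begin

context
  fixes C q h assumes C: "subgroup C G" and h: "hom_mod q C h"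
begin

lemma hom_mod_mult: "x \<in> C \<Longrightarrow> y \<in> C \<Longrightarrow> [h (x \<otimes> y) = h x + h y] (mod q)"
  using h by (simp add: hom_mod_def)

lemma hom_mod_one: "[h \<one> = 0] (mod q)"
proof -
  have "[h (\<one> \<otimes> \<one>) = h \<one> + h \<one>] (mod q)" by (rule hom_mod_mult) (use C subgroup.one_closed in auto)
  then have "q dvd h \<one> - (h \<one> + h \<one>)" by (simp add: cong_iff_dvd_diff)
  then show ?thesis by (simp add: cong_0_iff)
qed

lemma hom_mod_inv:
  assumes x: "x \<in> C"
  shows "[h (inv x) = - h x] (mod q)"
proof -
  have xG: "x \<in> carrier G" using subgroup.mem_carrier[OF C x] .
  have "[h (x \<otimes> inv x) = h x + h (inv x)] (mod q)"
    by (rule hom_mod_mult[OF x subgroup.m_inv_closed[OF C x]])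
  then have "[0 = h x + h (inv x)] (mod q)"
    using hom_mod_one xG cong_sym cong_trans by (metis r_inv)
  then have "q dvd h x + h (inv x)" by (simp only: cong_sym_eq[of 0] cong_0_iff)
  then show ?thesis by (simp add: cong_iff_dvd_diff add.commute)
qed

lemma hom_mod_nat_pow:
  assumes x: "x \<in> C"
  shows "[h (x [^] (n::nat)) = int n * h x] (mod q)"
proof (induction n)
  case 0
  then show ?case using hom_mod_one by simp
next
  case (Suc n)
  have "x [^] n \<in> C" using C x by (induction n) (auto simp: subgroup.one_closed subgroup.m_closed)
  then have "[h (x [^] Suc n) = h (x [^] n) + h x] (mod q)" using hom_mod_mult[OF _ x] by simp
  also have "[h (x [^] n) + h x = int n * h x + h x] (mod q)" by (rule cong_add[OF Suc cong_refl])
  finally show ?case by (simp add: algebra_simps)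
qed

lemma hom_mod_int_pow:
  assumes x: "x \<in> C"
  shows "[h (x [^] (i::int)) = i * h x] (mod q)"
proof (cases "i \<ge> 0")
  case True
  then obtain n where "i = int n" using nonneg_int_cases by blast
  then show ?thesis using hom_mod_nat_pow[OF x, of n] by (simp add: int_pow_int)
next
  case False
  then obtain n where n: "i = - int n" by (metis int_cases4 nle_le of_nat_0_le_iff zero_le_imp_eq_int minus_minus neg_0_le_iff_le)
  have xG: "x \<in> carrier G" using subgroup.mem_carrier[OF C x] .
  have "x [^] n \<in> C" using C x by (induction n) (auto simp: subgroup.one_closed subgroup.m_closed)
  from hom_mod_inv[OF this] have "[h (x [^] i) = - h (x [^] n)] (mod q)"
    using n xG by (simp add: int_pow_neg_int)
  also have "[- h (x [^] n) = - (int n * h x)] (mod q)"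
    using hom_mod_nat_pow[OF x, of n] by (simp add: cong_minus_minus_iff)
  finally show ?thesis using n by simp
qed

lemma subgroup_int_pow: "x \<in> C \<Longrightarrow> x [^] (i::int) \<in> C"
  using subgroup_int_pow_closed[OF C] .

lemma hom_mod_comb:
  assumes "x \<in> C" "y \<in> C" "d \<in> C"
  shows "[h (x [^] (i::int) \<otimes> y [^] (j::int) \<otimes> d) = i * h x + j * h y + h d] (mod q)"
proof -
  have cl: "x [^] i \<in> C" "y [^] j \<in> C" using assms subgroup_int_pow by auto
  have "[h (x [^] i \<otimes> y [^] j \<otimes> d) = h (x [^] i \<otimes> y [^] j) + h d] (mod q)"
    by (rule hom_mod_mult) (use cl assms C in \<open>auto simp: subgroup.m_closed\<close>)
  also have "[h (x [^] i \<otimes> y [^] j) + h d = (h (x [^] i) + h (y [^] j)) + h d] (mod q)"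
    by (intro cong_add cong_refl hom_mod_mult cl)
  also have "[(h (x [^] i) + h (y [^] j)) + h d = (i * h x + j * h y) + h d] (mod q)"
    by (intro cong_add cong_refl hom_mod_int_pow assms)
  finally show ?thesis .
qed

end

lemma hom_mod_subset: "hom_mod q C h \<Longrightarrow> D \<subseteq> C \<Longrightarrow> hom_mod q D h"
  by (auto simp: hom_mod_def)

end

lemma prime_power_dvd_cancel:
  fixes a :: int and p :: nat
  assumes "p > 0" "m \<le> M"
  shows "int p ^ M dvd int p ^ m * a \<longleftrightarrow> int p ^ (M - m) dvd a"
proof -
  have "int p ^ M = int p ^ m * int p ^ (M - m)" using assms by (simp add: power_add[symmetric])
  then show ?thesis using assms by simp
qed

lemma inverse_mod_prime_power:
  fixes a :: int and p :: nat
  assumes "Factorial_Ring.prime p" "\<not> int p dvd a"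
  obtains b where "[a * b = 1] (mod int p ^ M)" "\<not> int p dvd b"
proof -
  have "Factorial_Ring.prime (int p)" using assms(1) by simp
  then have "coprime a (int p ^ M)" "coprime a (int p)"
    using assms(2) prime_imp_coprime coprime_commute by (metis coprime_power_right_iff)+
  then have "coprime a (int p ^ Suc M)" by simp
  then obtain b where b: "[a * b = 1] (mod int p ^ Suc M)" using cong_solve_coprime_int by blast
  then have 1: "[a * b = 1] (mod int p ^ M)" and 2: "[a * b = 1] (mod int p)"
    by (auto elim!: cong_dvd_modulus simp: le_imp_power_dvd)
  have "\<not> int p dvd b"
  proof
    assume "int p dvd b"
    then have "int p dvd a * b" by simp
    then have "int p dvd 1" using 2 cong_dvd_iff by blast
    then show False using assms(1) by (simp add: prime_nat_iff)
  qed
  then show thesis using that 1 by blast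
qed

text \<open>The form lives on the quotient of \<open>G\<close> by its radical, which is abelian.
  The quotient is never formed: elements of \<open>G\<close> stand for their classes, and
  equality of classes is expressed by the values of \<open>w\<close>.\<close>

locale alternating_form = group G for G (structure) +
  fixes p M :: nat and w :: "'a \<Rightarrow> 'a \<Rightarrow> int" and \<chi> :: "'a \<Rightarrow> int"
  assumes finite_G: "finite (carrier G)" and prime_p: "Factorial_Ring.prime p"
    and w_left: "u \<in> carrier G \<Longrightarrow> hom_mod (int p ^ M) (carrier G) (\<lambda>x. w x u)"
    and w_right: "u \<in> carrier G \<Longrightarrow> hom_mod (int p ^ M) (carrier G) (\<lambda>x. w u x)"
    and w_alt: "x \<in> carrier G \<Longrightarrow> [w x x = 0] (mod int p ^ M)"
    and chi_hom: "hom_mod (int p ^ M) (carrier G) \<chi>"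
    and chi_rad: "x \<in> carrier G \<Longrightarrow> (\<And>u. u \<in> carrier G \<Longrightarrow> int p ^ M dvd w x u) \<Longrightarrow> int p ^ M dvd \<chi> x"
begin

abbreviation q :: int where "q \<equiv> int p ^ M"

lemma p_pos: "p > 0" "p > 1"
  using prime_p prime_gt_0_nat prime_gt_1_nat by auto

lemmas w_mult_left = hom_mod_mult[OF subgroup_self w_left]
  and w_mult_right = hom_mod_mult[OF subgroup_self w_right]
  and w_comb_left = hom_mod_comb[OF subgroup_self w_left]
  and w_comb_right = hom_mod_comb[OF subgroup_self w_right]
  and w_pow_left = hom_mod_int_pow[OF subgroup_self w_left]
  and w_pow_right = hom_mod_int_pow[OF subgroup_self w_right]
  and w_one_left = hom_mod_one[OF subgroup_self w_left]
  and w_one_right = hom_mod_one[OF subgroup_self w_right]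
  and w_inv_left = hom_mod_inv[OF subgroup_self w_left]
  and chi_mult = hom_mod_mult[OF subgroup_self chi_hom]
  and chi_comb = hom_mod_comb[OF subgroup_self chi_hom]
  and chi_pow = hom_mod_int_pow[OF subgroup_self chi_hom]

lemma w_skew:
  assumes x: "x \<in> carrier G" and y: "y \<in> carrier G"
  shows "[w x y = - w y x] (mod q)"
proof -
  have "[0 = w (x \<otimes> y) (x \<otimes> y)] (mod q)" using w_alt[of "x \<otimes> y"] x y cong_sym by simp
  also have "[w (x \<otimes> y) (x \<otimes> y) = w x (x \<otimes> y) + w y (x \<otimes> y)] (mod q)"
    using x y by (intro w_mult_left) auto
  also have "[w x (x \<otimes> y) + w y (x \<otimes> y) = (w x x + w x y) + (w y x + w y y)] (mod q)"
    using x y by (intro cong_add w_mult_right) auto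
  also have "[(w x x + w x y) + (w y x + w y y) = (0 + w x y) + (w y x + 0)] (mod q)"
    using x y by (intro cong_add cong_refl w_alt)
  finally have "q dvd 0 - ((0 + w x y) + (w y x + 0))" by (simp only: cong_iff_dvd_diff)
  then have "q dvd w x y - - w y x" by (simp add: dvd_diff_commute add.commute)
  then show ?thesis by (simp only: cong_iff_dvd_diff)
qed

text \<open>The elements of \<open>C\<close> that \<open>p^k\<close> moves into the radical of
  the form on \<open>C\<close>; for \<open>k = 0\<close> the radical itself.\<close>

definition tors :: "'a set \<Rightarrow> nat \<Rightarrow> 'a set" where
  "tors C k = {x \<in> C. \<forall>u\<in>C. q dvd int p ^ k * w x u}"

lemma tors_subset: "tors C k \<subseteq> C"
  by (auto simp: tors_def)

lemma tors_mono: "k \<le> l \<Longrightarrow> tors C k \<subseteq> tors C l"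
  by (auto simp: tors_def dest: le_imp_power_dvd[of k l "int p"] intro: dvd_trans[OF _ mult_dvd_mono])

lemma tors_subgroup:
  assumes C: "subgroup C G"
  shows "subgroup (tors C k) G"
proof (rule subgroupI)
  have CG: "C \<subseteq> carrier G" by (rule subgroup.subset[OF C])
  show "tors C k \<subseteq> carrier G" using CG tors_subset by blast
  have "q dvd int p ^ k * w \<one> u" if "u \<in> C" for u
    using w_one_left[of u] that CG by (auto simp: cong_0_iff)
  then have "\<one> \<in> tors C k" using subgroup.one_closed[OF C] by (simp add: tors_def)
  then show "tors C k \<noteq> {}" by blast
  fix a assume a: "a \<in> tors C k"
  have "q dvd int p ^ k * w (inv a) u" if u: "u \<in> C" for u
  proof -
    have "[int p ^ k * w (inv a) u = int p ^ k * (- w a u)] (mod q)"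
      by (intro cong_mult cong_refl w_inv_left) (use a u CG tors_subset in auto)
    moreover have "q dvd int p ^ k * (- w a u)" using a u by (simp add: tors_def)
    ultimately show ?thesis using cong_dvd_iff by blast
  qed
  then show "inv a \<in> tors C k" using a subgroup.m_inv_closed[OF C] by (simp add: tors_def)
  fix b assume b: "b \<in> tors C k"
  have "q dvd int p ^ k * w (a \<otimes> b) u" if u: "u \<in> C" for u
  proof -
    have "[int p ^ k * w (a \<otimes> b) u = int p ^ k * (w a u + w b u)] (mod q)"
      by (intro cong_mult cong_refl w_mult_left) (use a b u CG tors_subset in auto)
    moreover have "q dvd int p ^ k * (w a u + w b u)" using a b u by (simp add: tors_def distrib_left)
    ultimately show ?thesis using cong_dvd_iff by blast
  qed
  then show "a \<otimes> b \<in> tors C k" using a b subgroup.m_closed[OF C] by (simp add: tors_def)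
qed

text \<open>The exponent of \<open>C\<close> modulo its radical is \<open>p^m\<close>.\<close>

lemma level_exists:
  assumes "tors C 0 \<noteq> C"
  obtains m where "1 \<le> m" "m \<le> M" "tors C m = C" "tors C (m - 1) \<noteq> C"
proof -
  have M: "tors C M = C" by (auto simp: tors_def)
  define m where "m = (LEAST k. tors C k = C)"
  have m: "tors C m = C" unfolding m_def using M by (rule LeastI)
  have "m \<le> M" unfolding m_def using M by (rule Least_le)
  moreover have "m \<noteq> 0" using m assms by metis
  moreover have "tors C (m - 1) \<noteq> C"
    using not_less_Least[of "m - 1" "\<lambda>k. tors C k = C"] \<open>m \<noteq> 0\<close> by (simp add: m_def)
  ultimately show thesis using that[of m] m by simp
qed

lemma w_dvd_of_level:
  assumes "tors C m = C" "m \<le> M" "x \<in> C" "u \<in> C"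
  shows "int p ^ (M - m) dvd w x u"
proof -
  have "q dvd int p ^ m * w x u" using assms(1,3,4) by (auto simp: tors_def)
  then show ?thesis using prime_power_dvd_cancel[OF p_pos(1) assms(2)] by blast
qed

text \<open>If \<open>p^(m-1) w x u \<noteq> 0\<close> then \<open>w x u\<close> is a unit times
  \<open>p^(M-m)\<close>, the smallest possible value, and the unit can be moved into
  \<open>u\<close>.\<close>

lemma partner_exists:
  assumes C: "subgroup C G" and m: "1 \<le> m" "m \<le> M" "tors C m = C"
    and x: "x \<in> C" "u \<in> C" and nd: "\<not> q dvd int p ^ (m - 1) * w x u"
  obtains y where "y \<in> C" "[w x y = int p ^ (M - m)] (mod q)"
proof -
  obtain a where a: "w x u = int p ^ (M - m) * a"
    using w_dvd_of_level[OF m(3,2) x] by blast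
  have "\<not> int p dvd a"
  proof
    assume "int p dvd a"
    then obtain b where "a = int p * b" by blast
    then have "int p ^ (m - 1) * w x u = int p ^ ((m - 1) + (M - m) + 1) * b"
      by (simp add: a power_add)
    moreover have "(m - 1) + (M - m) + 1 = M" using m by simp
    ultimately show False using nd by simp
  qed
  then obtain b where b: "[a * b = 1] (mod q)" using inverse_mod_prime_power[OF prime_p] by blast
  have CG: "C \<subseteq> carrier G" by (rule subgroup.subset[OF C])
  have "[w x (u [^] b) = b * w x u] (mod q)"
    using x CG by (intro w_pow_right) auto
  also have "b * w x u = int p ^ (M - m) * (a * b)" by (simp add: a)
  also have "[int p ^ (M - m) * (a * b) = int p ^ (M - m) * 1] (mod q)"
    by (intro cong_mult cong_refl b)
  finally show thesis using that[of "u [^] b"] subgroup_int_pow_closed[OF C x(2)] by simp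
qed

definition perp :: "'a set \<Rightarrow> 'a \<Rightarrow> 'a \<Rightarrow> 'a set" where
  "perp C x y = {c \<in> C. q dvd w c x \<and> q dvd w c y}"

end

text \<open>The values of \<open>w\<close> on \<open>C\<close> are multiples of
  \<open>p^(M-m)\<close>, so a pair with exactly this value spans an orthogonal direct summand.\<close>

locale hyperbolic_pair = alternating_form G p M w \<chi> for G (structure) and p M w \<chi> +
  fixes C m x y
  assumes C: "subgroup C G" and m: "1 \<le> m" "m \<le> M" "tors C m = C"
    and x: "x \<in> C" and y: "y \<in> C" and wxy: "[w x y = int p ^ (M - m)] (mod q)"
begin

abbreviation "D \<equiv> perp C x y"

lemma CG: "c \<in> C \<Longrightarrow> c \<in> carrier G"
  by (rule subgroup.mem_carrier[OF C])

lemma D_sub: "D \<subseteq> C"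
  by (auto simp: perp_def)

lemma DC: "c \<in> D \<Longrightarrow> c \<in> C"
  using D_sub by blast

lemma wyx: "[w y x = - (int p ^ (M - m))] (mod q)"
proof -
  have "[w y x = - w x y] (mod q)" by (rule w_skew) (use x y CG in auto)
  also have "[- w x y = - (int p ^ (M - m))] (mod q)" using wxy by (simp add: cong_minus_minus_iff)
  finally show ?thesis .
qed

lemma wxx: "[w x x = 0] (mod q)" and wyy: "[w y y = 0] (mod q)"
  using w_alt x y CG by auto

lemma w_D:
  assumes "d \<in> D"
  shows "[w d x = 0] (mod q)" "[w d y = 0] (mod q)" "[w x d = 0] (mod q)" "[w y d = 0] (mod q)"
proof -
  show 1: "[w d x = 0] (mod q)" "[w d y = 0] (mod q)" using assms by (auto simp: perp_def cong_0_iff)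
  have "[w x d = - w d x] (mod q)" "[w y d = - w d y] (mod q)"
    by (intro w_skew; use x y CG DC[OF assms] in auto)+
  then show "[w x d = 0] (mod q)" "[w y d = 0] (mod q)"
    using 1 by (auto simp: cong_0_iff cong_dvd_iff)
qed

lemma D_subgroup: "subgroup D G"
proof (rule subgroupI)
  show "D \<subseteq> carrier G" using D_sub CG by blast
  have "\<one> \<in> D" using w_one_left x y CG subgroup.one_closed[OF C] by (simp add: perp_def cong_0_iff)
  then show "D \<noteq> {}" by blast
  fix a assume a: "a \<in> D"
  have "[w (inv a) u = - w a u] (mod q)" if "u \<in> C" for u
    using that DC[OF a] CG by (intro w_inv_left) auto
  from this[OF x] this[OF y] show "inv a \<in> D"
    using a subgroup.m_inv_closed[OF C] by (auto simp: perp_def cong_dvd_iff)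
  fix b assume b: "b \<in> D"
  have "[w (a \<otimes> b) u = w a u + w b u] (mod q)" if "u \<in> C" for u
    using that DC[OF a] DC[OF b] CG by (intro w_mult_left) auto
  from this[OF x] this[OF y] show "a \<otimes> b \<in> D"
    using a b subgroup.m_closed[OF C] by (auto simp: perp_def cong_dvd_iff)
qed

lemma x_notin_D: "x \<notin> D"
proof
  assume "x \<in> D"
  then have "q dvd int p ^ (M - m)" using wxy by (simp add: perp_def cong_dvd_iff)
  then have "p ^ M dvd p ^ (M - m)" by (simp only: of_nat_power[symmetric] int_dvd_int_iff)
  then have "M \<le> M - m" using p_pos by (intro power_dvd_imp_le[of p])
  then show False using m by simp
qed

lemma w_coords:
  assumes d: "d \<in> D"
  shows "[w (x [^] (i::int) \<otimes> y [^] (j::int) \<otimes> d) x = - j * int p ^ (M - m)] (mod q)"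
    and "[w (x [^] i \<otimes> y [^] j \<otimes> d) y = i * int p ^ (M - m)] (mod q)"
    and "v \<in> D \<Longrightarrow> [w (x [^] i \<otimes> y [^] j \<otimes> d) v = w d v] (mod q)"
proof -
  have c: "[w (x [^] i \<otimes> y [^] j \<otimes> d) u = i * w x u + j * w y u + w d u] (mod q)" if "u \<in> C" for u
    using that x y CG DC[OF d] by (intro w_comb_left) auto
  have "[i * w x x + j * w y x + w d x = i * 0 + j * (- (int p ^ (M - m))) + 0] (mod q)"
    by (intro cong_add cong_mult cong_refl wxx wyx w_D d)
  from cong_trans[OF c[OF x] this]
  show "[w (x [^] i \<otimes> y [^] j \<otimes> d) x = - j * int p ^ (M - m)] (mod q)" by simp
  have "[i * w x y + j * w y y + w d y = i * int p ^ (M - m) + j * 0 + 0] (mod q)"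
    by (intro cong_add cong_mult cong_refl wxy wyy w_D d)
  from cong_trans[OF c[OF y] this]
  show "[w (x [^] i \<otimes> y [^] j \<otimes> d) y = i * int p ^ (M - m)] (mod q)" by simp
  assume v: "v \<in> D"
  have "[i * w x v + j * w y v + w d v = i * 0 + j * 0 + w d v] (mod q)"
    by (intro cong_add cong_mult cong_refl w_D v)
  from cong_trans[OF c[OF DC[OF v]] this]
  show "[w (x [^] i \<otimes> y [^] j \<otimes> d) v = w d v] (mod q)" by simp
qed

text \<open>The coordinates are read off from \<open>w g y\<close> and \<open>w g x\<close>.\<close>

lemma decompose:
  assumes g: "g \<in> C"
  obtains i j d where "i \<in> {0..<int p ^ m}" "j \<in> {0..<int p ^ m}" "d \<in> D" "g = x [^] i \<otimes> y [^] j \<otimes> d"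
proof -
  let ?P = "int p ^ (M - m)"
  have qP: "q = ?P * int p ^ m" using m by (simp add: power_add[symmetric])
  have pm: "int p ^ m > 0" using p_pos by simp
  have ex: "\<exists>i\<in>{0..<int p ^ m}. [w g u = i * ?P] (mod q)" if u: "u \<in> C" for u
  proof -
    obtain a where a: "w g u = ?P * a" using w_dvd_of_level[OF m(3,2) g u] by blast
    have "[a = a mod int p ^ m] (mod int p ^ m)" by (simp add: cong_def)
    then have "[w g u = (a mod int p ^ m) * ?P] (mod q)"
      unfolding a qP by (simp add: cong_iff_dvd_diff mult.commute[of _ ?P] right_diff_distrib[symmetric])
    then show ?thesis using pm by (intro bexI[of _ "a mod int p ^ m"]) auto
  qed
  obtain i where i: "i \<in> {0..<int p ^ m}" "[w g y = i * ?P] (mod q)" using ex[OF y] by blast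
  obtain j0 where j0: "j0 \<in> {0..<int p ^ m}" "[w g x = j0 * ?P] (mod q)" using ex[OF x] by blast
  define j where "j = (- j0) mod int p ^ m"
  have j: "j \<in> {0..<int p ^ m}" using pm by (simp add: j_def)
  have "int p ^ m dvd j + j0" by (simp add: j_def mod_eq_0_iff_dvd[symmetric] mod_add_left_eq)
  then obtain k where k: "j + j0 = int p ^ m * k" by blast
  have "j0 * ?P - (- j * ?P) = (j + j0) * ?P" by (simp add: distrib_right)
  also have "\<dots> = ?P * (int p ^ m * k)" by (simp add: k)
  finally have "j0 * ?P - (- j * ?P) = ?P * (int p ^ m * k)" .
  then have jj: "[j0 * ?P = - j * ?P] (mod q)"
    unfolding qP cong_iff_dvd_diff by (simp add: mult.assoc)
  define d where "d = inv (x [^] i \<otimes> y [^] j) \<otimes> g"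
  have cl: "x [^] i \<otimes> y [^] j \<in> C"
    using x y subgroup_int_pow_closed[OF C] subgroup.m_closed[OF C] by blast
  have dC: "d \<in> C" unfolding d_def using cl g subgroup.m_closed[OF C] subgroup.m_inv_closed[OF C] by blast
  have gd: "g = x [^] i \<otimes> y [^] j \<otimes> d" unfolding d_def using CG[OF cl] CG[OF g] by (simp add: inv_mult_cancel)
  have c: "[w g u = i * w x u + j * w y u + w d u] (mod q)" if "u \<in> C" for u
    unfolding gd using that x y CG dC by (intro w_comb_left) auto
  have "[i * w x x + j * w y x + w d x = i * 0 + j * (- ?P) + w d x] (mod q)"
    by (intro cong_add cong_mult cong_refl wxx wyx)
  then have "[w g x = - j * ?P + w d x] (mod q)" using cong_trans[OF c[OF x]] by simp
  then have "[- j * ?P + 0 = - j * ?P + w d x] (mod q)" using cong_trans[OF cong_sym[OF cong_trans[OF j0(2) jj]]] by simp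
  then have dx: "q dvd w d x" by (simp only: cong_add_lcancel cong_sym_eq[of 0] cong_0_iff)
  have "[i * w x y + j * w y y + w d y = i * ?P + j * 0 + w d y] (mod q)"
    by (intro cong_add cong_mult cong_refl wxy wyy)
  then have "[w g y = i * ?P + w d y] (mod q)" using cong_trans[OF c[OF y]] by simp
  then have "[i * ?P + 0 = i * ?P + w d y] (mod q)" using cong_trans[OF cong_sym[OF i(2)]] by simp
  then have dy: "q dvd w d y" by (simp only: cong_add_lcancel cong_sym_eq[of 0] cong_0_iff)
  have "d \<in> D" using dC dx dy by (simp add: perp_def)
  then show thesis using that i(1) j gd by blast
qed

end

context hyperbolic_pair
begin

lemma tors_coords:
  assumes d: "d \<in> D"
  shows "x [^] (i::int) \<otimes> y [^] (j::int) \<otimes> d \<in> tors C k \<longleftrightarrow>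
    int p ^ m dvd int p ^ k * i \<and> int p ^ m dvd int p ^ k * j \<and> d \<in> tors D k" (is "?g \<in> _ \<longleftrightarrow> _")
proof -
  let ?P = "int p ^ (M - m)"
  have qP: "q = int p ^ m * ?P" using m by (simp add: power_add[symmetric])
  have P0: "?P \<noteq> 0" using p_pos by simp
  have gC: "?g \<in> C"
    by (intro subgroup.m_closed[OF C] subgroup_int_pow_closed[OF C] x y DC[OF d])
  have eqs: "q dvd int p ^ k * w ?g x \<longleftrightarrow> int p ^ m dvd int p ^ k * j"
    "q dvd int p ^ k * w ?g y \<longleftrightarrow> int p ^ m dvd int p ^ k * i"
  proof -
    have "q dvd int p ^ k * w ?g x \<longleftrightarrow> q dvd int p ^ k * (- j * ?P)"
      by (intro cong_dvd_iff cong_mult cong_refl w_coords d)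
    also have "int p ^ k * (- j * ?P) = - ((int p ^ k * j) * ?P)" by simp
    also have "q dvd \<dots> \<longleftrightarrow> int p ^ m dvd int p ^ k * j"
      using p_pos unfolding qP by simp
    finally show "q dvd int p ^ k * w ?g x \<longleftrightarrow> int p ^ m dvd int p ^ k * j" .
    have "q dvd int p ^ k * w ?g y \<longleftrightarrow> q dvd int p ^ k * (i * ?P)"
      by (intro cong_dvd_iff cong_mult cong_refl w_coords d)
    also have "int p ^ k * (i * ?P) = (int p ^ k * i) * ?P" by simp
    also have "q dvd \<dots> \<longleftrightarrow> int p ^ m dvd int p ^ k * i"
      using p_pos unfolding qP by simp
    finally show "q dvd int p ^ k * w ?g y \<longleftrightarrow> int p ^ m dvd int p ^ k * i" .
  qed
  show ?thesis
  proof
    assume g: "?g \<in> tors C k"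
    have "q dvd int p ^ k * w d u" if u: "u \<in> D" for u
    proof -
      have "[int p ^ k * w ?g u = int p ^ k * w d u] (mod q)" by (intro cong_mult cong_refl w_coords d u)
      moreover have "q dvd int p ^ k * w ?g u" using g DC[OF u] by (simp add: tors_def)
      ultimately show ?thesis using cong_dvd_iff by blast
    qed
    then show "int p ^ m dvd int p ^ k * i \<and> int p ^ m dvd int p ^ k * j \<and> d \<in> tors D k"
      using g eqs x y d by (auto simp: tors_def)
  next
    assume a: "int p ^ m dvd int p ^ k * i \<and> int p ^ m dvd int p ^ k * j \<and> d \<in> tors D k"
    have "q dvd int p ^ k * w ?g u" if u: "u \<in> C" for u
    proof -
      obtain a b v where v: "v \<in> D" "u = x [^] (a::int) \<otimes> y [^] (b::int) \<otimes> v" using decompose[OF u] by metis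
      have gG: "?g \<in> carrier G" using CG[OF gC] .
      have "[w ?g u = a * w ?g x + b * w ?g y + w ?g v] (mod q)"
        unfolding v(2) by (intro w_comb_right gG) (use x y CG DC[OF v(1)] in auto)
      then have "[int p ^ k * w ?g u = int p ^ k * (a * w ?g x + b * w ?g y + w ?g v)] (mod q)"
        by (intro cong_mult cong_refl)
      moreover have "q dvd int p ^ k * w ?g v"
      proof -
        have "[int p ^ k * w ?g v = int p ^ k * w d v] (mod q)" by (intro cong_mult cong_refl w_coords d v)
        moreover have "q dvd int p ^ k * w d v" using a v by (simp add: tors_def)
        ultimately show ?thesis using cong_dvd_iff by blast
      qed
      moreover have "int p ^ k * (a * w ?g x + b * w ?g y + w ?g v) =
         a * (int p ^ k * w ?g x) + b * (int p ^ k * w ?g y) + int p ^ k * w ?g v" by (simp add: algebra_simps)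
      moreover have "q dvd int p ^ k * w ?g x" "q dvd int p ^ k * w ?g y" using eqs a by auto
      ultimately have "q dvd int p ^ k * (a * w ?g x + b * w ?g y + w ?g v)"
        by (simp only: dvd_add dvd_mult)
      then show ?thesis
        using cong_dvd_iff[OF \<open>[int p ^ k * w ?g u = int p ^ k * (a * w ?g x + b * w ?g y + w ?g v)] (mod q)\<close>] by blast
    qed
    then show "?g \<in> tors C k" using gC by (simp add: tors_def)
  qed
qed

lemma tors_D: "tors D k = tors C k \<inter> D"
proof -
  have "d \<in> tors D k \<longleftrightarrow> d \<in> tors C k" if d: "d \<in> D" for d
    using tors_coords[OF d, of 0 0 k] x y CG DC[OF d] by simp
  then show ?thesis using tors_subset by blast
qed

text \<open>Torsion splits along the decomposition. The contribution of the plane depends only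
  on \<open>p\<close>, \<open>m\<close> and \<open>k\<close>, so it cancels when two forms are
  compared.\<close>

lemma card_tors:
  "card (tors C k) = card {i \<in> {0..<int p ^ m}. int p ^ m dvd int p ^ k * i} ^ 2 * card (tors D k)"
proof -
  let ?I = "{i \<in> {0..<int p ^ m}. int p ^ m dvd int p ^ k * i}"
  let ?f = "\<lambda>(i, j, d). x [^] (i::int) \<otimes> y [^] (j::int) \<otimes> d"
  have "bij_betw ?f (?I \<times> ?I \<times> tors D k) (tors C k)"
  proof (rule bij_betw_imageI)
    have eq: "i = i' \<and> j = j' \<and> d = d'"
      if i: "i \<in> ?I" "i' \<in> ?I" and j: "j \<in> ?I" "j' \<in> ?I" and d: "d \<in> tors D k" "d' \<in> tors D k"
        and e: "x [^] i \<otimes> y [^] j \<otimes> d = x [^] i' \<otimes> y [^] j' \<otimes> d'" for i j d i' j' d'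
    proof -
      have dD: "d \<in> D" "d' \<in> D" using d tors_subset by auto
      have qP: "q = int p ^ m * int p ^ (M - m)" using m by (simp add: power_add[symmetric])
      have *: "a = a'" if "[a * int p ^ (M - m) = a' * int p ^ (M - m)] (mod q)" "a \<in> ?I" "a' \<in> ?I" for a a'
      proof -
        have "int p ^ m dvd a - a'" using that(1) p_pos
          by (simp add: cong_iff_dvd_diff qP left_diff_distrib[symmetric])
        then have "[a = a'] (mod int p ^ m)" by (simp add: cong_iff_dvd_diff)
        then show "a = a'" using that(2,3) by (simp add: cong_def)
      qed
      have "[i * int p ^ (M - m) = i' * int p ^ (M - m)] (mod q)"
        by (rule cong_trans[OF cong_sym[OF w_coords(2)[OF dD(1), of i j]]
              w_coords(2)[OF dD(2), of i' j', folded e]])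
      then have ii: "i = i'" using * i by blast
      have "[- j * int p ^ (M - m) = - j' * int p ^ (M - m)] (mod q)"
        by (rule cong_trans[OF cong_sym[OF w_coords(1)[OF dD(1), of i j]]
              w_coords(1)[OF dD(2), of i' j', folded e]])
      then have "[j * int p ^ (M - m) = j' * int p ^ (M - m)] (mod q)" by (simp add: cong_minus_minus_iff)
      then have jj: "j = j'" using * j by blast
      have "x [^] i \<otimes> y [^] j \<in> carrier G" using x y CG by simp
      then have "d = d'" using l_cancel[of "x [^] i \<otimes> y [^] j" d d'] e[folded ii jj] CG DC dD by simp
      then show ?thesis using ii jj by simp
    qed
    show "inj_on ?f (?I \<times> ?I \<times> tors D k)"
    proof (rule inj_onI)
      fix a b assume ab: "a \<in> ?I \<times> ?I \<times> tors D k" "b \<in> ?I \<times> ?I \<times> tors D k" "?f a = ?f b"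
      obtain i j d where a: "a = (i, j, d)" by (cases a)
      obtain i' j' d' where b: "b = (i', j', d')" by (cases b)
      show "a = b" using eq[of i i' j j' d d'] ab unfolding a b by simp
    qed
    show "?f ` (?I \<times> ?I \<times> tors D k) = tors C k"
    proof (intro equalityI subsetI)
      fix g assume "g \<in> ?f ` (?I \<times> ?I \<times> tors D k)"
      then obtain i j d where "i \<in> ?I" "j \<in> ?I" "d \<in> tors D k" "g = x [^] i \<otimes> y [^] j \<otimes> d" by auto
      then show "g \<in> tors C k" using tors_coords[of d i j k] tors_subset[of D k] by auto
    next
      fix g assume g: "g \<in> tors C k"
      then have "g \<in> C" using tors_subset by blast
      then obtain i j d where ij: "i \<in> {0..<int p ^ m}" "j \<in> {0..<int p ^ m}" "d \<in> D" "g = x [^] i \<otimes> y [^] j \<otimes> d"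
        by (rule decompose)
      then have "(i, j, d) \<in> ?I \<times> ?I \<times> tors D k" using g tors_coords[OF ij(3), of i j k] by auto
      then show "g \<in> ?f ` (?I \<times> ?I \<times> tors D k)" using ij(4) by (intro image_eqI[of _ _ "(i, j, d)"]) auto
    qed
  qed
  then have "card (tors C k) = card (?I \<times> ?I \<times> tors D k)" by (rule bij_betw_same_card[symmetric])
  then show ?thesis by (simp add: card_cartesian_product power2_eq_square)
qed

lemma card_D_less: "card D < card C"
proof (rule psubset_card_mono)
  show "finite C" using finite_subset[OF subgroup.subset[OF C] finite_G] .
  show "D \<subset> C" using D_sub x x_notin_D by blast
qed

end

context alternating_form
begin

lemma hyperbolic_pairI:
  assumes "subgroup C G" "1 \<le> m" "m \<le> M" "tors C m = C" "x \<in> C" "y \<in> C" "[w x y = int p ^ (M - m)] (mod q)"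
  shows "hyperbolic_pair G p M w \<chi> C m x y"
  using assms alternating_form_axioms by (simp add: hyperbolic_pair_def hyperbolic_pair_axioms_def)

lemma nontrivial_pairing:
  assumes "tors C k \<noteq> C"
  obtains x u where "x \<in> C" "u \<in> C" "\<not> q dvd int p ^ k * w x u"
  using assms by (auto simp: tors_def)

text \<open>For \<open>e1 = 0\<close> and large \<open>e\<close> this says that every
  homomorphism vanishing on the radical is given by pairing with an element. In general a
  homomorphism on the \<open>p^e\<close>-torsion that vanishes on the
  \<open>p^e1\<close>-torsion factors through multiplication by \<open>p^e1\<close>. Splitting
  off one hyperbolic plane at a time reduces the claim to the plane, where the two values on
  generators of the torsion can be prescribed.\<close>

lemma partial_duality:
  assumes "subgroup C G" and "e1 \<le> e" and "hom_mod q (tors C e) \<delta>" and "\<And>c. c \<in> tors C e1 \<Longrightarrow> q dvd \<delta> c"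
  obtains d where "d \<in> C" "\<And>c. c \<in> tors C e \<Longrightarrow> [\<delta> c = int p ^ e1 * w c d] (mod q)"
  using assms
proof (induction "card C" arbitrary: C thesis rule: less_induct)
  case less
  note C = less.prems(2) and e1 = less.prems(3) and \<delta> = less.prems(4) and van = less.prems(5)
  have CG: "c \<in> carrier G" if "c \<in> C" for c using subgroup.mem_carrier[OF C that] .
  have triv: thesis if "tors C e1 = C"
  proof (rule less.prems(1)[of \<one>])
    show "\<one> \<in> C" by (rule subgroup.one_closed[OF C])
    fix c assume "c \<in> tors C e"
    then have c: "c \<in> C" using tors_subset by blast
    have "[int p ^ e1 * w c \<one> = int p ^ e1 * 0] (mod q)" by (intro cong_mult cong_refl w_one_right CG c)
    moreover have "[\<delta> c = 0] (mod q)" using van that c by (simp add: cong_0_iff)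
    ultimately show "[\<delta> c = int p ^ e1 * w c \<one>] (mod q)" using cong_sym cong_trans by simp blast
  qed
  show thesis
  proof (cases "tors C e1 = C")
    case False
    then have "tors C 0 \<noteq> C" using tors_mono[of 0 e1 C] tors_subset[of C e1] by auto
    then obtain m where m: "1 \<le> m" "m \<le> M" "tors C m = C" "tors C (m - 1) \<noteq> C" by (rule level_exists)
    have e1m: "e1 < m"
    proof (rule ccontr)
      assume "\<not> e1 < m"
      then have "tors C m \<subseteq> tors C e1" by (intro tors_mono) simp
      then show False using False m(3) tors_subset[of C e1] by blast
    qed
    obtain x u where xu: "x \<in> C" "u \<in> C" "\<not> q dvd int p ^ (m - 1) * w x u"
      using nontrivial_pairing[OF m(4)] by blast
    obtain y where y: "y \<in> C" "[w x y = int p ^ (M - m)] (mod q)"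
      using partner_exists[OF C m(1-3) xu] by blast
    interpret P: hyperbolic_pair G p M w \<chi> C m x y
      by (rule hyperbolic_pairI[OF C m(1-3) xu(1) y])
    \<comment> \<open>Torsion beyond the exponent is everything, so \<open>e\<close> may be
      lowered to \<open>m\<close>.\<close>
    define f where "f = min e m"
    have tef: "tors C e = tors C f"
    proof (cases "e \<le> m")
      case False
      then have "tors C e = C" using m(3) tors_mono[of m e C] tors_subset[of C e] by auto
      then show ?thesis using m(3) False by (simp add: f_def)
    qed (simp add: f_def)
    have f: "e1 \<le> f" "f \<le> m" "f \<le> M" using e1 e1m m(2) by (auto simp: f_def)
    have Dsub: "tors P.D k \<subseteq> tors C k" for k using P.tors_D by blast
    obtain d0 where d0: "d0 \<in> P.D" "\<And>c. c \<in> tors P.D e \<Longrightarrow> [\<delta> c = int p ^ e1 * w c d0] (mod q)"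
    proof (rule less.hyps[OF P.card_D_less _ P.D_subgroup e1])
      show "hom_mod q (tors P.D e) \<delta>" by (rule hom_mod_subset[OF \<delta> Dsub])
      show "q dvd \<delta> c" if "c \<in> tors P.D e1" for c using van Dsub that by blast
    qed blast
    have tC: "subgroup (tors C e) G" by (rule tors_subgroup[OF C])
    note comb = hom_mod_comb[OF tC \<delta>]
    have oneD: "\<one> \<in> P.D" by (rule subgroup.one_closed[OF P.D_subgroup])
    have oneT: "\<one> \<in> tors P.D k" for k using subgroup.one_closed[OF tors_subgroup[OF P.D_subgroup]] .
    let ?s = "int p ^ (m - f)"
    have pw: "int p ^ m = int p ^ f * ?s" using f by (simp add: power_add[symmetric])
    have xs: "x [^] ?s \<in> tors C e" "y [^] ?s \<in> tors C e"
      using P.tors_coords[OF oneD, of ?s 0 f] P.tors_coords[OF oneD, of 0 ?s f] oneT CG xu(1) y(1)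
      by (auto simp: tef pw)
    have val: "\<exists>\<alpha>. \<delta> s = int p ^ (M - f + e1) * \<alpha>" if s: "s \<in> tors C e" and st: "s [^] (int p ^ (f - e1)) \<in> tors C e1" for s
    proof -
      have "[\<delta> (s [^] (int p ^ (f - e1))) = int p ^ (f - e1) * \<delta> s] (mod q)"
        by (rule hom_mod_int_pow[OF tC \<delta> s])
      then have "q dvd int p ^ (f - e1) * \<delta> s" using van[OF st] cong_dvd_iff by blast
      then have "int p ^ (M - (f - e1)) dvd \<delta> s" using prime_power_dvd_cancel[OF p_pos(1), of "f - e1" M] f by simp
      moreover have "M - (f - e1) = M - f + e1" using f by simp
      ultimately show ?thesis by auto
    qed
    have "int p ^ m = int p ^ e1 * (?s * int p ^ (f - e1))" using f by (simp add: power_add[symmetric])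
    then have "x [^] (?s * int p ^ (f - e1)) \<in> tors C e1" "y [^] (?s * int p ^ (f - e1)) \<in> tors C e1"
      using P.tors_coords[OF oneD, of "?s * int p ^ (f - e1)" 0 e1]
        P.tors_coords[OF oneD, of 0 "?s * int p ^ (f - e1)" e1] oneT CG xu(1) y(1) by auto
    then have "(x [^] ?s) [^] (int p ^ (f - e1)) \<in> tors C e1" "(y [^] ?s) [^] (int p ^ (f - e1)) \<in> tors C e1"
      using int_pow_pow CG xu(1) y(1) by auto
    then obtain \<alpha> \<beta> where \<alpha>: "\<delta> (x [^] ?s) = int p ^ (M - f + e1) * \<alpha>" and \<beta>: "\<delta> (y [^] ?s) = int p ^ (M - f + e1) * \<beta>"
      using val[OF xs(1)] val[OF xs(2)] by blast
    \<comment> \<open>Pairing with \<open>x\<close> and \<open>y\<close> produces the prescribed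
      values on \<open>y\<close> and \<open>x\<close>; \<open>d0\<close> handles the complement.\<close>
    define d where "d = x [^] (- \<beta>) \<otimes> y [^] \<alpha> \<otimes> d0"
    show thesis
    proof (rule less.prems(1))
      show "d \<in> C" unfolding d_def
        by (intro subgroup.m_closed[OF C] subgroup_int_pow_closed[OF C] xu(1) y(1) P.DC[OF d0(1)])
      fix c assume c: "c \<in> tors C e"
      then have cC: "c \<in> C" using tors_subset by blast
      obtain i j c' where ij: "c' \<in> P.D" "c = x [^] (i::int) \<otimes> y [^] (j::int) \<otimes> c'" using P.decompose[OF cC] by metis
      have t: "int p ^ m dvd int p ^ f * i" "int p ^ m dvd int p ^ f * j" "c' \<in> tors P.D f"
        using P.tors_coords[OF ij(1), of i j f] c ij(2) tef by auto
      have c'e: "c' \<in> tors P.D e" using t(3) P.tors_D tef by blast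
      obtain i' j' where i': "i = ?s * i'" "j = ?s * j'"
        using t(1,2) p_pos unfolding pw by (auto simp: dvd_def)
      have "c = (x [^] ?s) [^] i' \<otimes> (y [^] ?s) [^] j' \<otimes> c'"
        using ij(2) i' CG xu(1) y(1) by (simp add: int_pow_pow)
      then have "[\<delta> c = i' * \<delta> (x [^] ?s) + j' * \<delta> (y [^] ?s) + \<delta> c'] (mod q)"
        using comb[OF xs, of c'] c'e Dsub by auto
      also have "[i' * \<delta> (x [^] ?s) + j' * \<delta> (y [^] ?s) + \<delta> c' =
          i' * \<delta> (x [^] ?s) + j' * \<delta> (y [^] ?s) + int p ^ e1 * w c' d0] (mod q)"
        by (intro cong_add cong_refl d0 c'e)
      also have "i' * \<delta> (x [^] ?s) + j' * \<delta> (y [^] ?s) + int p ^ e1 * w c' d0 =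
          int p ^ e1 * (i * (int p ^ (M - m) * \<alpha>) + j * (int p ^ (M - m) * \<beta>) + w c' d0)"
      proof -
        have "M - f + e1 = e1 + ((m - f) + (M - m))" using f m by simp
        then have "int p ^ (M - f + e1) = int p ^ (e1 + ((m - f) + (M - m)))" by (rule arg_cong)
        also have "\<dots> = int p ^ e1 * (?s * int p ^ (M - m))" by (simp only: power_add)
        finally have eq: "int p ^ (M - f + e1) = int p ^ e1 * (?s * int p ^ (M - m))" .
        show ?thesis unfolding \<alpha> \<beta> i' eq by (simp only: distrib_left mult.assoc mult.left_commute mult.commute)
      qed
      also have "[int p ^ e1 * (i * (int p ^ (M - m) * \<alpha>) + j * (int p ^ (M - m) * \<beta>) + w c' d0) = int p ^ e1 * w c d] (mod q)"
      proof (rule cong_mult[OF cong_refl cong_sym])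
        have dG: "d \<in> carrier G" using \<open>d \<in> C\<close> CG by blast
        have wd: "[w g d = (- \<beta>) * w g x + \<alpha> * w g y + w g d0] (mod q)" if "g \<in> C" for g
          unfolding d_def by (intro w_comb_right) (use that CG xu(1) y(1) P.DC[OF d0(1)] in auto)
        have wxd: "[w x d = int p ^ (M - m) * \<alpha>] (mod q)"
        proof -
          have "[(- \<beta>) * w x x + \<alpha> * w x y + w x d0 = (- \<beta>) * 0 + \<alpha> * int p ^ (M - m) + 0] (mod q)"
            by (intro cong_add cong_mult cong_refl P.wxx P.wxy P.w_D d0)
          from cong_trans[OF wd[OF xu(1)] this] show ?thesis by (simp add: mult.commute)
        qed
        have wyd: "[w y d = int p ^ (M - m) * \<beta>] (mod q)"
        proof -
          have "[(- \<beta>) * w y x + \<alpha> * w y y + w y d0 = (- \<beta>) * (- (int p ^ (M - m))) + \<alpha> * 0 + 0] (mod q)"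
            by (intro cong_add cong_mult cong_refl P.wyx P.wyy P.w_D d0)
          from cong_trans[OF wd[OF y(1)] this] show ?thesis by (simp add: mult.commute)
        qed
        have wcd: "[w c' d = w c' d0] (mod q)"
        proof -
          have "[(- \<beta>) * w c' x + \<alpha> * w c' y + w c' d0 = (- \<beta>) * 0 + \<alpha> * 0 + w c' d0] (mod q)"
            by (intro cong_add cong_mult cong_refl P.w_D ij)
          from cong_trans[OF wd[OF P.DC[OF ij(1)]] this] show ?thesis by simp
        qed
        have "[w c d = i * w x d + j * w y d + w c' d] (mod q)"
          unfolding ij(2) by (intro w_comb_left dG) (use CG xu(1) y(1) P.DC[OF ij(1)] in auto)
        also have "[i * w x d + j * w y d + w c' d =
          i * (int p ^ (M - m) * \<alpha>) + j * (int p ^ (M - m) * \<beta>) + w c' d0] (mod q)"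
          by (intro cong_add cong_mult cong_refl wxd wyd wcd)
        finally show "[w c d = i * (int p ^ (M - m) * \<alpha>) + j * (int p ^ (M - m) * \<beta>) + w c' d0] (mod q)" .
      qed
      finally show "[\<delta> c = int p ^ e1 * w c d] (mod q)" .
    qed
  qed (rule triv)
qed

lemma chi_value:
  assumes "tors C m = C" "m \<le> M" "subgroup C G" "c \<in> C" and rad: "\<And>c. c \<in> tors C 0 \<Longrightarrow> q dvd \<chi> c"
  shows "q dvd int p ^ m * \<chi> c"
proof -
  have cG: "c \<in> carrier G" using assms(3,4) by (simp add: subgroup.mem_carrier)
  have "q dvd int p ^ 0 * w (c [^] (int p ^ m)) u" if u: "u \<in> C" for u
  proof -
    have "[w (c [^] (int p ^ m)) u = int p ^ m * w c u] (mod q)"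
      using cG u assms(3) by (intro w_pow_left) (auto simp: subgroup.mem_carrier)
    moreover have "q dvd int p ^ m * w c u" using assms(1,4) u by (auto simp: tors_def)
    ultimately show ?thesis using cong_dvd_iff by auto
  qed
  then have "c [^] (int p ^ m) \<in> tors C 0"
    using subgroup_int_pow_closed[OF assms(3,4)] by (simp add: tors_def)
  then have "q dvd \<chi> (c [^] (int p ^ m))" by (rule rad)
  moreover have "[\<chi> (c [^] (int p ^ m)) = int p ^ m * \<chi> c] (mod q)" by (rule chi_pow[OF cG])
  ultimately show ?thesis using cong_dvd_iff by blast
qed

text \<open>A hyperbolic plane of maximal order on which \<open>\<chi>\<close> is in normal
  form, as far as \<open>\<chi>\<close> matters on the \<open>p^e\<close>-torsion: on
  \<open>x\<close> it takes the value \<open>p^(M-m+e1)\<close>, where \<open>e1\<close> is the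
  largest index with \<open>p^(m-e1) \<chi> = 0\<close>, and on \<open>y\<close> it is zero. Two
  properties are wanted of \<open>x\<close>: maximal order, and a value of \<open>\<chi>\<close>
  of maximal order. If one element has the first and another the second, one of the two or their
  product has both.\<close>

lemma normalized_pair:
  assumes C: "subgroup C G" and m: "1 \<le> m" "m \<le> M" "tors C m = C" "tors C (m - 1) \<noteq> C"
    and e: "e1 \<le> e" "e \<le> m"
    and van: "\<And>c. c \<in> C \<Longrightarrow> q dvd int p ^ (m - e1) * \<chi> c"
    and sharp: "e1 = e \<or> (\<exists>c\<in>C. \<not> q dvd int p ^ (m - e1 - 1) * \<chi> c)"
  obtains x y where "x \<in> C" "y \<in> C" "[w x y = int p ^ (M - m)] (mod q)"
    "[int p ^ (m - e) * \<chi> x = int p ^ (M - e + e1)] (mod q)" "q dvd int p ^ (m - e) * \<chi> y"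
proof -
  have CG: "c \<in> carrier G" if "c \<in> C" for c using subgroup.mem_carrier[OF C that] .
  have C_mult: "a \<otimes> b \<in> C" if "a \<in> C" "b \<in> C" for a b using subgroup.m_closed[OF C that] .
  obtain x0 u0 where x0: "x0 \<in> C" "u0 \<in> C" "\<not> q dvd int p ^ (m - 1) * w x0 u0"
    using nontrivial_pairing[OF m(4)] by blast
  show thesis
  proof (cases "e1 = e")
    case True
    obtain y where y: "y \<in> C" "[w x0 y = int p ^ (M - m)] (mod q)"
      using partner_exists[OF C m(1-3) x0] by blast
    have "[int p ^ (m - e) * \<chi> x0 = 0] (mod q)" using van[OF x0(1)] True by (simp add: cong_0_iff)
    moreover have "int p ^ (M - e + e1) = q" using True e m by simp
    moreover have "[0 = q] (mod q)" by (simp add: cong_sym_eq[of 0] cong_0_iff)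
    ultimately have "[int p ^ (m - e) * \<chi> x0 = int p ^ (M - e + e1)] (mod q)" using cong_trans by metis
    then show thesis using that[OF x0(1) y] van[OF y(1)] True by simp
  next
    case False
    then obtain c where c: "c \<in> C" "\<not> q dvd int p ^ (m - e1 - 1) * \<chi> c" using sharp by blast
    have e1m: "e1 < m" using False e by simp
    have "\<exists>x1\<in>C. (\<exists>u\<in>C. \<not> q dvd int p ^ (m - 1) * w x1 u) \<and> \<not> q dvd int p ^ (m - e1 - 1) * \<chi> x1"
    proof (cases "q dvd int p ^ (m - e1 - 1) * \<chi> x0")
      case True
      show ?thesis
      proof (cases "\<exists>u\<in>C. \<not> q dvd int p ^ (m - 1) * w c u")
        case False
        have "[int p ^ (m - 1) * w (x0 \<otimes> c) u0 = int p ^ (m - 1) * (w x0 u0 + w c u0)] (mod q)"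
          using x0 c CG by (intro cong_mult cong_refl w_mult_left) auto
        moreover have "q dvd int p ^ (m - 1) * w c u0" using False x0 by blast
        then have "\<not> q dvd int p ^ (m - 1) * (w x0 u0 + w c u0)"
          using x0(3) by (simp add: distrib_left dvd_add_left_iff)
        ultimately have 1: "\<not> q dvd int p ^ (m - 1) * w (x0 \<otimes> c) u0" using cong_dvd_iff by blast
        have "[int p ^ (m - e1 - 1) * \<chi> (x0 \<otimes> c) = int p ^ (m - e1 - 1) * (\<chi> x0 + \<chi> c)] (mod q)"
          using x0 c CG by (intro cong_mult cong_refl chi_mult) auto
        moreover have "\<not> q dvd int p ^ (m - e1 - 1) * (\<chi> x0 + \<chi> c)"
          using c(2) True by (simp add: distrib_left dvd_add_right_iff)
        ultimately have "\<not> q dvd int p ^ (m - e1 - 1) * \<chi> (x0 \<otimes> c)" using cong_dvd_iff by blast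
        then show ?thesis using 1 x0 c C_mult by blast
      qed (use c in blast)
    qed (use x0 in blast)
    then obtain x1 u where x1: "x1 \<in> C" "u \<in> C" "\<not> q dvd int p ^ (m - 1) * w x1 u"
      "\<not> q dvd int p ^ (m - e1 - 1) * \<chi> x1" by blast
    have div: "\<exists>v. \<chi> a = int p ^ (M - m + e1) * v" if "a \<in> C" for a
    proof -
      have "int p ^ (M - (m - e1)) dvd \<chi> a"
        using van[OF that] prime_power_dvd_cancel[OF p_pos(1), of "m - e1" M] m by simp
      moreover have "M - (m - e1) = M - m + e1" using m e1m by simp
      ultimately show ?thesis by auto
    qed
    obtain v where v: "\<chi> x1 = int p ^ (M - m + e1) * v" using div[OF x1(1)] by blast
    have "\<not> int p dvd v"
    proof
      assume "int p dvd v"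
      then obtain t where "v = int p * t" by blast
      then have "int p ^ (m - e1 - 1) * \<chi> x1 = int p ^ ((m - e1 - 1) + (M - m + e1) + 1) * t"
        by (simp add: v power_add)
      moreover have "(m - e1 - 1) + (M - m + e1) + 1 = M" using m e1m by simp
      ultimately show False using x1(4) by simp
    qed
    then obtain b where b: "[v * b = 1] (mod q)" "\<not> int p dvd b" using inverse_mod_prime_power[OF prime_p] by blast
    define x where "x = x1 [^] b"
    have xC: "x \<in> C" unfolding x_def by (rule subgroup_int_pow_closed[OF C x1(1)])
    have "[\<chi> x = b * \<chi> x1] (mod q)" unfolding x_def by (rule chi_pow) (rule CG[OF x1(1)])
    also have "b * \<chi> x1 = int p ^ (M - m + e1) * (v * b)" by (simp add: v)
    also have "[int p ^ (M - m + e1) * (v * b) = int p ^ (M - m + e1) * 1] (mod q)"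
      by (intro cong_mult cong_refl b)
    finally have chix: "[\<chi> x = int p ^ (M - m + e1)] (mod q)" by simp
    have wx: "\<not> q dvd int p ^ (m - 1) * w x u"
    proof
      assume "q dvd int p ^ (m - 1) * w x u"
      moreover have "[int p ^ (m - 1) * w x u = int p ^ (m - 1) * (b * w x1 u)] (mod q)"
        unfolding x_def by (intro cong_mult cong_refl w_pow_left) (use CG x1 in auto)
      ultimately have "q dvd b * (int p ^ (m - 1) * w x1 u)"
        using cong_dvd_iff by (metis mult.left_commute)
      moreover have "coprime (int p ^ M) b"
        using prime_imp_coprime[of "int p" b] prime_p b(2) by simp
      ultimately show False using x1(3) by (simp add: coprime_dvd_mult_right_iff)
    qed
    obtain y0 where y0: "y0 \<in> C" "[w x y0 = int p ^ (M - m)] (mod q)"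
      using partner_exists[OF C m(1-3) xC x1(2) wx] by blast
    obtain \<beta> where \<beta>: "\<chi> y0 = int p ^ (M - m + e1) * \<beta>" using div[OF y0(1)] by blast
    define y where "y = y0 \<otimes> x [^] (- \<beta>)"
    have xb: "x [^] (- \<beta>) \<in> C" by (rule subgroup_int_pow_closed[OF C xC])
    have yC: "y \<in> C" unfolding y_def by (rule C_mult[OF y0(1) xb])
    have "[w x y = w x y0 + w x (x [^] (- \<beta>))] (mod q)"
      unfolding y_def by (rule w_mult_right) (use CG xC y0(1) xb in auto)
    also have "[w x y0 + w x (x [^] (- \<beta>)) = int p ^ (M - m) + (- \<beta>) * w x x] (mod q)"
      by (intro cong_add y0 w_pow_right) (use CG xC in auto)
    also have "[int p ^ (M - m) + (- \<beta>) * w x x = int p ^ (M - m) + (- \<beta>) * 0] (mod q)"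
      by (intro cong_add cong_mult cong_refl w_alt) (use CG xC in auto)
    finally have wxy: "[w x y = int p ^ (M - m)] (mod q)" by simp
    have "[\<chi> y = \<chi> y0 + \<chi> (x [^] (- \<beta>))] (mod q)"
      unfolding y_def by (rule chi_mult) (use CG y0(1) xb in auto)
    also have "[\<chi> y0 + \<chi> (x [^] (- \<beta>)) = \<chi> y0 + (- \<beta>) * \<chi> x] (mod q)"
      by (intro cong_add cong_refl chi_pow) (use CG xC in auto)
    also have "[\<chi> y0 + (- \<beta>) * \<chi> x = int p ^ (M - m + e1) * \<beta> + (- \<beta>) * int p ^ (M - m + e1)] (mod q)"
      unfolding \<beta> by (intro cong_add cong_mult cong_refl chix)
    finally have "q dvd \<chi> y" by (simp add: cong_0_iff mult.commute)
    moreover have "[int p ^ (m - e) * \<chi> x = int p ^ (m - e) * int p ^ (M - m + e1)] (mod q)"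
      by (intro cong_mult cong_refl chix)
    moreover have "int p ^ (m - e) * int p ^ (M - m + e1) = int p ^ (M - e + e1)"
      using e m by (simp add: power_add[symmetric])
    ultimately show thesis using that[OF xC yC wxy] by simp
  qed
qed

end

context alternating_form
begin

text \<open>The element \<open>g\<close> has the class of \<open>x^i y^j c\<close> modulo the
  radical of \<open>C\<close>. Additivity is exact for this relation, while products in the
  group would have to be reordered.\<close>

definition approx :: "'a set \<Rightarrow> 'a \<Rightarrow> int \<Rightarrow> 'a \<Rightarrow> int \<Rightarrow> 'a \<Rightarrow> 'a \<Rightarrow> bool" where
  "approx C g i x j y c \<longleftrightarrow> (\<forall>u\<in>C. [w g u = i * w x u + j * w y u + w c u] (mod q))"

lemma approx_self:
  assumes "subgroup C G" "x \<in> C" "y \<in> C" "c \<in> C"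
  shows "approx C (x [^] i \<otimes> y [^] j \<otimes> c) i x j y c"
  unfolding approx_def using assms by (auto intro!: w_comb_left dest: subgroup.mem_carrier)

lemma approx_mult:
  assumes C: "subgroup C G" and "g \<in> C" "h \<in> C" "c \<in> C" "d \<in> C"
    and g: "approx C g i x j y c" and h: "approx C h k x l y d"
  shows "approx C (g \<otimes> h) (i + k) x (j + l) y (c \<otimes> d)"
  unfolding approx_def
proof
  fix u assume u: "u \<in> C"
  have "[w (g \<otimes> h) u = w g u + w h u] (mod q)"
    by (rule w_mult_left) (use assms u in \<open>auto dest: subgroup.mem_carrier\<close>)
  also have "[w g u + w h u = (i * w x u + j * w y u + w c u) + (k * w x u + l * w y u + w d u)] (mod q)"
    by (intro cong_add) (use g h u in \<open>auto simp: approx_def\<close>)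
  also have "(i * w x u + j * w y u + w c u) + (k * w x u + l * w y u + w d u) =
     (i + k) * w x u + (j + l) * w y u + (w c u + w d u)" by (simp add: algebra_simps)
  also have "[(i + k) * w x u + (j + l) * w y u + (w c u + w d u) =
     (i + k) * w x u + (j + l) * w y u + w (c \<otimes> d) u] (mod q)"
    by (intro cong_add cong_refl cong_sym[OF w_mult_left]) (use assms u in \<open>auto dest: subgroup.mem_carrier\<close>)
  finally show "[w (g \<otimes> h) u = (i + k) * w x u + (j + l) * w y u + w (c \<otimes> d) u] (mod q)" .
qed

lemma chi_cong:
  assumes C: "subgroup C G" and a: "a \<in> C" and b: "b \<in> C"
    and rad: "\<And>c. c \<in> tors C 0 \<Longrightarrow> q dvd \<chi> c"
    and eq: "\<And>u. u \<in> C \<Longrightarrow> [w a u = w b u] (mod q)"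
  shows "[\<chi> a = \<chi> b] (mod q)"
proof -
  have CG: "c \<in> carrier G" if "c \<in> C" for c using subgroup.mem_carrier[OF C that] .
  define t where "t = inv b \<otimes> a"
  have ib: "inv b \<in> C" by (rule subgroup.m_inv_closed[OF C b])
  have t: "t \<in> C" unfolding t_def by (rule subgroup.m_closed[OF C ib a])
  have "q dvd w t u" if u: "u \<in> C" for u
  proof -
    have "[w t u = w (inv b) u + w a u] (mod q)"
      unfolding t_def by (rule w_mult_left) (use CG u ib a in auto)
    also have "[w (inv b) u + w a u = - w b u + w b u] (mod q)"
      by (intro cong_add w_inv_left eq u) (use CG u b in auto)
    finally show ?thesis by (simp add: cong_0_iff)
  qed
  then have "q dvd \<chi> t" using t by (intro rad) (simp add: tors_def)
  have "a = b \<otimes> t" unfolding t_def using CG a b by (simp add: inv_mult_cancel)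
  then have "[\<chi> a = \<chi> b + \<chi> t] (mod q)" using chi_mult[of b t] CG b t by simp
  also have "[\<chi> b + \<chi> t = \<chi> b + 0] (mod q)"
    by (intro cong_add cong_refl) (use \<open>q dvd \<chi> t\<close> in \<open>simp add: cong_0_iff\<close>)
  finally show ?thesis by simp
qed

lemma tors_cong:
  assumes "a \<in> C" "b \<in> C" "\<And>u. u \<in> C \<Longrightarrow> [w a u = w b u] (mod q)"
  shows "a \<in> tors C k \<longleftrightarrow> b \<in> tors C k"
proof -
  have "q dvd int p ^ k * w a u \<longleftrightarrow> q dvd int p ^ k * w b u" if "u \<in> C" for u
    by (intro cong_dvd_iff cong_mult cong_refl assms that)
  then show ?thesis using assms by (auto simp: tors_def)
qed

lemma chi_approx:
  assumes C: "subgroup C G" and "g \<in> C" "x \<in> C" "y \<in> C" "c \<in> C"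
    and rad: "\<And>c. c \<in> tors C 0 \<Longrightarrow> q dvd \<chi> c"
    and g: "approx C g i x j y c"
  shows "[\<chi> g = i * \<chi> x + j * \<chi> y + \<chi> c] (mod q)"
proof -
  have CG: "c \<in> carrier G" if "c \<in> C" for c using subgroup.mem_carrier[OF C that] .
  let ?h = "x [^] i \<otimes> y [^] j \<otimes> c"
  have h: "?h \<in> C" by (intro subgroup.m_closed[OF C] subgroup_int_pow_closed[OF C] assms)
  have "[\<chi> g = \<chi> ?h] (mod q)"
  proof (rule chi_cong[OF C \<open>g \<in> C\<close> h rad])
    fix u assume u: "u \<in> C"
    have "[w g u = i * w x u + j * w y u + w c u] (mod q)" using g u by (simp add: approx_def)
    also have "[i * w x u + j * w y u + w c u = w ?h u] (mod q)"
      using approx_self[OF C assms(3-5), of i j] u by (simp add: approx_def cong_sym_eq)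
    finally show "[w g u = w ?h u] (mod q)" .
  qed
  also have "[\<chi> ?h = i * \<chi> x + j * \<chi> y + \<chi> c] (mod q)"
    by (intro chi_comb CG assms)
  finally show ?thesis .
qed

end

context hyperbolic_pair
begin

text \<open>Where \<open>k \<le> l + e1\<close>, the value of \<open>p^l \<chi>\<close> on the
  torsion of the plane is zero anyway. Hence these conditions are the same for \<open>C\<close>
  and for the complement, which is what the induction needs.\<close>

lemma chi_tors_D:
  assumes van: "\<And>c. c \<in> C \<Longrightarrow> q dvd int p ^ (m - e1) * \<chi> c" and e1: "e1 \<le> m" and kl: "k \<le> l + e1"
  shows "(\<forall>c\<in>tors C k. q dvd int p ^ l * \<chi> c) \<longleftrightarrow> (\<forall>c\<in>tors D k. q dvd int p ^ l * \<chi> c)"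
proof (intro iffI ballI)
  fix c assume "\<forall>c\<in>tors C k. q dvd int p ^ l * \<chi> c" "c \<in> tors D k"
  then show "q dvd int p ^ l * \<chi> c" using tors_D by blast
next
  fix c assume all: "\<forall>c\<in>tors D k. q dvd int p ^ l * \<chi> c" and c: "c \<in> tors C k"
  have "c \<in> C" using c tors_subset by blast
  then obtain i j d where ij: "d \<in> D" "c = x [^] (i::int) \<otimes> y [^] (j::int) \<otimes> d" using decompose by metis
  have t: "int p ^ m dvd int p ^ k * i" "int p ^ m dvd int p ^ k * j" "d \<in> tors D k"
    using tors_coords[OF ij(1), of i j k] c ij(2) by auto
  have *: "q dvd int p ^ l * (a * \<chi> v)" if a: "int p ^ m dvd int p ^ k * a" and v: "v \<in> C" for a v
  proof -
    have "int p ^ k * a dvd int p ^ (l + e1) * a"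
      by (rule mult_dvd_mono[OF le_imp_power_dvd[OF kl] dvd_refl])
    from dvd_trans[OF a this] have "int p ^ m dvd int p ^ (l + e1) * a" .
    also have "int p ^ (l + e1) * a = int p ^ e1 * (int p ^ l * a)" by (simp add: power_add)
    finally have "int p ^ (m - e1) dvd int p ^ l * a" using prime_power_dvd_cancel[OF p_pos(1) e1] by blast
    then obtain b where "int p ^ l * a = int p ^ (m - e1) * b" by blast
    then have "int p ^ l * (a * \<chi> v) = int p ^ (m - e1) * b * \<chi> v" by (simp only: mult.assoc[symmetric])
    also have "\<dots> = b * (int p ^ (m - e1) * \<chi> v)" by simp
    finally have eq: "int p ^ l * (a * \<chi> v) = b * (int p ^ (m - e1) * \<chi> v)" .
    show ?thesis unfolding eq by (rule dvd_mult[OF van[OF v]])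
  qed
  have "[int p ^ l * \<chi> c = int p ^ l * (i * \<chi> x + j * \<chi> y + \<chi> d)] (mod q)"
    unfolding ij(2) by (intro cong_mult cong_refl chi_comb CG x y DC ij)
  moreover have "q dvd int p ^ l * (i * \<chi> x + j * \<chi> y + \<chi> d)"
    unfolding distrib_left using *[OF t(1) x] *[OF t(2) y] all t(3) by (intro dvd_add) auto
  ultimately show "q dvd int p ^ l * \<chi> c" using cong_dvd_iff by blast
qed

lemma w_approx:
  assumes g: "approx C g i x j y c" and c: "c \<in> D"
  shows "[w g x = - j * int p ^ (M - m)] (mod q)" "[w g y = i * int p ^ (M - m)] (mod q)"
    "d \<in> D \<Longrightarrow> [w g d = w c d] (mod q)"
proof -
  have c': "[w g u = i * w x u + j * w y u + w c u] (mod q)" if "u \<in> C" for u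
    using g that by (simp add: approx_def)
  have "[i * w x x + j * w y x + w c x = i * 0 + j * (- (int p ^ (M - m))) + 0] (mod q)"
    by (intro cong_add cong_mult cong_refl wxx wyx w_D c)
  from cong_trans[OF c'[OF x] this] show "[w g x = - j * int p ^ (M - m)] (mod q)" by simp
  have "[i * w x y + j * w y y + w c y = i * int p ^ (M - m) + j * 0 + 0] (mod q)"
    by (intro cong_add cong_mult cong_refl wxy wyy w_D c)
  from cong_trans[OF c'[OF y] this] show "[w g y = i * int p ^ (M - m)] (mod q)" by simp
  assume d: "d \<in> D"
  have "[i * w x d + j * w y d + w c d = i * 0 + j * 0 + w c d] (mod q)"
    by (intro cong_add cong_mult cong_refl w_D d)
  from cong_trans[OF c'[OF DC[OF d]] this] show "[w g d = w c d] (mod q)" by simp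
qed

lemma w_approx_approx:
  assumes g: "approx C g i x j y c" and h: "approx C h k x l y d"
    and c: "c \<in> D" "d \<in> D" and C': "g \<in> C" "h \<in> C"
  shows "[w g h = i * l * int p ^ (M - m) - j * k * int p ^ (M - m) + w c d] (mod q)"
proof -
  have "[w g h = i * w x h + j * w y h + w c h] (mod q)" using g C' by (simp add: approx_def)
  also have "[i * w x h + j * w y h + w c h = i * (- w h x) + j * (- w h y) + (- w h c)] (mod q)"
    by (intro cong_add cong_mult cong_refl w_skew CG x y C' DC c)
  also have "[i * (- w h x) + j * (- w h y) + (- w h c) =
     i * (- (- l * int p ^ (M - m))) + j * (- (k * int p ^ (M - m))) + (- w d c)] (mod q)"
    by (intro cong_add cong_mult cong_refl cong_minus_minus_iff[THEN iffD2] w_approx[OF h] c)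
  also have "[i * (- (- l * int p ^ (M - m))) + j * (- (k * int p ^ (M - m))) + (- w d c) =
     i * (- (- l * int p ^ (M - m))) + j * (- (k * int p ^ (M - m))) + w c d] (mod q)"
    by (intro cong_add cong_refl cong_sym[OF w_skew] CG DC c)
  finally show ?thesis by (simp add: mult.assoc)
qed

end

section \<open>Isometries between two forms\<close>

locale form_pair = A: alternating_form G p M w \<chi> + B: alternating_form H p M w' \<chi>'
  for G :: "('g, 'm) monoid_scheme" and H :: "('h, 'n) monoid_scheme" and p M w \<chi> w' \<chi>'
begin

text \<open>An isomorphism between the quotients by the radicals, given by its graph in \<open>C
  \<times> C'\<close>. It respects the character on the \<open>p^e\<close>-torsion.\<close>

definition isometry :: "nat \<Rightarrow> 'g set \<Rightarrow> 'h set \<Rightarrow> ('g \<times> 'h) set \<Rightarrow> bool" where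
  "isometry e C C' \<Gamma> \<longleftrightarrow> \<Gamma> \<subseteq> C \<times> C' \<and>
     (\<forall>a a' b b'. (a, a') \<in> \<Gamma> \<longrightarrow> (b, b') \<in> \<Gamma> \<longrightarrow> (a \<otimes>\<^bsub>G\<^esub> b, a' \<otimes>\<^bsub>H\<^esub> b') \<in> \<Gamma>) \<and>
     (\<forall>c\<in>C. \<exists>c'. (c, c') \<in> \<Gamma>) \<and> (\<forall>c'\<in>C'. \<exists>c. (c, c') \<in> \<Gamma>) \<and>
     (\<forall>a a' b b'. (a, a') \<in> \<Gamma> \<longrightarrow> (b, b') \<in> \<Gamma> \<longrightarrow> [w a b = w' a' b'] (mod A.q)) \<and>
     (\<forall>a a'. (a, a') \<in> \<Gamma> \<longrightarrow> a \<in> A.tors C e \<longrightarrow> [\<chi> a = \<chi>' a'] (mod A.q))"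

lemma isometry_tors:
  assumes \<Gamma>: "isometry e C C' \<Gamma>" and c: "(c, c') \<in> \<Gamma>"
  shows "c \<in> A.tors C k \<longleftrightarrow> c' \<in> B.tors C' k"
proof -
  have cc: "c \<in> C" "c' \<in> C'" using \<Gamma> c by (auto simp: isometry_def)
  have iff: "A.q dvd int p ^ k * w c u \<longleftrightarrow> A.q dvd int p ^ k * w' c' u'" if u: "(u, u') \<in> \<Gamma>" for u u'
  proof (intro cong_dvd_iff cong_mult cong_refl)
    show "[w c u = w' c' u'] (mod A.q)" using \<Gamma> c u unfolding isometry_def by blast
  qed
  have sub: "u \<in> C" "u' \<in> C'" if "(u, u') \<in> \<Gamma>" for u u' using \<Gamma> that unfolding isometry_def by auto
  have on: "\<exists>u'. (u, u') \<in> \<Gamma>" if "u \<in> C" for u using \<Gamma> that unfolding isometry_def by blast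
  have on': "\<exists>u. (u, u') \<in> \<Gamma>" if "u' \<in> C'" for u' using \<Gamma> that unfolding isometry_def by blast
  have "(\<forall>u\<in>C. A.q dvd int p ^ k * w c u) \<longleftrightarrow> (\<forall>u'\<in>C'. A.q dvd int p ^ k * w' c' u')"
  proof (intro iffI ballI)
    fix u' assume all: "\<forall>u\<in>C. A.q dvd int p ^ k * w c u" and "u' \<in> C'"
    then obtain u where "(u, u') \<in> \<Gamma>" using on' by blast
    then show "A.q dvd int p ^ k * w' c' u'" using all iff sub by blast
  next
    fix u assume all: "\<forall>u'\<in>C'. A.q dvd int p ^ k * w' c' u'" and "u \<in> C"
    then obtain u' where "(u, u') \<in> \<Gamma>" using on by blast
    then show "A.q dvd int p ^ k * w c u" using all iff sub by blast
  qed
  then show ?thesis using cc unfolding A.tors_def B.tors_def mem_Collect_eq by blast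
qed

end

context form_pair
begin

text \<open>On the complements the characters are only known to agree on the
  \<open>p^e1\<close>-torsion. Their difference \<open>\<delta>\<close> on the
  \<open>p^e\<close>-torsion is, by \<open>partial_duality\<close>, of the form \<open>p^e1
  w'(_, d)\<close>. Since \<open>\<chi>' x'\<close> is \<open>p^(M-m+e1)\<close>, the difference
  disappears when \<open>c'\<close> is replaced by \<open>x'^s c'\<close> with \<open>p^(M-m) s
  = w' c' d\<close>. This shear is no longer orthogonal to \<open>y'\<close>, which is repaired
  by multiplying \<open>y'\<close> by the inverse of \<open>d\<close>; a further power of
  \<open>x'\<close> keeps the character zero on the second basis vector.\<close>

lemma extend_isometry:
  assumes PA: "hyperbolic_pair G p M w \<chi> C m x y" and PB: "hyperbolic_pair H p M w' \<chi>' C' m x' y'"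
    and e: "e1 \<le> e" "e \<le> m"
    and rad: "\<And>c. c \<in> A.tors C 0 \<Longrightarrow> A.q dvd \<chi> c" "\<And>c. c \<in> B.tors C' 0 \<Longrightarrow> A.q dvd \<chi>' c"
    and van': "\<And>c. c \<in> C' \<Longrightarrow> A.q dvd int p ^ (m - e1) * \<chi>' c"
    and chi: "[int p ^ (m - e) * \<chi> x = int p ^ (M - e + e1)] (mod A.q)" "A.q dvd int p ^ (m - e) * \<chi> y"
      "[int p ^ (m - e) * \<chi>' x' = int p ^ (M - e + e1)] (mod A.q)" "A.q dvd int p ^ (m - e) * \<chi>' y'"
    and \<Gamma>D: "isometry e1 (A.perp C x y) (B.perp C' x' y') \<Gamma>D"
  shows "\<exists>\<Gamma>. isometry e C C' \<Gamma>"
proof -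
  interpret PA: hyperbolic_pair G p M w \<chi> C m x y by (rule PA)
  interpret PB: hyperbolic_pair H p M w' \<chi>' C' m x' y' by (rule PB)
  let ?P = "int p ^ (M - m)"
  have mM: "m \<le> M" and m1: "1 \<le> m" using PA.m by auto
  have P0: "?P \<noteq> 0" using A.p_pos by simp
  have qP: "A.q = int p ^ m * ?P" using mM by (simp add: power_add[symmetric])
  have pme: "int p ^ m = int p ^ e * int p ^ (m - e)" using e by (simp add: power_add[symmetric])
  have PePm: "int p ^ (m - e) * (int p ^ e1 * ?P) = int p ^ (M - e + e1)"
  proof -
    have "M - e + e1 = (m - e) + (e1 + (M - m))" using e mM by simp
    then have "int p ^ (M - e + e1) = int p ^ ((m - e) + (e1 + (M - m)))" by (rule arg_cong)
    then show ?thesis by (simp only: power_add)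
  qed
  have D_in: "c \<in> PA.D" "c' \<in> PB.D" if "(c, c') \<in> \<Gamma>D" for c c' using \<Gamma>D that unfolding isometry_def by auto
  have D_mult: "(a \<otimes>\<^bsub>G\<^esub> b, a' \<otimes>\<^bsub>H\<^esub> b') \<in> \<Gamma>D" if "(a, a') \<in> \<Gamma>D" "(b, b') \<in> \<Gamma>D" for a a' b b'
    using \<Gamma>D that unfolding isometry_def by blast
  have D_onto: "\<exists>c'. (c, c') \<in> \<Gamma>D" if "c \<in> PA.D" for c using \<Gamma>D that unfolding isometry_def by blast
  have D_onto': "\<exists>c. (c, c') \<in> \<Gamma>D" if "c' \<in> PB.D" for c' using \<Gamma>D that unfolding isometry_def by blast
  have D_w: "[w a b = w' a' b'] (mod A.q)" if "(a, a') \<in> \<Gamma>D" "(b, b') \<in> \<Gamma>D" for a a' b b'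
    using \<Gamma>D that unfolding isometry_def by blast
  have D_chi: "[\<chi> a = \<chi>' a'] (mod A.q)" if "(a, a') \<in> \<Gamma>D" "a \<in> A.tors PA.D e1" for a a'
    using \<Gamma>D that unfolding isometry_def by blast
  note D_tors = isometry_tors[OF \<Gamma>D]
  have radD: "A.q dvd \<chi> c" if "c \<in> A.tors PA.D 0" for c using that rad(1) PA.tors_D by blast

  \<comment> \<open>The isometry of the complements need not be a function, but
    \<open>\<chi>\<close> does not depend on the choice of \<open>pre\<close>.\<close>
  define pre where "pre c' = (SOME c. (c, c') \<in> \<Gamma>D)" for c'
  have pre: "(pre c', c') \<in> \<Gamma>D" if "c' \<in> PB.D" for c'
    unfolding pre_def by (rule someI_ex[OF D_onto'[OF that]])
  have pre_chi: "[\<chi> (pre c') = \<chi> c] (mod A.q)" if cc: "(c, c') \<in> \<Gamma>D" for c c'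
  proof (rule A.chi_cong[OF PA.D_subgroup _ _ radD])
    have c': "c' \<in> PB.D" by (rule D_in(2)[OF cc])
    show "pre c' \<in> PA.D" "c \<in> PA.D" using D_in(1)[OF pre[OF c']] D_in(1)[OF cc] .
    fix u assume "u \<in> PA.D"
    then obtain u' where u': "(u, u') \<in> \<Gamma>D" using D_onto by blast
    show "[w (pre c') u = w c u] (mod A.q)"
      by (rule cong_trans[OF D_w[OF pre[OF c'] u'] cong_sym[OF D_w[OF cc u']]])
  qed
  define \<delta> where "\<delta> c' = \<chi> (pre c') - \<chi>' c'" for c'
  have \<delta>_eq: "[\<delta> c' = \<chi> c - \<chi>' c'] (mod A.q)" if "(c, c') \<in> \<Gamma>D" for c c'
    unfolding \<delta>_def by (intro cong_diff cong_refl pre_chi that)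
  have \<delta>_hom: "B.hom_mod A.q (B.tors PB.D e) \<delta>"
    unfolding B.hom_mod_def
  proof (intro ballI)
    fix a b assume "a \<in> B.tors PB.D e" "b \<in> B.tors PB.D e"
    then have ab: "a \<in> PB.D" "b \<in> PB.D" using B.tors_subset by blast+
    have "[\<delta> (a \<otimes>\<^bsub>H\<^esub> b) = \<chi> (pre a \<otimes>\<^bsub>G\<^esub> pre b) - \<chi>' (a \<otimes>\<^bsub>H\<^esub> b)] (mod A.q)"
      by (rule \<delta>_eq[OF D_mult[OF pre[OF ab(1)] pre[OF ab(2)]]])
    also have "[\<chi> (pre a \<otimes>\<^bsub>G\<^esub> pre b) - \<chi>' (a \<otimes>\<^bsub>H\<^esub> b) = (\<chi> (pre a) + \<chi> (pre b)) - (\<chi>' a + \<chi>' b)] (mod A.q)"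
      by (intro cong_diff A.chi_mult B.chi_mult PA.CG PB.CG PA.DC PB.DC D_in(1)[OF pre] ab)
    also have "(\<chi> (pre a) + \<chi> (pre b)) - (\<chi>' a + \<chi>' b) = \<delta> a + \<delta> b" by (simp add: \<delta>_def)
    finally show "[\<delta> (a \<otimes>\<^bsub>H\<^esub> b) = \<delta> a + \<delta> b] (mod A.q)" .
  qed
  have \<delta>_van: "A.q dvd \<delta> c'" if c': "c' \<in> B.tors PB.D e1" for c'
  proof -
    have cD: "c' \<in> PB.D" using c' B.tors_subset by blast
    have "pre c' \<in> A.tors PA.D e1" using D_tors[OF pre[OF cD]] c' by blast
    then have "[\<chi> (pre c') = \<chi>' c'] (mod A.q)" by (rule D_chi[OF pre[OF cD]])
    then show ?thesis by (simp add: \<delta>_def cong_iff_dvd_diff)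
  qed
  obtain d where d: "d \<in> PB.D" and d_eq: "\<And>c'. c' \<in> B.tors PB.D e \<Longrightarrow> [\<delta> c' = int p ^ e1 * w' c' d] (mod A.q)"
    using B.partial_duality[OF PB.D_subgroup e(1) \<delta>_hom \<delta>_van] by blast

  have dC: "d \<in> C'" by (rule PB.DC[OF d])
  obtain r where r: "\<chi>' d = int p ^ (M - m + e1) * r"
  proof -
    have "int p ^ (M - (m - e1)) dvd \<chi>' d"
      using van'[OF dC] prime_power_dvd_cancel[OF A.p_pos(1), of "m - e1" M] mM by simp
    moreover have "M - (m - e1) = M - m + e1" using e mM by simp
    ultimately show thesis using that by (metis dvd_def)
  qed
  \<comment> \<open>The exponent \<open>r\<close> is chosen so that \<open>\<chi>'
    (x'^r)\<close> compensates \<open>\<chi>' d\<close>.\<close>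
  define y2 where "y2 = x' [^]\<^bsub>H\<^esub> r \<otimes>\<^bsub>H\<^esub> y' [^]\<^bsub>H\<^esub> (1::int) \<otimes>\<^bsub>H\<^esub> inv\<^bsub>H\<^esub> d"
  have idC: "inv\<^bsub>H\<^esub> d \<in> C'" by (rule subgroup.m_inv_closed[OF PB.C dC])
  have y2C: "y2 \<in> C'" unfolding y2_def
    by (intro subgroup.m_closed[OF PB.C] B.subgroup_int_pow_closed[OF PB.C] PB.x PB.y idC)
  have w_y2: "[w' y2 u = r * w' x' u + w' y' u - w' d u] (mod A.q)" if u: "u \<in> C'" for u
  proof -
    have "[w' y2 u = r * w' x' u + 1 * w' y' u + w' (inv\<^bsub>H\<^esub> d) u] (mod A.q)"
      unfolding y2_def by (intro B.w_comb_left PB.CG u PB.x PB.y idC)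
    also have "[r * w' x' u + 1 * w' y' u + w' (inv\<^bsub>H\<^esub> d) u = r * w' x' u + 1 * w' y' u + - w' d u] (mod A.q)"
      by (intro cong_add cong_refl B.w_inv_left PB.CG u dC)
    finally show ?thesis by simp
  qed
  have y2x: "[w' y2 x' = - ?P] (mod A.q)"
  proof -
    have "[r * w' x' x' + w' y' x' - w' d x' = r * 0 + - ?P - 0] (mod A.q)"
      by (intro cong_add cong_diff cong_mult cong_refl PB.wxx PB.wyx PB.w_D d)
    from cong_trans[OF w_y2[OF PB.x] this] show ?thesis by simp
  qed
  have xy2: "[w' x' y2 = ?P] (mod A.q)"
  proof -
    have "[w' x' y2 = - w' y2 x'] (mod A.q)" by (intro B.w_skew PB.CG PB.x y2C)
    also have "[- w' y2 x' = - (- ?P)] (mod A.q)" using y2x by (simp only: cong_minus_minus_iff)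
    finally show ?thesis by simp
  qed
  have y2D: "[w' y2 c = w' c d] (mod A.q)" if c: "c \<in> PB.D" for c
  proof -
    have "[r * w' x' c + w' y' c - w' d c = r * 0 + 0 - w' d c] (mod A.q)"
      by (intro cong_add cong_diff cong_mult cong_refl PB.w_D c)
    from cong_trans[OF w_y2[OF PB.DC[OF c]] this] have "[w' y2 c = - w' d c] (mod A.q)" by simp
    also have "[- w' d c = w' c d] (mod A.q)"
      by (intro cong_sym[OF B.w_skew] PB.CG PB.DC c d)
    finally show ?thesis .
  qed
  have Dy2: "[w' c y2 = - w' c d] (mod A.q)" if c: "c \<in> PB.D" for c
  proof -
    have "[w' c y2 = - w' y2 c] (mod A.q)" by (intro B.w_skew PB.CG PB.DC y2C c)
    also have "[- w' y2 c = - w' c d] (mod A.q)" using y2D[OF c] by (simp only: cong_minus_minus_iff)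
    finally show ?thesis .
  qed
  have chi_y2: "[int p ^ (m - e) * \<chi>' y2 = 0] (mod A.q)"
  proof -
    let ?k = "int p ^ (m - e)"
    have "[\<chi>' y2 = r * \<chi>' x' + 1 * \<chi>' y' + \<chi>' (inv\<^bsub>H\<^esub> d)] (mod A.q)"
      unfolding y2_def by (intro B.chi_comb PB.CG PB.x PB.y idC)
    also have "[r * \<chi>' x' + 1 * \<chi>' y' + \<chi>' (inv\<^bsub>H\<^esub> d) = r * \<chi>' x' + 1 * \<chi>' y' + - \<chi>' d] (mod A.q)"
      by (intro cong_add cong_refl B.hom_mod_inv[OF B.subgroup_self B.chi_hom] PB.CG dC)
    finally have "[?k * \<chi>' y2 = ?k * (r * \<chi>' x' + 1 * \<chi>' y' + - \<chi>' d)] (mod A.q)"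
      by (intro cong_mult cong_refl)
    also have "?k * (r * \<chi>' x' + 1 * \<chi>' y' + - \<chi>' d) = r * (?k * \<chi>' x') + ?k * \<chi>' y' - ?k * \<chi>' d"
      by (simp add: algebra_simps)
    also have "[r * (?k * \<chi>' x') + ?k * \<chi>' y' - ?k * \<chi>' d = r * int p ^ (M - e + e1) + 0 - ?k * \<chi>' d] (mod A.q)"
      by (intro cong_add cong_diff cong_mult cong_refl chi(3) cong_0_iff[THEN iffD2] chi(4))
    also have "?k * \<chi>' d = r * int p ^ (M - e + e1)"
      unfolding r PePm[symmetric] by (simp add: power_add)
    finally show ?thesis by simp
  qed

  define \<Gamma> where "\<Gamma> = {(g, g'). g \<in> C \<and> g' \<in> C' \<and> (\<exists>c c' i j s. (c, c') \<in> \<Gamma>D \<and> [?P * s = w' c' d] (mod A.q) \<and>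
     A.approx C g i x j y c \<and> B.approx C' g' (i + s) x' j y2 c')}"
  have \<Gamma>I: "(g, g') \<in> \<Gamma>" if "g \<in> C" "g' \<in> C'" "(c, c') \<in> \<Gamma>D" "[?P * s = w' c' d] (mod A.q)"
     "A.approx C g i x j y c" "B.approx C' g' (i + s) x' j y2 c'" for g g' c c' i j s
    unfolding \<Gamma>_def using that by blast
  have \<Gamma>E: "\<exists>c c' i j s. g \<in> C \<and> g' \<in> C' \<and> (c, c') \<in> \<Gamma>D \<and> [?P * s = w' c' d] (mod A.q) \<and>
     A.approx C g i x j y c \<and> B.approx C' g' (i + s) x' j y2 c'" if "(g, g') \<in> \<Gamma>" for g g'
    using that unfolding \<Gamma>_def by blast
  have s_ex: "\<exists>s. [?P * s = w' c' d] (mod A.q)" if c': "c' \<in> PB.D" for c'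
  proof -
    obtain s where "w' c' d = ?P * s"
      using B.w_dvd_of_level[OF PB.m(3) mM PB.DC[OF c'] dC] by blast
    then show ?thesis by (intro exI[of _ s]) simp
  qed

  have mult: "(a \<otimes>\<^bsub>G\<^esub> b, a' \<otimes>\<^bsub>H\<^esub> b') \<in> \<Gamma>" if a: "(a, a') \<in> \<Gamma>" and b: "(b, b') \<in> \<Gamma>" for a a' b b'
  proof -
    obtain c c' i j s where 1: "a \<in> C" "a' \<in> C'" "(c, c') \<in> \<Gamma>D" "[?P * s = w' c' d] (mod A.q)"
      "A.approx C a i x j y c" "B.approx C' a' (i + s) x' j y2 c'" using \<Gamma>E[OF a] by blast
    obtain f f' k l t where 2: "b \<in> C" "b' \<in> C'" "(f, f') \<in> \<Gamma>D" "[?P * t = w' f' d] (mod A.q)"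
      "A.approx C b k x l y f" "B.approx C' b' (k + t) x' l y2 f'" using \<Gamma>E[OF b] by blast
    have cf: "c \<in> C" "f \<in> C" "c' \<in> C'" "f' \<in> C'"
      using D_in[OF 1(3)] D_in[OF 2(3)] PA.DC PB.DC by auto
    have "[?P * (s + t) = w' (c' \<otimes>\<^bsub>H\<^esub> f') d] (mod A.q)"
    proof -
      have "[?P * s + ?P * t = w' c' d + w' f' d] (mod A.q)" by (intro cong_add 1 2)
      also have "[w' c' d + w' f' d = w' (c' \<otimes>\<^bsub>H\<^esub> f') d] (mod A.q)"
        by (intro cong_sym[OF B.w_mult_left] PB.CG cf dC)
      finally show ?thesis by (simp only: distrib_left)
    qed
    moreover have "B.approx C' (a' \<otimes>\<^bsub>H\<^esub> b') (i + k + (s + t)) x' (j + l) y2 (c' \<otimes>\<^bsub>H\<^esub> f')"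
      using B.approx_mult[OF PB.C 1(2) 2(2) cf(3,4) 1(6) 2(6)] by (simp add: algebra_simps)
    ultimately show ?thesis
      by (intro \<Gamma>I[OF subgroup.m_closed[OF PA.C 1(1) 2(1)] subgroup.m_closed[OF PB.C 1(2) 2(2)]
        D_mult[OF 1(3) 2(3)] _ A.approx_mult[OF PA.C 1(1) 2(1) cf(1,2) 1(5) 2(5)]])
  qed

  have onto: "\<exists>g'. (g, g') \<in> \<Gamma>" if g: "g \<in> C" for g
  proof -
    obtain i j c where ij: "c \<in> PA.D" "g = x [^]\<^bsub>G\<^esub> (i::int) \<otimes>\<^bsub>G\<^esub> y [^]\<^bsub>G\<^esub> (j::int) \<otimes>\<^bsub>G\<^esub> c"
      using PA.decompose[OF g] by metis
    obtain c' where c': "(c, c') \<in> \<Gamma>D" using D_onto[OF ij(1)] by blast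
    have c'D: "c' \<in> PB.D" by (rule D_in(2)[OF c'])
    obtain s where s: "[?P * s = w' c' d] (mod A.q)" using s_ex[OF c'D] by blast
    let ?g' = "x' [^]\<^bsub>H\<^esub> (i + s) \<otimes>\<^bsub>H\<^esub> y2 [^]\<^bsub>H\<^esub> j \<otimes>\<^bsub>H\<^esub> c'"
    have "?g' \<in> C'" by (intro subgroup.m_closed[OF PB.C] B.subgroup_int_pow_closed[OF PB.C] PB.x y2C PB.DC c'D)
    then have "(g, ?g') \<in> \<Gamma>"
      unfolding ij(2) by (rule \<Gamma>I[OF g[unfolded ij(2)] _ c' s A.approx_self[OF PA.C PA.x PA.y PA.DC[OF ij(1)]]
        B.approx_self[OF PB.C PB.x y2C PB.DC[OF c'D]]])
    then show ?thesis by blast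
  qed

  have onto': "\<exists>g. (g, g') \<in> \<Gamma>" if g': "g' \<in> C'" for g'
  proof -
    obtain a b v where ab: "v \<in> PB.D" "g' = x' [^]\<^bsub>H\<^esub> (a::int) \<otimes>\<^bsub>H\<^esub> y' [^]\<^bsub>H\<^esub> (b::int) \<otimes>\<^bsub>H\<^esub> v"
      using PB.decompose[OF g'] by metis
    define c' where "c' = d [^]\<^bsub>H\<^esub> b \<otimes>\<^bsub>H\<^esub> v"
    have db: "d [^]\<^bsub>H\<^esub> b \<in> PB.D" by (rule B.subgroup_int_pow_closed[OF PB.D_subgroup d])
    have c'D: "c' \<in> PB.D" unfolding c'_def by (rule subgroup.m_closed[OF PB.D_subgroup db ab(1)])
    obtain c where c: "(c, c') \<in> \<Gamma>D" using D_onto'[OF c'D] by blast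
    obtain s where s: "[?P * s = w' c' d] (mod A.q)" using s_ex[OF c'D] by blast
    define i where "i = a - b * r - s"
    let ?g = "x [^]\<^bsub>G\<^esub> i \<otimes>\<^bsub>G\<^esub> y [^]\<^bsub>G\<^esub> b \<otimes>\<^bsub>G\<^esub> c"
    have gC: "?g \<in> C" by (intro subgroup.m_closed[OF PA.C] A.subgroup_int_pow_closed[OF PA.C] PA.x PA.y PA.DC D_in(1)[OF c])
    have "B.approx C' g' (i + s) x' b y2 c'"
      unfolding B.approx_def
    proof
      fix u assume u: "u \<in> C'"
      have "[w' g' u = a * w' x' u + b * w' y' u + w' v u] (mod A.q)"
        unfolding ab(2) by (intro B.w_comb_left PB.CG u PB.x PB.y PB.DC ab)
      also have "a * w' x' u + b * w' y' u + w' v u =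
        (i + s) * w' x' u + b * (r * w' x' u + w' y' u - w' d u) + (b * w' d u + w' v u)"
        by (simp add: i_def algebra_simps)
      also have "[(i + s) * w' x' u + b * (r * w' x' u + w' y' u - w' d u) + (b * w' d u + w' v u) =
        (i + s) * w' x' u + b * w' y2 u + (w' (d [^]\<^bsub>H\<^esub> b) u + w' v u)] (mod A.q)"
        by (intro cong_add cong_mult cong_refl cong_sym[OF w_y2] cong_sym[OF B.w_pow_left] PB.CG u dC)
      also have "[(i + s) * w' x' u + b * w' y2 u + (w' (d [^]\<^bsub>H\<^esub> b) u + w' v u) =
        (i + s) * w' x' u + b * w' y2 u + w' c' u] (mod A.q)"
        unfolding c'_def by (intro cong_add cong_refl cong_sym[OF B.w_mult_left] PB.CG u PB.DC db ab)
      finally show "[w' g' u = (i + s) * w' x' u + b * w' y2 u + w' c' u] (mod A.q)" .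
    qed
    then have "(?g, g') \<in> \<Gamma>"
      by (rule \<Gamma>I[OF gC g' c s A.approx_self[OF PA.C PA.x PA.y PA.DC[OF D_in(1)[OF c]]]])
    then show ?thesis by blast
  qed

  have iso: "[w g h = w' g' h'] (mod A.q)" if g: "(g, g') \<in> \<Gamma>" and h: "(h, h') \<in> \<Gamma>" for g g' h h'
  proof -
    obtain c c' i j s where 1: "g \<in> C" "g' \<in> C'" "(c, c') \<in> \<Gamma>D" "[?P * s = w' c' d] (mod A.q)"
      "A.approx C g i x j y c" "B.approx C' g' (i + s) x' j y2 c'" using \<Gamma>E[OF g] by blast
    obtain f f' k l t where 2: "h \<in> C" "h' \<in> C'" "(f, f') \<in> \<Gamma>D" "[?P * t = w' f' d] (mod A.q)"
      "A.approx C h k x l y f" "B.approx C' h' (k + t) x' l y2 f'" using \<Gamma>E[OF h] by blast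
    have c'D: "c' \<in> PB.D" and f'D: "f' \<in> PB.D" using D_in(2)[OF 1(3)] D_in(2)[OF 2(3)] .
    have hu: "[w' h' u = (k + t) * w' x' u + l * w' y2 u + w' f' u] (mod A.q)" if "u \<in> C'" for u
      using 2(6) that by (simp add: B.approx_def)
    have neg: "[w' v h' = - b] (mod A.q)" if "[w' h' v = b] (mod A.q)" "v \<in> C'" for v b
    proof -
      have "[w' v h' = - w' h' v] (mod A.q)" by (intro B.w_skew PB.CG 2 that)
      also have "[- w' h' v = - b] (mod A.q)" using that(1) by (simp only: cong_minus_minus_iff)
      finally show ?thesis .
    qed
    have hx: "[w' h' x' = l * (- ?P)] (mod A.q)"
    proof -
      have "[(k + t) * w' x' x' + l * w' y2 x' + w' f' x' = (k + t) * 0 + l * (- ?P) + 0] (mod A.q)"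
        by (intro cong_add cong_mult cong_refl PB.wxx y2x PB.w_D f'D)
      from cong_trans[OF hu[OF PB.x] this] show ?thesis by simp
    qed
    have hy: "[w' h' y2 = k * ?P] (mod A.q)"
    proof -
      have "[(k + t) * w' x' y2 + l * w' y2 y2 + w' f' y2 = (k + t) * ?P + l * 0 + - w' f' d] (mod A.q)"
        by (intro cong_add cong_mult cong_refl xy2 B.w_alt Dy2 f'D PB.CG y2C)
      also have "[(k + t) * ?P + l * 0 + - w' f' d = (k + t) * ?P + l * 0 + - (?P * t)] (mod A.q)"
        by (intro cong_add cong_refl) (simp only: cong_minus_minus_iff cong_sym[OF 2(4)])
      also have "(k + t) * ?P + l * 0 + - (?P * t) = k * ?P" by (simp add: algebra_simps)
      finally show ?thesis using cong_trans[OF hu[OF y2C]] by blast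
    qed
    have hc: "[w' h' c' = l * (?P * s) - w' c' f'] (mod A.q)"
    proof -
      have "[(k + t) * w' x' c' + l * w' y2 c' + w' f' c' = (k + t) * 0 + l * w' c' d + - w' c' f'] (mod A.q)"
        by (intro cong_add cong_mult cong_refl PB.w_D y2D c'D B.w_skew PB.CG PB.DC f'D)
      also have "[(k + t) * 0 + l * w' c' d + - w' c' f' = (k + t) * 0 + l * (?P * s) + - w' c' f'] (mod A.q)"
        by (intro cong_add cong_mult cong_refl cong_sym[OF 1(4)])
      finally show ?thesis using cong_trans[OF hu[OF PB.DC[OF c'D]]] by simp
    qed
    have "[w' g' h' = (i + s) * w' x' h' + j * w' y2 h' + w' c' h'] (mod A.q)"
      using 1(6) 2(2) by (simp add: B.approx_def)
    also have "[(i + s) * w' x' h' + j * w' y2 h' + w' c' h' =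
       (i + s) * (- (l * (- ?P))) + j * (- (k * ?P)) + (- (l * (?P * s) - w' c' f'))] (mod A.q)"
      by (intro cong_add cong_mult cong_refl neg hx hy hc PB.x y2C PB.DC c'D)
    also have "(i + s) * (- (l * (- ?P))) + j * (- (k * ?P)) + (- (l * (?P * s) - w' c' f')) =
      i * l * ?P - j * k * ?P + w' c' f'" by (simp add: algebra_simps)
    also have "[i * l * ?P - j * k * ?P + w' c' f' = i * l * ?P - j * k * ?P + w c f] (mod A.q)"
      by (intro cong_add cong_refl cong_sym[OF D_w] 1 2)
    also have "[i * l * ?P - j * k * ?P + w c f = w g h] (mod A.q)"
      by (rule cong_sym[OF PA.w_approx_approx[OF 1(5) 2(5) D_in(1)[OF 1(3)] D_in(1)[OF 2(3)] 1(1) 2(1)]])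
    finally show ?thesis by (rule cong_sym)
  qed

  have chi_eq: "[\<chi> g = \<chi>' g'] (mod A.q)" if g: "(g, g') \<in> \<Gamma>" and ge: "g \<in> A.tors C e" for g g'
  proof -
    let ?k = "int p ^ (m - e)"
    let ?Q = "int p ^ (M - e + e1)"
    obtain c c' i j s where 1: "g \<in> C" "g' \<in> C'" "(c, c') \<in> \<Gamma>D" "[?P * s = w' c' d] (mod A.q)"
      "A.approx C g i x j y c" "B.approx C' g' (i + s) x' j y2 c'" using \<Gamma>E[OF g] by blast
    have cD: "c \<in> PA.D" and c'D: "c' \<in> PB.D" using D_in[OF 1(3)] .
    let ?h = "x [^]\<^bsub>G\<^esub> i \<otimes>\<^bsub>G\<^esub> y [^]\<^bsub>G\<^esub> j \<otimes>\<^bsub>G\<^esub> c"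
    have hC: "?h \<in> C" by (intro subgroup.m_closed[OF PA.C] A.subgroup_int_pow_closed[OF PA.C] PA.x PA.y PA.DC cD)
    have "?h \<in> A.tors C e"
    proof (rule A.tors_cong[OF 1(1) hC, THEN iffD1, OF _ ge])
      fix u assume u: "u \<in> C"
      show "[w g u = w ?h u] (mod A.q)"
        using 1(5) A.approx_self[OF PA.C PA.x PA.y PA.DC[OF cD], of i j] u
        unfolding A.approx_def by (blast intro: cong_trans cong_sym)
    qed
    then have t: "int p ^ m dvd int p ^ e * i" "int p ^ m dvd int p ^ e * j" "c \<in> A.tors PA.D e"
      using PA.tors_coords[OF cD, of i j e] by auto
    have pe0: "int p ^ e \<noteq> 0" using A.p_pos by simp
    obtain i0 where i0: "i = ?k * i0" using t(1) pe0 unfolding pme by (auto simp: dvd_def)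
    obtain j0 where j0: "j = ?k * j0" using t(2) pe0 unfolding pme by (auto simp: dvd_def)
    have c't: "c' \<in> B.tors PB.D e" using t(3) D_tors[OF 1(3)] by blast
    obtain s0 where s0: "s = ?k * s0"
    proof -
      have "A.q dvd int p ^ e * w' c' d" using c't d by (auto simp: B.tors_def)
      moreover have "A.q dvd int p ^ e * (?P * s) \<longleftrightarrow> A.q dvd int p ^ e * w' c' d"
        by (intro cong_dvd_iff cong_mult cong_refl 1)
      ultimately have "int p ^ m * ?P dvd (int p ^ e * s) * ?P" unfolding qP by (simp add: ac_simps)
      then have "int p ^ m dvd int p ^ e * s" using P0 A.p_pos by simp
      then show thesis using that pe0 unfolding pme by (auto simp: dvd_def)
    qed
    have "[\<chi> g = i * \<chi> x + j * \<chi> y + \<chi> c] (mod A.q)"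
      by (rule A.chi_approx[OF PA.C 1(1) PA.x PA.y PA.DC[OF cD] rad(1) 1(5)])
    also have "i * \<chi> x + j * \<chi> y + \<chi> c = i0 * (?k * \<chi> x) + j0 * (?k * \<chi> y) + \<chi> c"
      by (simp add: i0 j0 ac_simps)
    also have "[i0 * (?k * \<chi> x) + j0 * (?k * \<chi> y) + \<chi> c = i0 * ?Q + j0 * 0 + \<chi> c] (mod A.q)"
      by (intro cong_add cong_mult cong_refl chi(1) cong_0_iff[THEN iffD2] chi(2))
    finally have L: "[\<chi> g = i0 * ?Q + j0 * 0 + \<chi> c] (mod A.q)" .
    have "[\<chi>' g' = (i + s) * \<chi>' x' + j * \<chi>' y2 + \<chi>' c'] (mod A.q)"
      by (rule B.chi_approx[OF PB.C 1(2) PB.x y2C PB.DC[OF c'D] rad(2) 1(6)])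
    also have "(i + s) * \<chi>' x' + j * \<chi>' y2 + \<chi>' c' = (i0 + s0) * (?k * \<chi>' x') + j0 * (?k * \<chi>' y2) + \<chi>' c'"
      by (simp add: i0 j0 s0 algebra_simps)
    also have "[(i0 + s0) * (?k * \<chi>' x') + j0 * (?k * \<chi>' y2) + \<chi>' c' = (i0 + s0) * ?Q + j0 * 0 + \<chi>' c'] (mod A.q)"
      by (intro cong_add cong_mult cong_refl chi(3) chi_y2)
    also have "(i0 + s0) * ?Q + j0 * 0 + \<chi>' c' = i0 * ?Q + j0 * 0 + (int p ^ e1 * (?P * s) + \<chi>' c')"
    proof -
      have "int p ^ e1 * (?P * s) = s0 * ?Q" unfolding PePm[symmetric] s0 by (simp add: ac_simps)
      then show ?thesis by (simp add: distrib_right)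
    qed
    also have "[i0 * ?Q + j0 * 0 + (int p ^ e1 * (?P * s) + \<chi>' c') =
       i0 * ?Q + j0 * 0 + (int p ^ e1 * w' c' d + \<chi>' c')] (mod A.q)"
      by (intro cong_add cong_mult cong_refl 1)
    also have "[i0 * ?Q + j0 * 0 + (int p ^ e1 * w' c' d + \<chi>' c') =
       i0 * ?Q + j0 * 0 + ((\<chi> c - \<chi>' c') + \<chi>' c')] (mod A.q)"
      by (intro cong_add cong_refl cong_trans[OF cong_sym[OF d_eq[OF c't]] \<delta>_eq[OF 1(3)]])
    also have "i0 * ?Q + j0 * 0 + ((\<chi> c - \<chi>' c') + \<chi>' c') = i0 * ?Q + j0 * 0 + \<chi> c" by simp
    finally have R: "[\<chi>' g' = i0 * ?Q + j0 * 0 + \<chi> c] (mod A.q)" .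
    show ?thesis by (rule cong_trans[OF L cong_sym[OF R]])
  qed

  have "isometry e C C' \<Gamma>"
    unfolding isometry_def
  proof (intro conjI allI ballI impI)
    show "\<Gamma> \<subseteq> C \<times> C'" unfolding \<Gamma>_def by blast
  qed (use mult onto onto' iso chi_eq in blast)+
  then show ?thesis by blast
qed

end

context form_pair
begin

lemma tors_eq_iff:
  assumes C: "subgroup C G" and C': "subgroup C' H"
    and cards: "\<And>k. card (A.tors C k) * card (B.tors C' 0) = card (B.tors C' k) * card (A.tors C 0)"
  shows "A.tors C k = C \<longleftrightarrow> B.tors C' k = C'"
proof -
  have fin: "finite C" "finite C'"
    using finite_subset[OF subgroup.subset[OF C] A.finite_G] finite_subset[OF subgroup.subset[OF C'] B.finite_G] .
  have top: "A.tors C M = C" "B.tors C' M = C'" by (auto simp: A.tors_def B.tors_def)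
  have "\<one>\<^bsub>G\<^esub> \<in> A.tors C 0" "\<one>\<^bsub>H\<^esub> \<in> B.tors C' 0"
    using subgroup.one_closed[OF A.tors_subgroup[OF C]] subgroup.one_closed[OF B.tors_subgroup[OF C']] .
  then have pos: "card (A.tors C 0) > 0" "card (B.tors C' 0) > 0"
    using fin finite_subset[OF A.tors_subset] finite_subset[OF B.tors_subset] by (auto simp: card_gt_0_iff)
  have "A.tors C k = C \<longleftrightarrow> card (A.tors C k) = card C"
    using card_subset_eq[OF fin(1) A.tors_subset] by auto
  also have "\<dots> \<longleftrightarrow> card (A.tors C k) * card (B.tors C' 0) = card C * card (B.tors C' 0)"
    using pos(2) by simp
  also have "\<dots> \<longleftrightarrow> card (B.tors C' k) * card (A.tors C 0) = card C' * card (A.tors C 0)"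
    using cards[of k] cards[of M] by (simp only: top)
  also have "\<dots> \<longleftrightarrow> card (B.tors C' k) = card C'" using pos(1) by simp
  also have "\<dots> \<longleftrightarrow> B.tors C' k = C'"
    using card_subset_eq[OF fin(2) B.tors_subset] by auto
  finally show ?thesis .
qed

text \<open>Only conditions with \<open>k \<le> l + e\<close> are assumed, and only the
  character on the \<open>p^e\<close>-torsion is respected. In the induction the complement of a
  normalized plane satisfies the hypotheses with the smaller parameter \<open>e1\<close> of the
  plane. Both forms have the same \<open>m\<close>, because the level is visible in the orders
  of the torsion subgroups, and the same \<open>e1\<close>, because it is defined by conditions
  of the kind assumed.\<close>

theorem isometry_exists:
  assumes "subgroup C G" "subgroup C' H"
    and "\<And>c. c \<in> A.tors C 0 \<Longrightarrow> A.q dvd \<chi> c" "\<And>c. c \<in> B.tors C' 0 \<Longrightarrow> A.q dvd \<chi>' c"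
    and "\<And>k. card (A.tors C k) * card (B.tors C' 0) = card (B.tors C' k) * card (A.tors C 0)"
    and "\<And>k l. k \<le> l + e \<Longrightarrow> (\<forall>c\<in>A.tors C k. A.q dvd int p ^ l * \<chi> c) \<longleftrightarrow> (\<forall>c\<in>B.tors C' k. A.q dvd int p ^ l * \<chi>' c)"
  shows "\<exists>\<Gamma>. isometry e C C' \<Gamma>"
  using assms
proof (induction "card C" arbitrary: C C' e rule: less_induct)
  case less
  note C = less.prems(1) and C' = less.prems(2) and rad = less.prems(3,4) and cards = less.prems(5) and inv = less.prems(6)
  note teq = tors_eq_iff[OF C C' cards]
  show ?case
  proof (cases "A.tors C 0 = C")
    case True
    then have True': "B.tors C' 0 = C'" using teq by blast
    have w0: "[w a b = w' a' b'] (mod A.q)" if "a \<in> C" "b \<in> C" "a' \<in> C'" "b' \<in> C'" for a b a' b'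
    proof -
      have "A.q dvd w a b" "A.q dvd w' a' b'" using that True True' by (auto simp: A.tors_def B.tors_def)
      then show ?thesis by (simp add: cong_def mod_0_imp_dvd dvd_imp_mod_0)
    qed
    have c0: "[\<chi> a = \<chi>' a'] (mod A.q)" if "a \<in> C" "a' \<in> C'" for a a'
    proof -
      have "A.q dvd \<chi> a" "A.q dvd \<chi>' a'" using that rad True True' by auto
      then show ?thesis by (simp add: cong_def dvd_imp_mod_0)
    qed
    have "isometry e C C' (C \<times> C')"
      unfolding isometry_def
    proof (intro conjI allI ballI impI)
      show "\<exists>c'. (c, c') \<in> C \<times> C'" if "c \<in> C" for c using that subgroup.one_closed[OF C'] by blast
      show "\<exists>c. (c, c') \<in> C \<times> C'" if "c' \<in> C'" for c' using that subgroup.one_closed[OF C] by blast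
    qed (auto intro: w0 c0 subgroup.m_closed[OF C] subgroup.m_closed[OF C'])
    then show ?thesis by blast
  next
    case False
    obtain m where m: "1 \<le> m" "m \<le> M" "A.tors C m = C" "A.tors C (m - 1) \<noteq> C" by (rule A.level_exists[OF False])
    have m': "B.tors C' m = C'" "B.tors C' (m - 1) \<noteq> C'" using m teq by auto
    define f where "f = min e m"
    have f: "f \<le> m" "f \<le> e" by (auto simp: f_def)
    have tef: "A.tors C e = A.tors C f"
    proof (cases "e \<le> m")
      case False
      then have "A.tors C m \<subseteq> A.tors C e" by (intro A.tors_mono) simp
      then have "A.tors C e = C" using m(3) A.tors_subset[of C e] by blast
      then show ?thesis using m(3) False by (simp add: f_def)
    qed (simp add: f_def)
    define Q where "Q i \<longleftrightarrow> (\<forall>c\<in>C. A.q dvd int p ^ (m - i) * \<chi> c)" for i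
    have Q': "Q i \<longleftrightarrow> (\<forall>c\<in>C'. A.q dvd int p ^ (m - i) * \<chi>' c)" if "i \<le> f" for i
      unfolding Q_def using inv[of m "m - i"] that f m(3) m'(1) by auto
    have Q0: "Q 0" unfolding Q_def using A.chi_value[OF m(3,2) C _ rad(1)] by simp
    define e1 where "e1 = Max {i. i \<le> f \<and> Q i}"
    have finS: "finite {i. i \<le> f \<and> Q i}" by simp
    have "e1 \<in> {i. i \<le> f \<and> Q i}"
      unfolding e1_def by (rule Max_in[OF finS]) (use Q0 in blast)
    then have e1: "e1 \<le> f" "Q e1" by auto
    have sharp: "\<not> Q (e1 + 1)" if "e1 \<noteq> f"
    proof
      assume "Q (e1 + 1)"
      then have "e1 + 1 \<in> {i. i \<le> f \<and> Q i}" using that e1 by auto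
      then have "e1 + 1 \<le> e1" unfolding e1_def by (rule Max_ge[OF finS])
      then show False by simp
    qed
    have van: "\<And>c. c \<in> C \<Longrightarrow> A.q dvd int p ^ (m - e1) * \<chi> c" using e1(2) by (simp add: Q_def)
    have van': "\<And>c. c \<in> C' \<Longrightarrow> A.q dvd int p ^ (m - e1) * \<chi>' c" using e1(2) Q'[OF e1(1)] by simp
    have sh: "e1 = f \<or> (\<exists>c\<in>C. \<not> A.q dvd int p ^ (m - e1 - 1) * \<chi> c)"
      using sharp by (auto simp: Q_def)
    have sh': "e1 = f \<or> (\<exists>c\<in>C'. \<not> A.q dvd int p ^ (m - e1 - 1) * \<chi>' c)"
    proof (cases "e1 = f")
      case False
      then have "e1 + 1 \<le> f" using e1(1) by simp
      then show ?thesis using sharp[OF False] Q'[of "e1 + 1"] by auto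
    qed simp
    obtain x y where xy: "x \<in> C" "y \<in> C" "[w x y = int p ^ (M - m)] (mod A.q)"
      "[int p ^ (m - f) * \<chi> x = int p ^ (M - f + e1)] (mod A.q)" "A.q dvd int p ^ (m - f) * \<chi> y"
      by (rule A.normalized_pair[OF C m e1(1) f(1) van sh])
    obtain x' y' where xy': "x' \<in> C'" "y' \<in> C'" "[w' x' y' = int p ^ (M - m)] (mod A.q)"
      "[int p ^ (m - f) * \<chi>' x' = int p ^ (M - f + e1)] (mod A.q)" "A.q dvd int p ^ (m - f) * \<chi>' y'"
      by (rule B.normalized_pair[OF C' m(1,2) m' e1(1) f(1) van' sh'])
    have PA: "hyperbolic_pair G p M w \<chi> C m x y" by (rule A.hyperbolic_pairI[OF C m(1-3) xy(1-3)])
    have PB: "hyperbolic_pair H p M w' \<chi>' C' m x' y'" by (rule B.hyperbolic_pairI[OF C' m(1,2) m'(1) xy'(1-3)])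
    interpret PA: hyperbolic_pair G p M w \<chi> C m x y by (rule PA)
    interpret PB: hyperbolic_pair H p M w' \<chi>' C' m x' y' by (rule PB)
    have e1m: "e1 \<le> m" using e1 f by simp
    have "\<exists>\<Gamma>. isometry e1 PA.D PB.D \<Gamma>"
    proof (rule less.hyps[OF PA.card_D_less PA.D_subgroup PB.D_subgroup])
      show "A.q dvd \<chi> c" if "c \<in> A.tors PA.D 0" for c using that rad(1) PA.tors_D by blast
      show "A.q dvd \<chi>' c" if "c \<in> B.tors PB.D 0" for c using that rad(2) PB.tors_D by blast
      fix k
      define n where "n k = card {i \<in> {0..<int p ^ m}. int p ^ m dvd int p ^ k * i} ^ 2" for k
      have "card {i \<in> {0..<int p ^ m}. int p ^ m dvd int p ^ k * i} > 0" for k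
      proof -
        have "0 \<in> {i \<in> {0..<int p ^ m}. int p ^ m dvd int p ^ k * i}" using A.p_pos by simp
        moreover have "finite {i \<in> {0..<int p ^ m}. int p ^ m dvd int p ^ k * i}"
          by (rule finite_subset[of _ "{0..<int p ^ m}"]) auto
        ultimately show ?thesis unfolding card_gt_0_iff by blast
      qed
      then have n0: "n k > 0" for k by (simp add: n_def)
      have "(n k * n 0) * (card (A.tors PA.D k) * card (B.tors PB.D 0)) =
        (n k * n 0) * (card (B.tors PB.D k) * card (A.tors PA.D 0))"
        using cards[of k] unfolding PA.card_tors PB.card_tors n_def[symmetric] by (simp add: ac_simps)
      then show "card (A.tors PA.D k) * card (B.tors PB.D 0) = card (B.tors PB.D k) * card (A.tors PA.D 0)"
        using n0[of k] n0[of 0] by simp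
    next
      fix k l assume kl: "k \<le> l + e1"
      have kl': "k \<le> l + e" using kl e1 f by simp
      show "(\<forall>c\<in>A.tors PA.D k. A.q dvd int p ^ l * \<chi> c) \<longleftrightarrow> (\<forall>c\<in>B.tors PB.D k. A.q dvd int p ^ l * \<chi>' c)"
        using PA.chi_tors_D[OF van e1m kl] PB.chi_tors_D[OF van' e1m kl] inv[OF kl'] by simp
    qed
    then obtain \<Gamma>D where \<Gamma>D: "isometry e1 PA.D PB.D \<Gamma>D" by blast
    obtain \<Gamma> where iso: "isometry f C C' \<Gamma>"
      using extend_isometry[OF PA PB e1(1) f(1) rad van' xy(4,5) xy'(4,5) \<Gamma>D] by blast
    have "isometry e C C' \<Gamma>" using iso unfolding isometry_def tef .
    then show ?thesis by blast
  qed
qed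

end

section \<open>Extension of homomorphisms to a cyclic group\<close>

text \<open>Characters of a subgroup of an abelian group of exponent dividing \<open>N\<close>
  extend to the whole group; here the abelian group is the quotient of \<open>G\<close> by the
  normal subgroup generated by commutators and \<open>N\<close>-th powers, on which
  \<open>h\<close> is trivial. One element \<open>t\<close> is adjoined at a time. If
  \<open>t^k\<close> is its first power in \<open>S\<close>, then \<open>k\<close> divides
  \<open>N\<close> and \<open>(N/k) h(t^k) = h(t^N) = 0\<close>, hence \<open>h(t^k)\<close> is
  divisible by \<open>k\<close>.\<close>

lemma (in group) extend_hom_mod:
  assumes "finite (carrier G)" and "N > (0::nat)" and "subgroup S G" and "hom_mod (int N) S h"
    and "\<And>a b. a \<in> carrier G \<Longrightarrow> b \<in> carrier G \<Longrightarrow> a \<otimes> b \<otimes> inv a \<otimes> inv b \<in> S \<and> int N dvd h (a \<otimes> b \<otimes> inv a \<otimes> inv b)"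
    and "\<And>a. a \<in> carrier G \<Longrightarrow> a [^] N \<in> S \<and> int N dvd h (a [^] N)"
  shows "\<exists>h'. hom_mod (int N) (carrier G) h' \<and> (\<forall>s\<in>S. [h' s = h s] (mod int N))"
  using assms(3-6)
proof (induction "card (carrier G - S)" arbitrary: S h rule: less_induct)
  case less
  note S = less.prems(1) and h = less.prems(2) and comm = less.prems(3) and pow = less.prems(4)
  have SG: "S \<subseteq> carrier G" by (rule subgroup.subset[OF S])
  show ?case
  proof (cases "S = carrier G")
    case True
    then show ?thesis using h by (auto intro!: exI[of _ h])
  next
    case False
    then obtain t where t: "t \<in> carrier G" "t \<notin> S" using SG by blast
    define k where "k = (LEAST k. k > 0 \<and> t [^] (k::nat) \<in> S)"
    have "N > 0 \<and> t [^] N \<in> S" using assms(2) pow[OF t(1)] by simp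
    then have k: "k > 0" "t [^] k \<in> S" unfolding k_def by (metis (mono_tags, lifting) LeastI)+
    have kmin: "\<not> (t [^] j \<in> S)" if "0 < j" "j < k" for j
      using not_less_Least[of j "\<lambda>k. k > 0 \<and> t [^] k \<in> S"] that by (auto simp: k_def)
    have tk_iff: "t [^] (i::int) \<in> S \<longleftrightarrow> int k dvd i" for i
    proof
      assume i: "t [^] i \<in> S"
      have "t [^] (int k * (i div int k)) \<in> S"
        using subgroup_int_pow_closed[OF S k(2), of "i div int k"] t by (simp add: int_pow_int[symmetric] int_pow_pow)
      then have "t [^] (i - int k * (i div int k)) \<in> S"
        using i t subgroup.m_closed[OF S] subgroup.m_inv_closed[OF S] by (simp add: int_pow_diff)
      moreover have "i - int k * (i div int k) = i mod int k" by (simp add: minus_mult_div_eq_mod)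
      moreover have "i mod int k = int (nat (i mod int k))" using k by simp
      ultimately have "t [^] nat (i mod int k) \<in> S" by (metis int_pow_int)
      moreover have "nat (i mod int k) < k" using k by (simp add: nat_less_iff)
      ultimately have "nat (i mod int k) = 0" using kmin by blast
      then have "i mod int k = 0" using k(1) pos_mod_sign[of "int k" i] by linarith
      then show "int k dvd i" by auto
    next
      assume "int k dvd i"
      then obtain j where "i = int k * j" by blast
      then have "t [^] i = (t [^] k) [^] j" using t by (simp add: int_pow_int[symmetric] int_pow_pow)
      then show "t [^] i \<in> S" using subgroup_int_pow_closed[OF S k(2)] by simp
    qed
    have h_pow: "[h ((t [^] k) [^] (j::int)) = j * h (t [^] k)] (mod int N)" for j
      by (rule hom_mod_int_pow[OF S h k(2)])
    have "int k dvd int N" using tk_iff[of "int N"] pow[OF t(1)] by (simp add: int_pow_int)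
    then obtain n where n: "int N = int k * n" by blast
    have n0: "n \<noteq> 0" using n assms(2) by auto
    have "t [^] N = (t [^] k) [^] n"
      using n t by (simp add: int_pow_int[symmetric] int_pow_pow)
    then have "int N dvd n * h (t [^] k)" using h_pow[of n] pow[OF t(1)] cong_dvd_iff by metis
    then have "n * int k dvd n * h (t [^] k)" using n by (simp add: mult.commute)
    then have "int k dvd h (t [^] k)" using n0 by simp
    then obtain c where c: "h (t [^] k) = int k * c" by blast
    define S' where "S' = {s \<otimes> t [^] (i::int) | s i. s \<in> S}"
    have S'I: "s \<otimes> t [^] (i::int) \<in> S'" if "s \<in> S" for s i using that unfolding S'_def by blast
    have wd: "[h s + i * c = h s' + i' * c] (mod int N)"
      if s: "s \<in> S" "s' \<in> S" and e: "s \<otimes> t [^] (i::int) = s' \<otimes> t [^] (i'::int)" for s s' i i'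
    proof -
      have sG: "s \<in> carrier G" "s' \<in> carrier G" using s SG by auto
      have "s \<otimes> t [^] i \<otimes> t [^] (- i') = s' \<otimes> (t [^] i' \<otimes> t [^] (- i'))" using e sG t by (simp add: m_assoc)
      then have "s \<otimes> t [^] (i - i') = s'" using sG t by (simp add: m_assoc int_pow_mult[symmetric])
      then have eq: "t [^] (i - i') = inv s \<otimes> s'" using sG t by (metis inv_solve_left int_pow_closed)
      then have tS: "t [^] (i - i') \<in> S" using s subgroup.m_closed[OF S] subgroup.m_inv_closed[OF S] by metis
      then obtain j where j: "i - i' = int k * j" using tk_iff by blast
      then have "t [^] (i - i') = (t [^] k) [^] j" using t by (simp add: int_pow_int[symmetric] int_pow_pow)
      then have "[h (t [^] (i - i')) = (i - i') * c] (mod int N)" using h_pow[of j] c j by (simp add: ac_simps)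
      have "[h s' = h (s \<otimes> t [^] (i - i'))] (mod int N)" using \<open>s \<otimes> t [^] (i - i') = s'\<close> by simp
      also have "[h (s \<otimes> t [^] (i - i')) = h s + h (t [^] (i - i'))] (mod int N)"
        by (rule hom_mod_mult[OF S h s(1) tS])
      also have "[h s + h (t [^] (i - i')) = h s + (i - i') * c] (mod int N)"
        by (intro cong_add cong_refl \<open>[h (t [^] (i - i')) = (i - i') * c] (mod int N)\<close>)
      finally have "[h s' + i' * c = h s + (i - i') * c + i' * c] (mod int N)" by (intro cong_add cong_refl)
      then show ?thesis by (simp add: algebra_simps cong_sym_eq)
    qed
    define h' where "h' g = (SOME v. \<exists>s i. s \<in> S \<and> g = s \<otimes> t [^] (i::int) \<and> v = h s + i * c)" for g
    have h': "[h' (s \<otimes> t [^] i) = h s + i * c] (mod int N)" if s: "s \<in> S" for s i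
    proof -
      have "\<exists>v. \<exists>s' i'. s' \<in> S \<and> s \<otimes> t [^] i = s' \<otimes> t [^] (i'::int) \<and> v = h s' + i' * c" using s by blast
      then have "\<exists>s' i'. s' \<in> S \<and> s \<otimes> t [^] i = s' \<otimes> t [^] (i'::int) \<and> h' (s \<otimes> t [^] i) = h s' + i' * c"
        unfolding h'_def by (rule someI_ex)
      then obtain s' i' where si: "s' \<in> S" "s \<otimes> t [^] i = s' \<otimes> t [^] (i'::int)" "h' (s \<otimes> t [^] i) = h s' + i' * c"
        by blast
      show ?thesis unfolding si(3) by (rule wd[OF si(1) s si(2)[symmetric]])
    qed
    have prod: "\<exists>z\<in>S. int N dvd h z \<and> (s \<otimes> t [^] i) \<otimes> (s' \<otimes> t [^] j) = (s \<otimes> (z \<otimes> s')) \<otimes> t [^] (i + j)"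
      if s: "s \<in> S" "s' \<in> S" for s s' and i j :: int
    proof -
      have sG: "s \<in> carrier G" "s' \<in> carrier G" using s SG by auto
      let ?z = "t [^] i \<otimes> s' \<otimes> inv (t [^] i) \<otimes> inv s'"
      have "(s \<otimes> (?z \<otimes> s')) \<otimes> t [^] (i + j) = (s \<otimes> t [^] i) \<otimes> (s' \<otimes> t [^] j)"
        using sG t by (simp add: m_assoc int_pow_mult inv_mult_cancel)
      moreover have "?z \<in> S \<and> int N dvd h ?z" by (rule comm) (use t sG in auto)
      ultimately show ?thesis by (intro bexI[of _ ?z]) auto
    qed
    have S'sub: "subgroup S' G"
    proof (rule subgroupI)
      show "S' \<subseteq> carrier G" using SG t by (auto simp: S'_def)
      show "S' \<noteq> {}" using S'I[OF subgroup.one_closed[OF S]] by blast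
      fix a assume "a \<in> S'"
      then obtain s i where a: "s \<in> S" "a = s \<otimes> t [^] (i::int)" unfolding S'_def by blast
      have sG: "s \<in> carrier G" using a SG by blast
      obtain z where z: "z \<in> S" "(\<one> \<otimes> t [^] (- i)) \<otimes> (inv s \<otimes> t [^] (0::int)) = (\<one> \<otimes> (z \<otimes> inv s)) \<otimes> t [^] (- i + 0)"
        using prod[OF subgroup.one_closed[OF S] subgroup.m_inv_closed[OF S a(1)], of "- i" 0] by blast
      have "inv a = (\<one> \<otimes> t [^] (- i)) \<otimes> (inv s \<otimes> t [^] (0::int))"
        unfolding a(2) using sG t by (simp add: inv_mult_group int_pow_neg)
      then have "inv a = (\<one> \<otimes> (z \<otimes> inv s)) \<otimes> t [^] (- i + 0)" using z(2) by simp
      then show "inv a \<in> S'"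
        using S'I[of "\<one> \<otimes> (z \<otimes> inv s)"] subgroup.m_closed[OF S] subgroup.m_inv_closed[OF S a(1)] z(1) subgroup.one_closed[OF S]
        by metis
      fix b assume "b \<in> S'"
      then obtain s' j where b: "s' \<in> S" "b = s' \<otimes> t [^] (j::int)" unfolding S'_def by blast
      obtain z where "z \<in> S" "a \<otimes> b = (s \<otimes> (z \<otimes> s')) \<otimes> t [^] (i + j)"
        using prod[OF a(1) b(1), of i j] a b by blast
      then show "a \<otimes> b \<in> S'" using S'I[of "s \<otimes> (z \<otimes> s')"] subgroup.m_closed[OF S] a(1) b(1) by metis
    qed
    have SS': "S \<subseteq> S'" using S'I[of _ 0] SG by fastforce
    have h'S: "[h' s = h s] (mod int N)" if s: "s \<in> S" for s
      using h'[OF s, of 0] s SG by (simp add: subset_iff)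
    have h'hom: "hom_mod (int N) S' h'"
      unfolding hom_mod_def
    proof (intro ballI)
      fix a b assume "a \<in> S'" "b \<in> S'"
      then obtain s i s' j where ab: "s \<in> S" "a = s \<otimes> t [^] (i::int)" "s' \<in> S" "b = s' \<otimes> t [^] (j::int)"
        unfolding S'_def by blast
      obtain z where z: "z \<in> S" "int N dvd h z" "a \<otimes> b = (s \<otimes> (z \<otimes> s')) \<otimes> t [^] (i + j)"
        using prod[OF ab(1,3), of i j] ab by blast
      have zs: "z \<otimes> s' \<in> S" "s \<otimes> (z \<otimes> s') \<in> S"
        by (intro subgroup.m_closed[OF S] z ab)+
      have "[h' (a \<otimes> b) = h (s \<otimes> (z \<otimes> s')) + (i + j) * c] (mod int N)"
        unfolding z(3) by (rule h'[OF zs(2)])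
      also have "[h (s \<otimes> (z \<otimes> s')) + (i + j) * c = (h s + h (z \<otimes> s')) + (i + j) * c] (mod int N)"
        by (intro cong_add cong_refl hom_mod_mult[OF S h] ab zs)
      also have "[(h s + h (z \<otimes> s')) + (i + j) * c = (h s + (h z + h s')) + (i + j) * c] (mod int N)"
        by (intro cong_add cong_refl hom_mod_mult[OF S h] ab z)
      also have "[(h s + (h z + h s')) + (i + j) * c = (h s + (0 + h s')) + (i + j) * c] (mod int N)"
        by (intro cong_add cong_refl cong_0_iff[THEN iffD2] z)
      also have "(h s + (0 + h s')) + (i + j) * c = (h s + i * c) + (h s' + j * c)" by (simp add: algebra_simps)
      also have "[(h s + i * c) + (h s' + j * c) = h' a + h' b] (mod int N)"
        unfolding ab(2,4) by (intro cong_add cong_sym[OF h'] ab)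
      finally show "[h' (a \<otimes> b) = h' a + h' b] (mod int N)" .
    qed
    have "t \<in> S'" using S'I[OF subgroup.one_closed[OF S], of 1] t by simp
    have "card (carrier G - S') < card (carrier G - S)"
      by (rule psubset_card_mono) (use assms(1) SS' \<open>t \<in> S'\<close> t in auto)
    then have "\<exists>h''. hom_mod (int N) (carrier G) h'' \<and> (\<forall>s\<in>S'. [h'' s = h' s] (mod int N))"
    proof (rule less.hyps[OF _ S'sub h'hom])
      fix a b assume ab: "a \<in> carrier G" "b \<in> carrier G"
      then show "a \<otimes> b \<otimes> inv a \<otimes> inv b \<in> S' \<and> int N dvd h' (a \<otimes> b \<otimes> inv a \<otimes> inv b)"
        using comm[OF ab] SS' h'S cong_dvd_iff by blast
    next
      fix a assume "a \<in> carrier G"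
      then show "a [^] N \<in> S' \<and> int N dvd h' (a [^] N)" using pow SS' h'S cong_dvd_iff by blast
    qed
    then obtain h'' where h'': "hom_mod (int N) (carrier G) h''" "\<And>s. s \<in> S' \<Longrightarrow> [h'' s = h' s] (mod int N)" by blast
    have "[h'' s = h s] (mod int N)" if s: "s \<in> S" for s
      by (rule cong_trans[OF h''(2) h'S]) (use s SS' in auto)
    then show ?thesis using h''(1) by blast
  qed
qed

section \<open>Groups of class two with cyclic centre\<close>

definition (in group) comm :: "'a \<Rightarrow> 'a \<Rightarrow> 'a" where
  "comm x y = x \<otimes> y \<otimes> inv x \<otimes> inv y"

lemma (in group) subgroup_center: "subgroup (group_center G) G"
proof (rule subgroupI)
  show "group_center G \<subseteq> carrier G" by (auto simp: group_center_def)
  have "\<one> \<in> group_center G" by (simp add: group_center_def)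
  then show "group_center G \<noteq> {}" by blast
  fix a assume "a \<in> group_center G"
  then have a: "a \<in> carrier G" "\<And>x. x \<in> carrier G \<Longrightarrow> a \<otimes> x = x \<otimes> a" by (auto simp: group_center_def)
  have "inv a \<otimes> x = x \<otimes> inv a" if x: "x \<in> carrier G" for x
  proof -
    have "inv a \<otimes> x = inv a \<otimes> (x \<otimes> a) \<otimes> inv a" using a(1) x by (simp add: m_assoc)
    also have "\<dots> = x \<otimes> inv a" unfolding a(2)[OF x, symmetric] using a(1) x by (simp add: m_assoc inv_mult_cancel)
    finally show ?thesis .
  qed
  then show "inv a \<in> group_center G" using a(1) by (simp add: group_center_def)
  fix b assume "b \<in> group_center G"
  then have b: "b \<in> carrier G" "\<And>x. x \<in> carrier G \<Longrightarrow> b \<otimes> x = x \<otimes> b" by (auto simp: group_center_def)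
  have "a \<otimes> b \<otimes> x = x \<otimes> (a \<otimes> b)" if x: "x \<in> carrier G" for x
  proof -
    have "a \<otimes> b \<otimes> x = a \<otimes> (x \<otimes> b)" using a(1) b x by (simp add: m_assoc)
    also have "\<dots> = x \<otimes> a \<otimes> b" using a b x by (simp add: m_assoc[symmetric])
    finally show ?thesis using a(1) b(1) x by (simp add: m_assoc)
  qed
  then show "a \<otimes> b \<in> group_center G" using a(1) b(1) by (simp add: group_center_def)
qed

locale cyclic_center_class_two = group G for G (structure) +
  fixes p n :: nat and z
  assumes finite_G: "finite (carrier G)" and prime_p: "Factorial_Ring.prime p" and odd_p: "odd p"
    and z_center: "z \<in> group_center G"
    and center_gen: "x \<in> group_center G \<Longrightarrow> \<exists>i::int. x = z [^] i"
    and ord_z: "ord z = p ^ n"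
    and comm_central: "x \<in> carrier G \<Longrightarrow> y \<in> carrier G \<Longrightarrow> comm x y \<in> group_center G"
begin

lemma z_carrier: "z \<in> carrier G"
  using z_center by (simp add: group_center_def)

lemma center_carrier: "c \<in> group_center G \<Longrightarrow> c \<in> carrier G"
  by (simp add: group_center_def)

lemma center_commute: "c \<in> group_center G \<Longrightarrow> x \<in> carrier G \<Longrightarrow> c \<otimes> x = x \<otimes> c"
  by (simp add: group_center_def)

lemma comm_carrier: "x \<in> carrier G \<Longrightarrow> y \<in> carrier G \<Longrightarrow> comm x y \<in> carrier G"
  using comm_central center_carrier by blast

lemma z_pow_eq: "z [^] (i::int) = z [^] (j::int) \<longleftrightarrow> [i = j] (mod int p ^ n)"
proof -
  have "int (ord z) dvd j - i \<longleftrightarrow> [i = j] (mod int p ^ n)"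
    by (simp add: ord_z cong_iff_dvd_diff dvd_diff_commute)
  then show ?thesis using int_pow_eq[OF z_carrier, of i j] by simp
qed

lemma z_pow_one: "z [^] (i::int) = \<one> \<longleftrightarrow> int p ^ n dvd i"
  using int_pow_eq_id[OF z_carrier, of i] by (simp add: ord_z)

lemma z_pow_center: "z [^] (i::int) \<in> group_center G"
  by (rule subgroup_int_pow_closed[OF subgroup_center z_center])

definition dlog :: "'a \<Rightarrow> int" where
  "dlog c = (SOME i. c = z [^] i)"

lemma z_dlog: "c \<in> group_center G \<Longrightarrow> z [^] dlog c = c"
  unfolding dlog_def using someI_ex[OF center_gen] by metis

lemma dlog_pow: "[dlog (z [^] (i::int)) = i] (mod int p ^ n)"
  using z_dlog[OF z_pow_center] z_pow_eq by blast

lemma dlog_mult: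
  assumes "a \<in> group_center G" "b \<in> group_center G"
  shows "[dlog (a \<otimes> b) = dlog a + dlog b] (mod int p ^ n)"
proof -
  have "a \<otimes> b = z [^] (dlog a + dlog b)"
    using assms by (simp add: int_pow_mult z_carrier z_dlog)
  then show ?thesis using dlog_pow by simp
qed

lemma dlog_zero_iff: "c \<in> group_center G \<Longrightarrow> int p ^ n dvd dlog c \<longleftrightarrow> c = \<one>"
  using z_pow_one[of "dlog c"] z_dlog by simp

lemma comm_mult_left:
  assumes "x \<in> carrier G" "y \<in> carrier G" "u \<in> carrier G"
  shows "comm (x \<otimes> y) u = comm x u \<otimes> comm y u"
proof -
  have "comm (x \<otimes> y) u = x \<otimes> comm y u \<otimes> (u \<otimes> inv x \<otimes> inv u)"
    using assms by (simp add: comm_def m_assoc inv_mult_group inv_mult_cancel)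
  also have "x \<otimes> comm y u = comm y u \<otimes> x"
    using center_commute[OF comm_central[OF assms(2,3)] assms(1)] by simp
  also have "comm y u \<otimes> x \<otimes> (u \<otimes> inv x \<otimes> inv u) = comm y u \<otimes> comm x u"
    using assms comm_carrier[OF assms(2,3)] by (simp add: comm_def[of x u] m_assoc)
  also have "\<dots> = comm x u \<otimes> comm y u"
    by (rule center_commute[OF comm_central[OF assms(2,3)] comm_carrier[OF assms(1,3)]])
  finally show ?thesis .
qed

lemma comm_mult_right:
  assumes "x \<in> carrier G" "y \<in> carrier G" "u \<in> carrier G"
  shows "comm u (x \<otimes> y) = comm u x \<otimes> comm u y"
proof -
  have "comm u (x \<otimes> y) = comm u x \<otimes> (x \<otimes> comm u y \<otimes> inv x)"
    using assms by (simp add: comm_def m_assoc inv_mult_group inv_mult_cancel)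
  also have "x \<otimes> comm u y = comm u y \<otimes> x"
    using center_commute[OF comm_central[OF assms(3,2)] assms(1)] by simp
  finally show ?thesis using assms comm_carrier by (simp add: m_assoc)
qed

lemma comm_pow_left:
  assumes "x \<in> carrier G" "u \<in> carrier G"
  shows "comm (x [^] (k::nat)) u = comm x u [^] k"
proof (induction k)
  case 0
  then show ?case using assms by (simp add: comm_def)
next
  case (Suc k)
  then show ?case using assms comm_mult_left[of "x [^] k" x u] by simp
qed

lemma center_pow_pn: "c \<in> group_center G \<Longrightarrow> c [^] (p ^ n) = \<one>"
proof -
  assume c: "c \<in> group_center G"
  have "c [^] int (p ^ n) = z [^] (dlog c * int (p ^ n))"
    using int_pow_pow[OF z_carrier, of "dlog c" "int (p ^ n)"] z_dlog[OF c] by simp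
  also have "\<dots> = \<one>" unfolding z_pow_one by simp
  finally show ?thesis by (simp only: int_pow_int)
qed

lemma pow_pn_central: "x \<in> carrier G \<Longrightarrow> x [^] (p ^ n) \<in> group_center G"
proof -
  assume x: "x \<in> carrier G"
  have "x [^] (p ^ n) \<otimes> u = u \<otimes> x [^] (p ^ n)" if u: "u \<in> carrier G" for u
  proof -
    have "comm (x [^] (p ^ n)) u = \<one>"
      using comm_pow_left[OF x u] center_pow_pn[OF comm_central[OF x u]] by simp
    then have "x [^] (p ^ n) \<otimes> u \<otimes> inv (x [^] (p ^ n)) \<otimes> inv u \<otimes> u \<otimes> x [^] (p ^ n) = \<one> \<otimes> u \<otimes> x [^] (p ^ n)"
      by (simp only: comm_def)
    then show ?thesis using x u by (simp add: m_assoc inv_mult_cancel)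
  qed
  then show ?thesis using x by (simp add: group_center_def)
qed

text \<open>Collecting the commutators in \<open>(xy)^k\<close> gives a triangular number as
  exponent. For odd \<open>p\<close> and \<open>k = p^n\<close> it is divisible by
  \<open>p^n\<close>, and the \<open>p^n\<close>-th power map becomes a homomorphism.\<close>

lemma mult_pow:
  assumes x: "x \<in> carrier G" and y: "y \<in> carrier G"
  shows "(x \<otimes> y) [^] (k::nat) = x [^] k \<otimes> y [^] k \<otimes> comm y x [^] (k * (k - 1) div 2)"
proof (induction k)
  case 0
  then show ?case using x y by simp
next
  case (Suc k)
  let ?c = "comm y x"
  let ?t = "k * (k - 1) div 2"
  have c: "?c \<in> carrier G" "?c \<in> group_center G" using comm_carrier comm_central x y by auto
  have cc: "?c [^] (j::nat) \<otimes> u = u \<otimes> ?c [^] j" if "u \<in> carrier G" for u j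
    using c that
  proof (induction j)
    case (Suc j)
    then show ?case using center_commute[OF c(2) that] by (simp add: m_assoc) (simp add: m_assoc[symmetric])
  qed simp
  have yx: "y [^] k \<otimes> x = x \<otimes> y [^] k \<otimes> ?c [^] k"
  proof -
    have "comm (y [^] k) x \<otimes> (x \<otimes> y [^] k) = y [^] k \<otimes> x"
      using x y by (simp add: comm_def m_assoc inv_mult_cancel)
    then have "?c [^] k \<otimes> (x \<otimes> y [^] k) = y [^] k \<otimes> x" using comm_pow_left[OF y x] by simp
    then show ?thesis using cc[of "x \<otimes> y [^] k" k] x y by simp
  qed
  have tri: "k + ?t = Suc k * (Suc k - 1) div 2"
  proof -
    have "Suc k * (Suc k - 1) = 2 * k + k * (k - 1)" by (cases k) auto
    then show ?thesis by simp
  qed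
  have "(x \<otimes> y) [^] Suc k = x [^] k \<otimes> y [^] k \<otimes> (?c [^] ?t \<otimes> (x \<otimes> y))"
    using Suc x y c by (simp add: m_assoc)
  also have "\<dots> = x [^] k \<otimes> (y [^] k \<otimes> x) \<otimes> (y \<otimes> ?c [^] ?t)"
    using x y c cc[of "x \<otimes> y" ?t] by (simp add: m_assoc)
  also have "\<dots> = x [^] k \<otimes> x \<otimes> y [^] k \<otimes> (?c [^] k \<otimes> y \<otimes> ?c [^] ?t)"
    unfolding yx using x y c by (simp add: m_assoc)
  also have "\<dots> = x [^] k \<otimes> x \<otimes> (y [^] k \<otimes> y) \<otimes> (?c [^] k \<otimes> ?c [^] ?t)"
    unfolding cc[OF y, of k] using x y c by (simp add: m_assoc)
  also have "\<dots> = x [^] Suc k \<otimes> y [^] Suc k \<otimes> ?c [^] (Suc k * (Suc k - 1) div 2)"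
    unfolding tri[symmetric] using c by (simp add: nat_pow_mult)
  finally show ?case .
qed

lemma mult_pow_pn:
  assumes x: "x \<in> carrier G" and y: "y \<in> carrier G"
  shows "(x \<otimes> y) [^] (p ^ n) = x [^] (p ^ n) \<otimes> y [^] (p ^ n)"
proof -
  let ?c = "comm y x"
  have "even (p ^ n - 1)" using odd_p by simp
  then have "p ^ n * (p ^ n - 1) div 2 = p ^ n * ((p ^ n - 1) div 2)" by (simp add: div_mult_swap)
  then have "?c [^] (p ^ n * (p ^ n - 1) div 2) = (?c [^] (p ^ n)) [^] ((p ^ n - 1) div 2)"
    using comm_carrier x y by (simp add: nat_pow_pow)
  also have "\<dots> = \<one>" using center_pow_pn comm_central x y by simp
  finally show ?thesis using mult_pow[OF x y, of "p ^ n"] x y by simp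
qed

definition w :: "'a \<Rightarrow> 'a \<Rightarrow> int" where "w x y = dlog (comm x y)"

definition \<chi> :: "'a \<Rightarrow> int" where "\<chi> x = dlog (x [^] (p ^ n))"

lemma w_zero_imp_central:
  assumes x: "x \<in> carrier G" and "\<And>u. u \<in> carrier G \<Longrightarrow> int p ^ n dvd w x u"
  shows "x \<in> group_center G"
proof -
  have "x \<otimes> u = u \<otimes> x" if u: "u \<in> carrier G" for u
  proof -
    have "comm x u = \<one>" using assms(2)[OF u] dlog_zero_iff[OF comm_central[OF x u]] by (simp add: w_def)
    then have "x \<otimes> u \<otimes> inv x \<otimes> inv u \<otimes> u \<otimes> x = \<one> \<otimes> u \<otimes> x" by (simp only: comm_def)
    then show ?thesis using x u by (simp add: m_assoc inv_mult_cancel)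
  qed
  then show ?thesis using x by (simp add: group_center_def)
qed

lemma w_central_zero:
  assumes "c \<in> group_center G" "u \<in> carrier G"
  shows "int p ^ n dvd w c u"
proof -
  have "comm c u = \<one>" using assms center_commute[OF assms] center_carrier[OF assms(1)]
    by (simp add: comm_def) (simp add: m_assoc)
  then show ?thesis using dlog_zero_iff[of \<one>] by (simp add: w_def group_center_def)
qed

lemma alternating_form_commutator: "alternating_form G p n w \<chi>"
proof
  show "finite (carrier G)" by (rule finite_G)
  show "Factorial_Ring.prime p" by (rule prime_p)
  show "hom_mod (int p ^ n) (carrier G) (\<lambda>x. w x u)" if "u \<in> carrier G" for u
    unfolding hom_mod_def w_def using that by (simp add: comm_mult_left dlog_mult comm_central)
  show "hom_mod (int p ^ n) (carrier G) (\<lambda>x. w u x)" if "u \<in> carrier G" for u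
    unfolding hom_mod_def w_def using that by (simp add: comm_mult_right dlog_mult comm_central)
  show "[w x x = 0] (mod int p ^ n)" if "x \<in> carrier G" for x
  proof -
    have "comm x x = \<one>" using that by (simp add: comm_def m_assoc)
    then show ?thesis using dlog_zero_iff[of \<one>] by (simp add: w_def group_center_def cong_0_iff)
  qed
  show "hom_mod (int p ^ n) (carrier G) \<chi>"
    unfolding hom_mod_def \<chi>_def by (simp add: mult_pow_pn dlog_mult pow_pn_central)
  show "int p ^ n dvd \<chi> x" if x: "x \<in> carrier G" and "\<And>u. u \<in> carrier G \<Longrightarrow> int p ^ n dvd w x u" for x
    using center_pow_pn[OF w_zero_imp_central[OF that]] dlog_zero_iff[of \<one>]
    by (simp add: \<chi>_def group_center_def)
qed

sublocale alternating_form G p n w \<chi>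
  by (rule alternating_form_commutator)

lemma chi_pow_one_iff:
  assumes x: "x \<in> carrier G"
  shows "int p ^ n dvd int p ^ l * \<chi> x \<longleftrightarrow> x [^] (p ^ (n + l)) = \<one>"
proof -
  have "x [^] (p ^ (n + l)) = (x [^] (p ^ n)) [^] int (p ^ l)"
    by (simp only: int_pow_int nat_pow_pow[OF x] power_add)
  also have "\<dots> = (z [^] \<chi> x) [^] int (p ^ l)" unfolding \<chi>_def z_dlog[OF pow_pn_central[OF x]] ..
  also have "\<dots> = z [^] (\<chi> x * int (p ^ l))" using z_carrier by (simp add: int_pow_pow)
  finally show ?thesis using z_pow_one[of "\<chi> x * int (p ^ l)"] by (simp add: mult.commute)
qed

end

locale cyclic_center_pair = A: cyclic_center_class_two G p n z + B: cyclic_center_class_two H p n z'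
  for G :: "('g, 'm) monoid_scheme" and H :: "('h, 'k) monoid_scheme" and p n z z'
begin

sublocale form_pair G H p n A.w A.\<chi> B.w B.\<chi>
  by (simp add: form_pair_def A.alternating_form_commutator B.alternating_form_commutator)

text \<open>The isometry identifies \<open>G/Z(G)\<close> with \<open>H/Z(H)\<close>. The group
  \<open>K\<close> of all pairs with corresponding classes contains \<open>S = Z(G) \<times>
  Z(H)\<close>, and \<open>lam\<close> measures how far a central pair is from the diagonal
  \<open>(z^a, z'^a)\<close>. As \<open>w\<close> and \<open>\<chi>\<close> are respected,
  \<open>lam\<close> is trivial on commutators and \<open>p^n\<close>-th powers and extends to
  \<open>K\<close>. In each fibre of \<open>K\<close> over \<open>G\<close> exactly one element
  lies in the kernel \<open>\<Delta>\<close> of the extension.\<close>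

lemma iso_of_isometry:
  assumes \<Gamma>: "isometry n (carrier G) (carrier H) \<Gamma>"
  shows "G \<cong> H"
proof -
  let ?q = "int p ^ n"
  have \<Gamma>_sub: "u \<in> carrier G" "u' \<in> carrier H" if "(u, u') \<in> \<Gamma>" for u u' using \<Gamma> that unfolding isometry_def by auto
  have \<Gamma>_onto: "\<exists>u'. (u, u') \<in> \<Gamma>" if "u \<in> carrier G" for u using \<Gamma> that unfolding isometry_def by blast
  have \<Gamma>_onto': "\<exists>u. (u, u') \<in> \<Gamma>" if "u' \<in> carrier H" for u' using \<Gamma> that unfolding isometry_def by blast
  have \<Gamma>_w: "[A.w a b = B.w a' b'] (mod ?q)" if "(a, a') \<in> \<Gamma>" "(b, b') \<in> \<Gamma>" for a a' b b'
    using \<Gamma> that unfolding isometry_def by blast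
  have top: "A.tors (carrier G) n = carrier G" by (auto simp: A.tors_def)
  have \<Gamma>_chi: "[A.\<chi> a = B.\<chi> a'] (mod ?q)" if "(a, a') \<in> \<Gamma>" for a a'
    using \<Gamma> that \<Gamma>_sub[OF that] unfolding isometry_def top by blast
  \<comment> \<open>Every pair that pairs with \<open>\<Gamma>\<close> in the right way is
    admitted, so that \<open>K\<close> contains all pairs of central elements.\<close>
  define K where "K = {(g, g'). g \<in> carrier G \<and> g' \<in> carrier H \<and> (\<forall>u u'. (u, u') \<in> \<Gamma> \<longrightarrow> [A.w g u = B.w g' u'] (mod ?q))}"
  have KI: "(g, g') \<in> K" if "g \<in> carrier G" "g' \<in> carrier H" "\<And>u u'. (u, u') \<in> \<Gamma> \<Longrightarrow> [A.w g u = B.w g' u'] (mod ?q)" for g g'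
    using that by (simp add: K_def)
  have K_sub: "g \<in> carrier G" "g' \<in> carrier H" if "(g, g') \<in> K" for g g' using that by (auto simp: K_def)
  have K_w: "[A.w g u = B.w g' u'] (mod ?q)" if "(g, g') \<in> K" "(u, u') \<in> \<Gamma>" for g g' u u'
    using that by (auto simp: K_def)
  have \<Gamma>K: "(g, g') \<in> K" if "(g, g') \<in> \<Gamma>" for g g'
    using that \<Gamma>_sub[OF that] \<Gamma>_w by (intro KI) auto
  have w'eq: "[B.w g' v = B.w g'' v] (mod ?q)" if gK: "(g, g') \<in> K" and g\<Gamma>: "(g, g'') \<in> \<Gamma>" and v: "v \<in> carrier H" for g g' g'' v
  proof -
    obtain u where u: "(u, v) \<in> \<Gamma>" using \<Gamma>_onto'[OF v] by blast
    show ?thesis by (rule cong_trans[OF cong_sym[OF K_w[OF gK u]] \<Gamma>_w[OF g\<Gamma> u]])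
  qed
  have KK_w: "[A.w g h = B.w g' h'] (mod ?q)" if gg: "(g, g') \<in> K" and hh: "(h, h') \<in> K" for g g' h h'
  proof -
    obtain g'' where g'': "(g, g'') \<in> \<Gamma>" using \<Gamma>_onto[OF K_sub(1)[OF gg]] by blast
    have "[A.w g h = - A.w h g] (mod ?q)" by (intro A.w_skew K_sub(1)[OF gg] K_sub(1)[OF hh])
    also have "[- A.w h g = - B.w h' g''] (mod ?q)" using K_w[OF hh g''] by (simp only: cong_minus_minus_iff)
    also have "[- B.w h' g'' = B.w g'' h'] (mod ?q)"
      by (intro cong_sym[OF B.w_skew] K_sub(2)[OF hh] \<Gamma>_sub(2)[OF g''])
    also have "[B.w g'' h' = B.w g' h'] (mod ?q)" by (rule cong_sym[OF w'eq[OF gg g'' K_sub(2)[OF hh]]])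
    finally show ?thesis .
  qed
  have K_chi: "[A.\<chi> g = B.\<chi> g'] (mod ?q)" if gg: "(g, g') \<in> K" for g g'
  proof -
    obtain g'' where g'': "(g, g'') \<in> \<Gamma>" using \<Gamma>_onto[OF K_sub(1)[OF gg]] by blast
    have "[B.\<chi> g' = B.\<chi> g''] (mod ?q)"
      by (rule B.chi_cong[OF B.subgroup_self K_sub(2)[OF gg] \<Gamma>_sub(2)[OF g''] _ w'eq[OF gg g'']])
         (auto simp: B.tors_def intro: B.chi_rad)
    then show ?thesis using \<Gamma>_chi[OF g''] cong_sym cong_trans by blast
  qed
  let ?P = "G \<times>\<times> H"
  interpret P: group ?P by (rule DirProd_group[OF A.is_group B.is_group])
  have invP: "inv\<^bsub>?P\<^esub> (a, b) = (inv\<^bsub>G\<^esub> a, inv\<^bsub>H\<^esub> b)" if "a \<in> carrier G" "b \<in> carrier H" for a b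
    by (rule inv_DirProd[OF A.is_group B.is_group that])
  have KP: "subgroup K ?P"
  proof (rule P.subgroupI)
    show "K \<subseteq> carrier ?P" using K_sub by auto
    have "(\<one>\<^bsub>G\<^esub>, \<one>\<^bsub>H\<^esub>) \<in> K"
      by (intro KI) (auto intro: cong_trans[OF A.w_one_left cong_sym[OF B.w_one_left]] \<Gamma>_sub)
    then show "K \<noteq> {}" by blast
    fix a assume aK: "a \<in> K"
    obtain g g' where a: "a = (g, g')" by (cases a)
    have gK: "(g, g') \<in> K" using aK a by simp
    have "(inv\<^bsub>G\<^esub> g, inv\<^bsub>H\<^esub> g') \<in> K"
    proof (rule KI)
      fix u u' assume u: "(u, u') \<in> \<Gamma>"
      have "[A.w (inv\<^bsub>G\<^esub> g) u = - A.w g u] (mod ?q)" by (intro A.w_inv_left K_sub[OF gK] \<Gamma>_sub[OF u])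
      also have "[- A.w g u = - B.w g' u'] (mod ?q)" using K_w[OF gK u] by (simp only: cong_minus_minus_iff)
      also have "[- B.w g' u' = B.w (inv\<^bsub>H\<^esub> g') u'] (mod ?q)" by (intro cong_sym[OF B.w_inv_left] K_sub[OF gK] \<Gamma>_sub[OF u])
      finally show "[A.w (inv\<^bsub>G\<^esub> g) u = B.w (inv\<^bsub>H\<^esub> g') u'] (mod ?q)" .
    qed (use K_sub[OF gK] in auto)
    then show "inv\<^bsub>?P\<^esub> a \<in> K" using a invP K_sub[OF gK] by simp
    fix b assume bK: "b \<in> K"
    obtain h h' where b: "b = (h, h')" by (cases b)
    have hK: "(h, h') \<in> K" using bK b by simp
    have "(g \<otimes>\<^bsub>G\<^esub> h, g' \<otimes>\<^bsub>H\<^esub> h') \<in> K"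
    proof (rule KI)
      fix u u' assume u: "(u, u') \<in> \<Gamma>"
      have "[A.w (g \<otimes>\<^bsub>G\<^esub> h) u = A.w g u + A.w h u] (mod ?q)" by (intro A.w_mult_left K_sub[OF gK] K_sub[OF hK] \<Gamma>_sub[OF u])
      also have "[A.w g u + A.w h u = B.w g' u' + B.w h' u'] (mod ?q)" by (intro cong_add K_w[OF _ u] gK hK)
      also have "[B.w g' u' + B.w h' u' = B.w (g' \<otimes>\<^bsub>H\<^esub> h') u'] (mod ?q)"
        by (intro cong_sym[OF B.w_mult_left] K_sub[OF gK] K_sub[OF hK] \<Gamma>_sub[OF u])
      finally show "[A.w (g \<otimes>\<^bsub>G\<^esub> h) u = B.w (g' \<otimes>\<^bsub>H\<^esub> h') u'] (mod ?q)" .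
    qed (use K_sub[OF gK] K_sub[OF hK] in auto)
    then show "a \<otimes>\<^bsub>?P\<^esub> b \<in> K" using a b by simp
  qed
  let ?K = "?P\<lparr>carrier := K\<rparr>"
  interpret K: group ?K by (rule P.subgroup_imp_group[OF KP])
  define S where "S = group_center G \<times> group_center H"
  define lam where "lam = (\<lambda>(a, b). B.dlog b - A.dlog a)"
  have SK: "(a, b) \<in> K" if "a \<in> group_center G" "b \<in> group_center H" for a b
  proof (rule KI)
    fix u u' assume u: "(u, u') \<in> \<Gamma>"
    have "[A.w a u = 0] (mod ?q)" "[B.w b u' = 0] (mod ?q)"
      using A.w_central_zero[OF that(1) \<Gamma>_sub(1)[OF u]] B.w_central_zero[OF that(2) \<Gamma>_sub(2)[OF u]]
      by (simp_all add: cong_0_iff)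
    then show "[A.w a u = B.w b u'] (mod ?q)" using cong_trans cong_sym by blast
  qed (use that A.center_carrier B.center_carrier in auto)
  have SP: "subgroup S ?P" unfolding S_def
    by (rule DirProd_subgroups[OF A.is_group A.subgroup_center B.is_group B.subgroup_center])
  have SsubK: "S \<subseteq> K" using SK by (auto simp: S_def)
  have SKs: "subgroup S ?K"
    by (rule P.subgroup_incl[OF SP KP SsubK])
  have lam_hom: "K.hom_mod ?q S lam"
    unfolding K.hom_mod_def
  proof (intro ballI)
    fix s t assume "s \<in> S" "t \<in> S"
    then obtain a b c d where st: "s = (a, b)" "t = (c, d)" "a \<in> group_center G" "b \<in> group_center H"
       "c \<in> group_center G" "d \<in> group_center H" by (auto simp: S_def)
    have "[B.dlog (b \<otimes>\<^bsub>H\<^esub> d) - A.dlog (a \<otimes>\<^bsub>G\<^esub> c) = (B.dlog b + B.dlog d) - (A.dlog a + A.dlog c)] (mod ?q)"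
      by (intro cong_diff A.dlog_mult B.dlog_mult st)
    then show "[lam (s \<otimes>\<^bsub>?K\<^esub> t) = lam s + lam t] (mod ?q)" by (simp add: lam_def st algebra_simps)
  qed
  have powP: "(g, g') [^]\<^bsub>?K\<^esub> (k::nat) = (g [^]\<^bsub>G\<^esub> k, g' [^]\<^bsub>H\<^esub> k)" for g g' k
    by (induction k) auto
  have invK: "inv\<^bsub>?K\<^esub> (g, g') = (inv\<^bsub>G\<^esub> g, inv\<^bsub>H\<^esub> g')" if "(g, g') \<in> K" for g g'
    using P.m_inv_consistent[OF KP that] invP K_sub[OF that] by simp
  have finK: "finite (carrier ?K)"
  proof -
    have "K \<subseteq> carrier G \<times> carrier H" using K_sub by auto
    then show ?thesis using finite_subset A.finite_G B.finite_G by auto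
  qed
  have pn: "p ^ n > 0" using A.prime_p prime_gt_0_nat by simp
  have "\<exists>h'. K.hom_mod (int (p ^ n)) (carrier ?K) h' \<and> (\<forall>s\<in>S. [h' s = lam s] (mod int (p ^ n)))"
  proof (rule K.extend_hom_mod[OF finK pn SKs])
    show "K.hom_mod (int (p ^ n)) S lam" using lam_hom by simp
  next
    fix a b assume ab: "a \<in> carrier ?K" "b \<in> carrier ?K"
    obtain g g' where a: "a = (g, g')" by (cases a)
    obtain h h' where b: "b = (h, h')" by (cases b)
    have gK: "(g, g') \<in> K" and hK: "(h, h') \<in> K" using ab a b by auto
    have eq: "a \<otimes>\<^bsub>?K\<^esub> b \<otimes>\<^bsub>?K\<^esub> inv\<^bsub>?K\<^esub> a \<otimes>\<^bsub>?K\<^esub> inv\<^bsub>?K\<^esub> b = (A.comm g h, B.comm g' h')"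
      unfolding a b invK[OF gK] invK[OF hK] by (simp add: A.comm_def B.comm_def)
    have "int (p ^ n) dvd lam (A.comm g h, B.comm g' h')"
      using KK_w[OF gK hK] by (simp add: lam_def A.w_def B.w_def cong_iff_dvd_diff dvd_diff_commute)
    moreover have "(A.comm g h, B.comm g' h') \<in> S"
      using A.comm_central B.comm_central K_sub[OF gK] K_sub[OF hK] by (simp add: S_def)
    ultimately show "a \<otimes>\<^bsub>?K\<^esub> b \<otimes>\<^bsub>?K\<^esub> inv\<^bsub>?K\<^esub> a \<otimes>\<^bsub>?K\<^esub> inv\<^bsub>?K\<^esub> b \<in> S \<and>
       int (p ^ n) dvd lam (a \<otimes>\<^bsub>?K\<^esub> b \<otimes>\<^bsub>?K\<^esub> inv\<^bsub>?K\<^esub> a \<otimes>\<^bsub>?K\<^esub> inv\<^bsub>?K\<^esub> b)"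
      unfolding eq by blast
  next
    fix a assume aK: "a \<in> carrier ?K"
    obtain g g' where a: "a = (g, g')" by (cases a)
    have gK: "(g, g') \<in> K" using aK a by simp
    have "int (p ^ n) dvd lam (g [^]\<^bsub>G\<^esub> (p ^ n), g' [^]\<^bsub>H\<^esub> (p ^ n))"
      using K_chi[OF gK] by (simp add: lam_def A.\<chi>_def B.\<chi>_def cong_iff_dvd_diff dvd_diff_commute)
    moreover have "(g [^]\<^bsub>G\<^esub> (p ^ n), g' [^]\<^bsub>H\<^esub> (p ^ n)) \<in> S"
      using A.pow_pn_central B.pow_pn_central K_sub[OF gK] by (simp add: S_def)
    ultimately show "a [^]\<^bsub>?K\<^esub> (p ^ n) \<in> S \<and> int (p ^ n) dvd lam (a [^]\<^bsub>?K\<^esub> (p ^ n))"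
      unfolding a powP by blast
  qed
  then obtain l where l: "K.hom_mod ?q K l" "\<And>s. s \<in> S \<Longrightarrow> [l s = lam s] (mod ?q)" by auto
  have l_mult: "[l (g \<otimes>\<^bsub>G\<^esub> h, g' \<otimes>\<^bsub>H\<^esub> h') = l (g, g') + l (h, h')] (mod ?q)" if "(g, g') \<in> K" "(h, h') \<in> K" for g g' h h'
    using l(1) that unfolding K.hom_mod_def by fastforce
  have K_mult: "(g \<otimes>\<^bsub>G\<^esub> h, g' \<otimes>\<^bsub>H\<^esub> h') \<in> K" if "(g, g') \<in> K" "(h, h') \<in> K" for g g' h h'
    using subgroup.m_closed[OF KP that] by simp
  define \<Delta> where "\<Delta> = {(g, g'). (g, g') \<in> K \<and> ?q dvd l (g, g')}"
  have \<Delta>_mult: "(g \<otimes>\<^bsub>G\<^esub> h, g' \<otimes>\<^bsub>H\<^esub> h') \<in> \<Delta>" if g: "(g, g') \<in> \<Delta>" and h: "(h, h') \<in> \<Delta>" for g g' h h'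
  proof -
    have K: "(g, g') \<in> K" "(h, h') \<in> K" using g h by (auto simp: \<Delta>_def)
    have "?q dvd l (g, g') + l (h, h')" using g h by (auto simp: \<Delta>_def)
    then show ?thesis using K_mult[OF K] cong_dvd_iff[OF l_mult[OF K]] by (simp add: \<Delta>_def)
  qed
  have zH: "z' [^]\<^bsub>H\<^esub> (i::int) \<in> group_center H" for i by (rule B.z_pow_center)
  have zG: "z [^]\<^bsub>G\<^esub> (i::int) \<in> group_center G" for i by (rule A.z_pow_center)
  have oneG: "\<one>\<^bsub>G\<^esub> \<in> group_center G" "\<one>\<^bsub>H\<^esub> \<in> group_center H" by (auto simp: group_center_def)
  have dl1: "[A.dlog \<one>\<^bsub>G\<^esub> = 0] (mod ?q)" "[B.dlog \<one>\<^bsub>H\<^esub> = 0] (mod ?q)"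
    using A.dlog_zero_iff[OF oneG(1)] B.dlog_zero_iff[OF oneG(2)] by (auto simp: cong_0_iff)
  have ex: "\<exists>g'. (g, g') \<in> \<Delta>" if g: "g \<in> carrier G" for g
  proof -
    obtain g' where g': "(g, g') \<in> K" using \<Gamma>_onto[OF g] \<Gamma>K by blast
    let ?c = "z' [^]\<^bsub>H\<^esub> (- l (g, g'))"
    have cS: "(\<one>\<^bsub>G\<^esub>, ?c) \<in> S" using zH oneG by (simp add: S_def)
    have "[l (\<one>\<^bsub>G\<^esub>, ?c) = B.dlog ?c - A.dlog \<one>\<^bsub>G\<^esub>] (mod ?q)" using l(2)[OF cS] by (simp add: lam_def)
    also have "[B.dlog ?c - A.dlog \<one>\<^bsub>G\<^esub> = - l (g, g') - 0] (mod ?q)" by (intro cong_diff B.dlog_pow dl1)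
    finally have lc: "[l (\<one>\<^bsub>G\<^esub>, ?c) = - l (g, g') - 0] (mod ?q)" .
    have cK: "(\<one>\<^bsub>G\<^esub>, ?c) \<in> K" using cS SsubK by blast
    have "[l (g \<otimes>\<^bsub>G\<^esub> \<one>\<^bsub>G\<^esub>, g' \<otimes>\<^bsub>H\<^esub> ?c) = l (g, g') + l (\<one>\<^bsub>G\<^esub>, ?c)] (mod ?q)" by (rule l_mult[OF g' cK])
    also have "[l (g, g') + l (\<one>\<^bsub>G\<^esub>, ?c) = l (g, g') + (- l (g, g') - 0)] (mod ?q)" by (intro cong_add cong_refl lc)
    finally have "?q dvd l (g, g' \<otimes>\<^bsub>H\<^esub> ?c)" using g by (simp add: cong_0_iff)
    moreover have "(g, g' \<otimes>\<^bsub>H\<^esub> ?c) \<in> K" using K_mult[OF g' cK] g by simp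
    ultimately show ?thesis by (auto simp: \<Delta>_def)
  qed
  have ex': "\<exists>g. (g, g') \<in> \<Delta>" if g': "g' \<in> carrier H" for g'
  proof -
    obtain g where g: "(g, g') \<in> K" using \<Gamma>_onto'[OF g'] \<Gamma>K by blast
    let ?c = "z [^]\<^bsub>G\<^esub> (l (g, g'))"
    have cS: "(?c, \<one>\<^bsub>H\<^esub>) \<in> S" using zG oneG by (simp add: S_def)
    have "[l (?c, \<one>\<^bsub>H\<^esub>) = B.dlog \<one>\<^bsub>H\<^esub> - A.dlog ?c] (mod ?q)" using l(2)[OF cS] by (simp add: lam_def)
    also have "[B.dlog \<one>\<^bsub>H\<^esub> - A.dlog ?c = 0 - l (g, g')] (mod ?q)" by (intro cong_diff A.dlog_pow dl1)
    finally have lc: "[l (?c, \<one>\<^bsub>H\<^esub>) = 0 - l (g, g')] (mod ?q)" .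
    have cK: "(?c, \<one>\<^bsub>H\<^esub>) \<in> K" using cS SsubK by blast
    have "[l (g \<otimes>\<^bsub>G\<^esub> ?c, g' \<otimes>\<^bsub>H\<^esub> \<one>\<^bsub>H\<^esub>) = l (g, g') + l (?c, \<one>\<^bsub>H\<^esub>)] (mod ?q)" by (rule l_mult[OF g cK])
    also have "[l (g, g') + l (?c, \<one>\<^bsub>H\<^esub>) = l (g, g') + (0 - l (g, g'))] (mod ?q)" by (intro cong_add cong_refl lc)
    finally have "?q dvd l (g \<otimes>\<^bsub>G\<^esub> ?c, g')" using g' by (simp add: cong_0_iff)
    moreover have "(g \<otimes>\<^bsub>G\<^esub> ?c, g') \<in> K" using K_mult[OF g cK] g' by simp
    ultimately show ?thesis by (auto simp: \<Delta>_def)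
  qed
  have \<Delta>_inv: "(inv\<^bsub>G\<^esub> g, inv\<^bsub>H\<^esub> g') \<in> \<Delta>" if g: "(g, g') \<in> \<Delta>" for g g'
  proof -
    have gK: "(g, g') \<in> K" using g by (simp add: \<Delta>_def)
    have "[l (inv\<^bsub>?K\<^esub> (g, g')) = - l (g, g')] (mod ?q)"
      by (rule K.hom_mod_inv[OF K.subgroup_self]) (use l(1) gK in auto)
    moreover have "?q dvd - l (g, g')" using g by (simp add: \<Delta>_def)
    ultimately have "?q dvd l (inv\<^bsub>G\<^esub> g, inv\<^bsub>H\<^esub> g')" unfolding invK[OF gK] using cong_dvd_iff by blast
    moreover have "(inv\<^bsub>G\<^esub> g, inv\<^bsub>H\<^esub> g') \<in> K" using subgroup.m_inv_closed[OF KP gK] invP K_sub[OF gK] by simp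
    ultimately show ?thesis by (simp add: \<Delta>_def)
  qed
  have one1: "b = \<one>\<^bsub>H\<^esub>" if b: "(\<one>\<^bsub>G\<^esub>, b) \<in> \<Delta>" for b
  proof -
    have bK: "(\<one>\<^bsub>G\<^esub>, b) \<in> K" using b by (simp add: \<Delta>_def)
    have bZ: "b \<in> group_center H"
    proof (rule B.w_zero_imp_central[OF K_sub(2)[OF bK]])
      fix u' assume "u' \<in> carrier H"
      then obtain u where u: "(u, u') \<in> \<Gamma>" using \<Gamma>_onto' by blast
      have "[0 = A.w \<one>\<^bsub>G\<^esub> u] (mod ?q)" by (rule cong_sym[OF A.w_one_left]) (rule \<Gamma>_sub(1)[OF u])
      also have "[A.w \<one>\<^bsub>G\<^esub> u = B.w b u'] (mod ?q)" by (rule K_w[OF bK u])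
      finally show "?q dvd B.w b u'" by (simp only: cong_sym_eq[of 0] cong_0_iff)
    qed
    have "[l (\<one>\<^bsub>G\<^esub>, b) = B.dlog b - A.dlog \<one>\<^bsub>G\<^esub>] (mod ?q)"
      using l(2)[of "(\<one>\<^bsub>G\<^esub>, b)"] bZ oneG by (simp add: S_def lam_def)
    also have "[B.dlog b - A.dlog \<one>\<^bsub>G\<^esub> = B.dlog b - 0] (mod ?q)" by (intro cong_diff cong_refl dl1)
    finally have "?q dvd B.dlog b" using b cong_dvd_iff by (fastforce simp: \<Delta>_def)
    then show ?thesis using B.dlog_zero_iff[OF bZ] by simp
  qed
  have one2: "a = \<one>\<^bsub>G\<^esub>" if a: "(a, \<one>\<^bsub>H\<^esub>) \<in> \<Delta>" for a
  proof -
    have aK: "(a, \<one>\<^bsub>H\<^esub>) \<in> K" using a by (simp add: \<Delta>_def)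
    have aZ: "a \<in> group_center G"
    proof (rule A.w_zero_imp_central[OF K_sub(1)[OF aK]])
      fix u assume "u \<in> carrier G"
      then obtain u' where u: "(u, u') \<in> \<Gamma>" using \<Gamma>_onto by blast
      have "[A.w a u = B.w \<one>\<^bsub>H\<^esub> u'] (mod ?q)" by (rule K_w[OF aK u])
      also have "[B.w \<one>\<^bsub>H\<^esub> u' = 0] (mod ?q)" by (rule B.w_one_left) (rule \<Gamma>_sub(2)[OF u])
      finally show "?q dvd A.w a u" by (simp only: cong_0_iff)
    qed
    have "[l (a, \<one>\<^bsub>H\<^esub>) = B.dlog \<one>\<^bsub>H\<^esub> - A.dlog a] (mod ?q)"
      using l(2)[of "(a, \<one>\<^bsub>H\<^esub>)"] aZ oneG by (simp add: S_def lam_def)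
    also have "[B.dlog \<one>\<^bsub>H\<^esub> - A.dlog a = 0 - A.dlog a] (mod ?q)" by (intro cong_diff cong_refl dl1)
    finally have "?q dvd A.dlog a" using a cong_dvd_iff by (fastforce simp: \<Delta>_def)
    then show ?thesis using A.dlog_zero_iff[OF aZ] by simp
  qed
  have \<Delta>_sub: "g \<in> carrier G" "g' \<in> carrier H" if "(g, g') \<in> \<Delta>" for g g'
    using that K_sub by (auto simp: \<Delta>_def)
  have uniq: "g' = g''" if "(g, g') \<in> \<Delta>" "(g, g'') \<in> \<Delta>" for g g' g''
  proof -
    have "(inv\<^bsub>G\<^esub> g \<otimes>\<^bsub>G\<^esub> g, inv\<^bsub>H\<^esub> g' \<otimes>\<^bsub>H\<^esub> g'') \<in> \<Delta>" by (rule \<Delta>_mult[OF \<Delta>_inv[OF that(1)] that(2)])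
    then have "inv\<^bsub>H\<^esub> g' \<otimes>\<^bsub>H\<^esub> g'' = \<one>\<^bsub>H\<^esub>" using one1 \<Delta>_sub[OF that(1)] by simp
    then show ?thesis using \<Delta>_sub[OF that(1)] \<Delta>_sub[OF that(2)] by (metis B.inv_equality B.inv_inv B.inv_closed)
  qed
  have uniq': "g = h" if "(g, g') \<in> \<Delta>" "(h, g') \<in> \<Delta>" for g h g'
  proof -
    have "(inv\<^bsub>G\<^esub> g \<otimes>\<^bsub>G\<^esub> h, inv\<^bsub>H\<^esub> g' \<otimes>\<^bsub>H\<^esub> g') \<in> \<Delta>" by (rule \<Delta>_mult[OF \<Delta>_inv[OF that(1)] that(2)])
    then have "inv\<^bsub>G\<^esub> g \<otimes>\<^bsub>G\<^esub> h = \<one>\<^bsub>G\<^esub>" using one2 \<Delta>_sub[OF that(1)] by simp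
    then show ?thesis using \<Delta>_sub[OF that(1)] \<Delta>_sub[OF that(2)] by (metis A.inv_equality A.inv_inv A.inv_closed)
  qed
  define f where "f g = (SOME g'. (g, g') \<in> \<Delta>)" for g
  have f: "(g, f g) \<in> \<Delta>" if "g \<in> carrier G" for g
    unfolding f_def by (rule someI_ex[OF ex[OF that]])
  have "f \<in> hom G H"
  proof (rule homI)
    fix g h assume g: "g \<in> carrier G" and h: "h \<in> carrier G"
    show "f g \<in> carrier H" by (rule \<Delta>_sub(2)[OF f[OF g]])
    show "f (g \<otimes>\<^bsub>G\<^esub> h) = f g \<otimes>\<^bsub>H\<^esub> f h"
      by (rule uniq[OF f[OF A.m_closed[OF g h]] \<Delta>_mult[OF f[OF g] f[OF h]]])
  qed
  moreover have "bij_betw f (carrier G) (carrier H)"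
  proof (rule bij_betw_imageI)
    show "inj_on f (carrier G)" using f uniq' by (metis inj_onI)
    show "f ` carrier G = carrier H"
    proof (intro equalityI subsetI)
      fix h assume "h \<in> carrier H"
      then obtain g where g: "(g, h) \<in> \<Delta>" using ex' by blast
      then have "f g = h" using uniq[OF f g] \<Delta>_sub(1)[OF g] by blast
      then show "h \<in> f ` carrier G" using \<Delta>_sub(1)[OF g] by blast
    qed (use f \<Delta>_sub in blast)
  qed
  ultimately show ?thesis unfolding is_iso_def iso_def by blast
qed

end

context group
begin

lemma card_of_cosets:
  assumes N: "subgroup N G" and fin: "finite (carrier G)" and R: "R \<subseteq> carrier G" "\<And>x n. x \<in> R \<Longrightarrow> n \<in> N \<Longrightarrow> x \<otimes> n \<in> R"
  shows "card R = card ((\<lambda>x. x <# N) ` R) * card N"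
proof -
  let ?E = "(\<lambda>x. x <# N) ` R"
  have NG: "N \<subseteq> carrier G" by (rule subgroup.subset[OF N])
  have sub: "x <# N \<subseteq> R" if "x \<in> R" for x using that R by (auto simp: l_coset_def)
  have un: "\<Union>?E = R"
  proof
    show "\<Union>?E \<subseteq> R" using sub by blast
    show "R \<subseteq> \<Union>?E"
    proof
      fix x assume x: "x \<in> R"
      then have "x \<in> x <# N" using R(1) by (intro lcos_self[OF _ N]) blast
      then show "x \<in> \<Union>?E" using x by blast
    qed
  qed
  have finR: "finite R" using R(1) fin finite_subset by blast
  have "card N * card ?E = card (\<Union>?E)"
  proof (rule card_partition)
    show "finite ?E" using finR by simp
    show "finite (\<Union>?E)" unfolding un by (rule finR)
    show "card c = card N" if c: "c \<in> ?E" for c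
    proof -
      obtain x where x: "x \<in> R" "c = x <# N" using c by blast
      have "c = (\<lambda>n. x \<otimes> n) ` N" unfolding x(2) l_coset_def by auto
      moreover have "inj_on (\<lambda>n. x \<otimes> n) N"
      proof (rule inj_onI)
        fix a b assume "a \<in> N" "b \<in> N" "x \<otimes> a = x \<otimes> b"
        then show "a = b" using l_cancel[of x a b] NG R(1) x(1) by blast
      qed
      ultimately show ?thesis by (simp add: card_image)
    qed
    show "c1 \<inter> c2 = {}" if c: "c1 \<in> ?E" "c2 \<in> ?E" "c1 \<noteq> c2" for c1 c2
    proof (rule ccontr)
      assume "c1 \<inter> c2 \<noteq> {}"
      then obtain t where t: "t \<in> c1" "t \<in> c2" by blast
      obtain x where x: "x \<in> R" "c1 = x <# N" using c(1) by blast
      obtain y where y: "y \<in> R" "c2 = y <# N" using c(2) by blast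
      have "x <# N = t <# N" "y <# N = t <# N"
        using l_repr_independence[of t x N] l_repr_independence[of t y N] t x y R(1) N by blast+
      then show False using c(3) x y by simp
    qed
  qed
  then show ?thesis unfolding un by (simp add: mult.commute)
qed

end

context finite_group_algebra
begin

text \<open>The relative centre interpolates between the centre of \<open>G\<close>, for trivial
  \<open>N\<close>, and \<open>G\<close> itself, for the derived subgroup.\<close>

lemma center_mod_one: "center_mod {\<one>} = group_center G"
proof -
  have "inv x \<otimes> (h \<otimes> x \<otimes> inv h) = \<one> \<longleftrightarrow> x \<otimes> h = h \<otimes> x" if "x \<in> carrier G" "h \<in> carrier G" for x h
  proof
    assume "inv x \<otimes> (h \<otimes> x \<otimes> inv h) = \<one>"
    then have "x \<otimes> (inv x \<otimes> (h \<otimes> x \<otimes> inv h)) \<otimes> h = x \<otimes> \<one> \<otimes> h" by simp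
    then show "x \<otimes> h = h \<otimes> x" using that by (simp add: m_assoc inv_mult_cancel)
  next
    assume e: "x \<otimes> h = h \<otimes> x"
    show "inv x \<otimes> (h \<otimes> x \<otimes> inv h) = \<one>" unfolding e[symmetric] using that by (simp add: m_assoc)
  qed
  then show ?thesis by (auto simp: center_mod_def group_center_def)
qed

lemma center_mod_derived: "center_mod (derived G (carrier G)) = carrier G"
proof -
  have "inv x \<otimes> (h \<otimes> x \<otimes> inv h) \<in> derived G (carrier G)" if "x \<in> carrier G" "h \<in> carrier G" for x h
  proof -
    have "inv x \<otimes> h \<otimes> inv (inv x) \<otimes> inv h \<in> derived G (carrier G)"
      unfolding derived_def by (rule generate.incl) (use that in blast)
    then show ?thesis using that by (simp add: m_assoc)
  qed
  then show ?thesis by (auto simp: center_mod_def)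
qed

lemma center_mod_sat:
  assumes N: "N \<lhd> G" and x: "x \<in> center_mod N" and n: "n \<in> N"
  shows "x \<otimes> n \<in> center_mod N"
proof -
  have sN: "subgroup N G" using N by (rule normal_imp_subgroup)
  have xG: "x \<in> carrier G" and nG: "n \<in> carrier G"
    using x n subgroup.mem_carrier[OF sN] by (auto simp: center_mod_def)
  have "inv (x \<otimes> n) \<otimes> (h \<otimes> (x \<otimes> n) \<otimes> inv h) \<in> N" if h: "h \<in> carrier G" for h
  proof -
    have "inv n \<otimes> (inv x \<otimes> (h \<otimes> x \<otimes> inv h)) \<otimes> (h \<otimes> n \<otimes> inv h) \<in> N"
    proof -
      have "inv x \<otimes> (h \<otimes> x \<otimes> inv h) \<in> N" using x h by (simp add: center_mod_def)
      from subgroup.m_closed[OF sN subgroup.m_closed[OF sN subgroup.m_inv_closed[OF sN n] this] normal_conj(1)[OF N n h]]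
      show ?thesis .
    qed
    then show ?thesis using xG nG h by (simp add: m_assoc inv_mult_group inv_mult_cancel)
  qed
  then show ?thesis using xG nG by (simp add: center_mod_def)
qed

lemma card_center_mod:
  assumes N: "N \<lhd> G"
  shows "card (center_mod N) = card ((\<lambda>x. x <# N) ` center_mod N) * card N"
  by (rule card_of_cosets[OF normal_imp_subgroup[OF N] finite_carrier _ center_mod_sat[OF N]])
     (auto simp: center_mod_def)

end

context p_group_algebra_isomorphism
begin

lemma card_center_mod_eq:
  assumes m: "matched N N'" and N: "N \<lhd> G" "N' \<lhd> H" and c: "card N = card N'"
  shows "card (A.center_mod N) = card (B.center_mod N')"
  using card_center_mod_cosets[OF m m N N subset_refl subset_refl] A.card_center_mod[OF N(1)] B.card_center_mod[OF N(2)] c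
  by simp

lemma card_center_eq: "card (group_center G) = card (group_center H)"
  using card_center_mod_eq[OF matched_one A.one_is_normal B.one_is_normal]
  by (simp add: A.center_mod_one B.center_mod_one)

lemma card_derived_eq:
  assumes "order G = order H"
  shows "card (derived G (carrier G)) = card (derived H (carrier H))"
proof -
  let ?D = "derived G (carrier G)" and ?D' = "derived H (carrier H)"
  have "card ((\<lambda>x. x <#\<^bsub>G\<^esub> ?D) ` carrier G) = card ((\<lambda>x. x <#\<^bsub>H\<^esub> ?D') ` carrier H)"
    using card_center_mod_cosets[OF matched_derived matched_derived A.derived_self_is_normal B.derived_self_is_normal
      A.derived_self_is_normal B.derived_self_is_normal subset_refl subset_refl]
    by (simp add: A.center_mod_derived B.center_mod_derived)
  moreover have "order G = card ((\<lambda>x. x <#\<^bsub>G\<^esub> ?D) ` carrier G) * card ?D"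
    using A.card_center_mod[OF A.derived_self_is_normal] by (simp add: A.center_mod_derived order_def)
  moreover have "order H = card ((\<lambda>x. x <#\<^bsub>H\<^esub> ?D') ` carrier H) * card ?D'"
    using B.card_center_mod[OF B.derived_self_is_normal] by (simp add: B.center_mod_derived order_def)
  moreover have "order G > 0" by (rule A.order_gt_0_iff_finite[THEN iffD2, OF A.finite_carrier])
  ultimately show ?thesis using assms by auto
qed

text \<open>The counts for \<open>N = 1\<close> and \<open>M\<close> the derived subgroup give
  the index of the derived subgroup in \<open>Z(G) G'\<close>. Together with the orders of
  \<open>G'\<close> and \<open>Z(G)\<close> this determines whether \<open>Z(G) G' =
  Z(G)\<close>.\<close>

lemma derived_central_transfer:
  assumes ord: "order G = order H" and D: "derived G (carrier G) \<subseteq> group_center G"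
  shows "derived H (carrier H) \<subseteq> group_center H"
proof -
  let ?D = "derived G (carrier G)" and ?D' = "derived H (carrier H)"
  have sD: "subgroup ?D G" and sD': "subgroup ?D' H"
    using A.derived_self_is_normal B.derived_self_is_normal by (auto dest: normal_imp_subgroup)
  have c: "card ((\<lambda>x. x <#\<^bsub>G\<^esub> ?D) ` group_center G) = card ((\<lambda>x. x <#\<^bsub>H\<^esub> ?D') ` group_center H)"
    using card_center_mod_cosets[OF matched_one matched_derived A.one_is_normal B.one_is_normal
      A.derived_self_is_normal B.derived_self_is_normal] subgroup.one_closed[OF sD] subgroup.one_closed[OF sD']
    by (simp add: A.center_mod_one B.center_mod_one)
  have ZG: "group_center G \<subseteq> carrier G" "group_center H \<subseteq> carrier H" by (auto simp: group_center_def)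
  have "card (group_center G) = card ((\<lambda>x. x <#\<^bsub>G\<^esub> ?D) ` group_center G) * card ?D"
    by (rule A.card_of_cosets[OF sD A.finite_carrier ZG(1)])
       (use D subgroup.m_closed[OF A.subgroup_center] in blast)
  then have cZ: "card (group_center H) = card ((\<lambda>x. x <#\<^bsub>H\<^esub> ?D') ` group_center H) * card ?D'"
    using c card_center_eq card_derived_eq[OF ord] by simp
  \<comment> \<open>This is the product of the centre and the derived subgroup of
    \<open>H\<close>.\<close>
  define R where "R = (\<Union>x\<in>group_center H. x <#\<^bsub>H\<^esub> ?D')"
  have D'H: "?D' \<subseteq> carrier H" by (rule subgroup.subset[OF sD'])
  have RH: "R \<subseteq> carrier H" unfolding R_def using ZG(2) B.l_coset_subset_G[OF D'H] by blast
  have Rsat: "x \<otimes>\<^bsub>H\<^esub> d \<in> R" if x: "x \<in> R" and d: "d \<in> ?D'" for x d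
  proof -
    obtain t where t: "t \<in> group_center H" "x \<in> t <#\<^bsub>H\<^esub> ?D'" using x unfolding R_def by blast
    obtain d0 where d0: "d0 \<in> ?D'" "x = t \<otimes>\<^bsub>H\<^esub> d0" using t(2) unfolding l_coset_def by blast
    have "x \<otimes>\<^bsub>H\<^esub> d = t \<otimes>\<^bsub>H\<^esub> (d0 \<otimes>\<^bsub>H\<^esub> d)"
      unfolding d0(2) by (rule B.m_assoc) (use t(1) d0(1) d ZG D'H in auto)
    then show ?thesis using t(1) subgroup.m_closed[OF sD' d0(1) d] unfolding R_def l_coset_def by blast
  qed
  have ZR: "group_center H \<subseteq> R"
    unfolding R_def using B.lcos_self[OF _ sD'] ZG(2) by blast
  have img: "(\<lambda>x. x <#\<^bsub>H\<^esub> ?D') ` R = (\<lambda>x. x <#\<^bsub>H\<^esub> ?D') ` group_center H"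
  proof
    show "(\<lambda>x. x <#\<^bsub>H\<^esub> ?D') ` group_center H \<subseteq> (\<lambda>x. x <#\<^bsub>H\<^esub> ?D') ` R" using ZR by (rule image_mono)
    show "(\<lambda>x. x <#\<^bsub>H\<^esub> ?D') ` R \<subseteq> (\<lambda>x. x <#\<^bsub>H\<^esub> ?D') ` group_center H"
    proof
      fix E assume "E \<in> (\<lambda>x. x <#\<^bsub>H\<^esub> ?D') ` R"
      then obtain x t where x: "E = x <#\<^bsub>H\<^esub> ?D'" "t \<in> group_center H" "x \<in> t <#\<^bsub>H\<^esub> ?D'" unfolding R_def by blast
      have "t <#\<^bsub>H\<^esub> ?D' = x <#\<^bsub>H\<^esub> ?D'"
        by (rule B.l_repr_independence[OF x(3) _ sD']) (use x(2) ZG in blast)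
      then show "E \<in> (\<lambda>x. x <#\<^bsub>H\<^esub> ?D') ` group_center H" using x by blast
    qed
  qed
  have "card R = card (group_center H)"
    unfolding cZ img[symmetric] by (rule B.card_of_cosets[OF sD' B.finite_carrier RH Rsat])
  then have "group_center H = R"
    using card_subset_eq[OF finite_subset[OF RH B.finite_carrier] ZR] by simp
  moreover have "?D' \<subseteq> R"
  proof
    fix d assume d: "d \<in> ?D'"
    have "\<one>\<^bsub>H\<^esub> \<in> R" using ZR subgroup.one_closed[OF B.subgroup_center] by blast
    from Rsat[OF this d] show "d \<in> R" using d D'H by auto
  qed
  ultimately show ?thesis by simp
qed

lemma center_power_transfer:
  "(\<forall>x\<in>group_center G. x [^]\<^bsub>G\<^esub> (p ^ k) = \<one>\<^bsub>G\<^esub>) \<longleftrightarrow> (\<forall>x\<in>group_center H. x [^]\<^bsub>H\<^esub> (p ^ k) = \<one>\<^bsub>H\<^esub>)"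
  using center_mod_power_transfer[OF matched_one A.one_is_normal B.one_is_normal, of k]
  by (simp add: A.center_mod_one B.center_mod_one)

end

context cyclic_center_class_two
begin

lemma mem_generate_z_pow:
  "c \<in> generate G {z [^] (k::nat)} \<longleftrightarrow> (\<exists>i::int. c = z [^] (int k * i))"
  using z_carrier by (auto simp: generate_pow int_pow_pow int_pow_int[symmetric])

lemma z_pow_normal:
  "generate G {z [^] (k::nat)} \<lhd> G" "x \<in> carrier G \<Longrightarrow> c \<in> generate G {z [^] k} \<Longrightarrow> c \<otimes> x = x \<otimes> c"
proof -
  have cz: "generate G {z [^] k} \<subseteq> group_center G"
    using mem_generate_z_pow z_pow_center by auto
  then show "c \<otimes> x = x \<otimes> c" if "x \<in> carrier G" "c \<in> generate G {z [^] k}"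
    using center_commute that by blast
  have s: "subgroup (generate G {z [^] k}) G" using z_carrier by (simp add: generate_is_subgroup)
  have "x \<otimes> c \<otimes> inv x = c" if "x \<in> carrier G" "c \<in> generate G {z [^] k}" for x c
  proof -
    have cG: "c \<in> carrier G" using cz that(2) center_carrier by blast
    have "x \<otimes> c = c \<otimes> x" using center_commute[OF subsetD[OF cz that(2)] that(1)] by simp
    then show ?thesis using that(1) cG by (simp add: m_assoc)
  qed
  then show "generate G {z [^] k} \<lhd> G" using s by (simp add: normal_inv_iff)
qed

text \<open>Membership of \<open>x\<close> in the \<open>p^k\<close>-torsion says that all
  commutators \<open>[x, h]\<close> are killed by \<open>p^k\<close>, that is, that they lie in
  the subgroup of order \<open>p^k\<close> of the cyclic centre.\<close>

lemma tors_eq_center_mod: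
  assumes k: "k \<le> n"
  shows "tors (carrier G) k = {x \<in> carrier G. \<forall>h\<in>carrier G. inv x \<otimes> (h \<otimes> x \<otimes> inv h) \<in> generate G {z [^] (p ^ (n - k))}}"
proof -
  have dvd_iff: "z [^] (i::int) \<in> generate G {z [^] (p ^ (n - k))} \<longleftrightarrow> int p ^ n dvd int p ^ k * i" for i
  proof -
    have "z [^] i \<in> generate G {z [^] (p ^ (n - k))} \<longleftrightarrow> (\<exists>j. [i = int p ^ (n - k) * j] (mod int p ^ n))"
      unfolding mem_generate_z_pow z_pow_eq by simp
    also have "\<dots> \<longleftrightarrow> int p ^ (n - k) dvd i"
    proof
      assume "\<exists>j. [i = int p ^ (n - k) * j] (mod int p ^ n)"
      then obtain j where "[i = int p ^ (n - k) * j] (mod int p ^ n)" by blast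
      then have "[i = int p ^ (n - k) * j] (mod int p ^ (n - k))"
        by (rule cong_dvd_modulus) (simp add: le_imp_power_dvd)
      then show "int p ^ (n - k) dvd i" using cong_dvd_iff by (metis dvd_triv_left)
    next
      assume "int p ^ (n - k) dvd i"
      then obtain j where "i = int p ^ (n - k) * j" by blast
      then show "\<exists>j. [i = int p ^ (n - k) * j] (mod int p ^ n)" by (intro exI[of _ j]) simp
    qed
    also have "\<dots> \<longleftrightarrow> int p ^ n dvd int p ^ k * i"
      by (rule prime_power_dvd_cancel[OF p_pos(1) k, symmetric])
    finally show ?thesis .
  qed
  have "x \<in> tors (carrier G) k \<longleftrightarrow> (\<forall>h\<in>carrier G. inv x \<otimes> (h \<otimes> x \<otimes> inv h) \<in> generate G {z [^] (p ^ (n - k))})"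
    if x: "x \<in> carrier G" for x
  proof -
    have "inv x \<otimes> (h \<otimes> x \<otimes> inv h) \<in> generate G {z [^] (p ^ (n - k))} \<longleftrightarrow> int p ^ n dvd int p ^ k * w x h"
      if h: "h \<in> carrier G" for h
    proof -
      have "inv x \<otimes> (h \<otimes> x \<otimes> inv h) = comm (inv x) h" using x h by (simp add: comm_def m_assoc)
      also have "\<dots> = z [^] w (inv x) h" using x h by (simp add: w_def z_dlog comm_central)
      finally have "inv x \<otimes> (h \<otimes> x \<otimes> inv h) \<in> generate G {z [^] (p ^ (n - k))} \<longleftrightarrow> int p ^ n dvd int p ^ k * w (inv x) h"
        using dvd_iff by simp
      also have "\<dots> \<longleftrightarrow> int p ^ n dvd int p ^ k * (- w x h)"
        by (intro cong_dvd_iff cong_mult cong_refl w_inv_left x h)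
      finally show ?thesis by simp
    qed
    then show ?thesis using x by (simp add: tors_def)
  qed
  then show ?thesis using tors_subset[of "carrier G" k] by blast
qed

end

context cyclic_center_class_two
begin

lemma card_generate_z_pow:
  assumes "k \<le> n"
  shows "card (generate G {z [^] (p ^ (n - k))}) = p ^ k"
proof -
  have "ord (z [^] (p ^ (n - k))) = p ^ n div p ^ (n - k)"
    using ord_pow[OF z_carrier, of "p ^ (n - k)"] p_pos by (simp add: ord_z le_imp_power_dvd)
  also have "\<dots> = p ^ k" using assms p_pos by (simp add: power_diff[symmetric])
  finally show ?thesis using generate_pow_card[of "z [^] (p ^ (n - k))"] z_carrier by simp
qed

text \<open>A cyclic group has only one subgroup of each order; this is used for the derived
  subgroup.\<close>

lemma central_subgroup_eq:
  assumes D: "subgroup D G" "D \<subseteq> group_center G" and card: "card D = p ^ m"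
  shows "m \<le> n" "D = generate G {z [^] (p ^ (n - m))}"
proof -
  have Z: "group_center G = generate G {z [^] (p ^ (n - n))}"
    using mem_generate_z_pow[of _ 1] center_gen z_pow_center by fastforce
  have cZ: "card (group_center G) = p ^ n" unfolding Z by (rule card_generate_z_pow) simp
  have finZ: "finite (group_center G)" using finite_subset[OF _ finite_G] by (auto simp: group_center_def)
  have "p ^ m \<le> p ^ n" using card_mono[OF finZ D(2)] card cZ by simp
  then show m: "m \<le> n" using p_pos by (simp add: power_increasing_iff)
  have "D \<subseteq> generate G {z [^] (p ^ (n - m))}"
  proof
    fix c assume c: "c \<in> D"
    interpret D: group "G\<lparr>carrier := D\<rparr>" by (rule subgroup_imp_group[OF D(1)])
    have "c [^]\<^bsub>G\<lparr>carrier := D\<rparr>\<^esub> order (G\<lparr>carrier := D\<rparr>) = \<one>"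
      using D.pow_order_eq_1[of c] c by simp
    then have "c [^] (p ^ m) = \<one>" using card nat_pow_consistent[of c] by (simp add: order_def)
    moreover obtain i :: int where i: "c = z [^] i" using center_gen c D(2) by blast
    ultimately have "z [^] (i * int (p ^ m)) = \<one>"
      using int_pow_pow[OF z_carrier, of i "int (p ^ m)"] by (simp only: int_pow_int)
    then have "int p ^ n dvd int p ^ m * i" unfolding z_pow_one by (simp add: mult.commute)
    then have "int p ^ (n - m) dvd i" using prime_power_dvd_cancel[OF p_pos(1) m] by blast
    then show "c \<in> generate G {z [^] (p ^ (n - m))}"
      unfolding mem_generate_z_pow i by auto
  qed
  moreover have "finite (generate G {z [^] (p ^ (n - m))})"
    using finite_subset[OF generate_incl finite_G] z_carrier by simp
  ultimately show "D = generate G {z [^] (p ^ (n - m))}"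
    using card card_generate_z_pow[OF m] by (simp add: card_subset_eq)
qed

lemma derived_central: "derived G (carrier G) \<subseteq> group_center G"
  unfolding derived_def
proof (rule generate_subgroup_incl[OF _ subgroup_center])
  show "derived_set G (carrier G) \<subseteq> group_center G"
    using comm_central by (auto simp: comm_def)
qed

end

text \<open>Let \<open>p^m\<close> be the common order of the derived subgroups. For \<open>k
  \<le> m\<close> the \<open>p^k\<close>-torsion is the centre modulo the subgroup of order
  \<open>p^k\<close> of the derived subgroup; these subgroups are matched, being generated by
  \<open>p\<close>-powers of a generator. For \<open>k \<ge> m\<close> the torsion is the whole
  group. All numerical data of the forms are thus transported by the isomorphism of algebras.\<close>

lemma (in p_group_algebra_isomorphism) iso_of_cyclic_centers:
  assumes CG: "cyclic_center_class_two G p n z" and CH: "cyclic_center_class_two H p n z'"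
    and ord: "order G = order H"
  shows "G \<cong> H"
proof -
  interpret CG: cyclic_center_class_two G p n z by (rule CG)
  interpret CH: cyclic_center_class_two H p n z' by (rule CH)
  interpret C: cyclic_center_pair G H p n z z' by (simp add: cyclic_center_pair_def CG CH)
  let ?D = "derived G (carrier G)" and ?D' = "derived H (carrier H)"
  have sD: "subgroup ?D G" and sD': "subgroup ?D' H"
    using A.derived_self_is_normal B.derived_self_is_normal by (auto dest: normal_imp_subgroup)
  have "card ?D dvd p ^ e"
    using A.lagrange[OF sD] A.order_p_power by (metis dvd_triv_right)
  then obtain m where cD: "card ?D = p ^ m" using divides_primepow_nat[OF CG.prime_p] by blast
  then have cD': "card ?D' = p ^ m" using card_derived_eq[OF ord] by simp
  note DG = CG.central_subgroup_eq[OF sD CG.derived_central cD]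
  note DH = CH.central_subgroup_eq[OF sD' CH.derived_central cD']
  have mn: "m \<le> n" by (rule DG(1))
  let ?N = "\<lambda>k. generate G {z [^]\<^bsub>G\<^esub> (p ^ (n - k))}" and ?N' = "\<lambda>k. generate H {z' [^]\<^bsub>H\<^esub> (p ^ (n - k))}"
  have cm: "A.center_mod N = {x \<in> carrier G. \<forall>h\<in>carrier G. inv\<^bsub>G\<^esub> x \<otimes>\<^bsub>G\<^esub> (h \<otimes>\<^bsub>G\<^esub> x \<otimes>\<^bsub>G\<^esub> inv\<^bsub>G\<^esub> h) \<in> N}" for N
    by (rule A.center_mod_def)
  have cm': "B.center_mod N = {x \<in> carrier H. \<forall>h\<in>carrier H. inv\<^bsub>H\<^esub> x \<otimes>\<^bsub>H\<^esub> (h \<otimes>\<^bsub>H\<^esub> x \<otimes>\<^bsub>H\<^esub> inv\<^bsub>H\<^esub> h) \<in> N}" for N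
    by (rule B.center_mod_def)
  have tG: "CG.tors (carrier G) k = A.center_mod (?N k)" and tH: "CH.tors (carrier H) k = B.center_mod (?N' k)"
    if "k \<le> m" for k
    using CG.tors_eq_center_mod[of k] CH.tors_eq_center_mod[of k] that mn by (simp_all add: cm cm')
  have top: "CG.tors (carrier G) k = carrier G" "CH.tors (carrier H) k = carrier H" if "m \<le> k" for k
  proof -
    have "CG.tors (carrier G) m = carrier G" "CH.tors (carrier H) m = carrier H"
      using tG[of m] tH[of m] A.center_mod_derived B.center_mod_derived by (simp_all flip: DG(2) DH(2))
    then show "CG.tors (carrier G) k = carrier G" "CH.tors (carrier H) k = carrier H"
      using CG.tors_mono[OF that, of "carrier G"] CH.tors_mono[OF that, of "carrier H"]
        CG.tors_subset[of "carrier G" k] CH.tors_subset[of "carrier H" k] by auto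
  qed
  have matchedN: "matched (?N k) (?N' k)" if k: "k \<le> m" for k
  proof -
    have "p ^ (n - m) * p ^ (m - k) = p ^ (n - k)" using k mn by (simp add: power_add[symmetric])
    then have eq: "(z [^]\<^bsub>G\<^esub> (p ^ (n - m))) [^]\<^bsub>G\<^esub> (p ^ (m - k)) = z [^]\<^bsub>G\<^esub> (p ^ (n - k))"
      "(z' [^]\<^bsub>H\<^esub> (p ^ (n - m))) [^]\<^bsub>H\<^esub> (p ^ (m - k)) = z' [^]\<^bsub>H\<^esub> (p ^ (n - k))"
      by (simp_all add: A.nat_pow_pow[OF CG.z_carrier] B.nat_pow_pow[OF CH.z_carrier])
    have m0: "matched (?N m) (?N' m)"
      using matched_derived by (simp flip: DG(2) DH(2))
    have "matched (generate G {(z [^]\<^bsub>G\<^esub> (p ^ (n - m))) [^]\<^bsub>G\<^esub> (p ^ (m - k))})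
       (generate H {(z' [^]\<^bsub>H\<^esub> (p ^ (n - m))) [^]\<^bsub>H\<^esub> (p ^ (m - k))})"
    proof (rule matched_generate_pow[OF _ _ _ _ m0])
      show "z [^]\<^bsub>G\<^esub> (p ^ (n - m)) \<in> carrier G" "z' [^]\<^bsub>H\<^esub> (p ^ (n - m)) \<in> carrier H"
        using CG.z_carrier CH.z_carrier by auto
      show "z [^]\<^bsub>G\<^esub> (p ^ (n - m)) \<otimes>\<^bsub>G\<^esub> x = x \<otimes>\<^bsub>G\<^esub> z [^]\<^bsub>G\<^esub> (p ^ (n - m))" if "x \<in> carrier G" for x
        by (rule CG.z_pow_normal(2)[OF that]) (rule generate.incl, simp)
      show "z' [^]\<^bsub>H\<^esub> (p ^ (n - m)) \<otimes>\<^bsub>H\<^esub> x = x \<otimes>\<^bsub>H\<^esub> z' [^]\<^bsub>H\<^esub> (p ^ (n - m))" if "x \<in> carrier H" for x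
        by (rule CH.z_pow_normal(2)[OF that]) (rule generate.incl, simp)
    qed
    then show ?thesis unfolding eq .
  qed
  have cards: "card (CG.tors (carrier G) k) = card (CH.tors (carrier H) k)" for k
  proof (cases "k \<le> m")
    case True
    then have "k \<le> n" using mn by simp
    then have "card (?N k) = card (?N' k)" by (simp add: CG.card_generate_z_pow CH.card_generate_z_pow)
    then show ?thesis unfolding tG[OF True] tH[OF True]
      by (rule card_center_mod_eq[OF matchedN[OF True] CG.z_pow_normal(1) CH.z_pow_normal(1)])
  next
    case False
    then show ?thesis using top[of k] ord by (simp add: order_def)
  qed
  have low: "(\<forall>c\<in>CG.tors (carrier G) k. int p ^ n dvd int p ^ l * CG.\<chi> c) \<longleftrightarrow>
      (\<forall>c\<in>CH.tors (carrier H) k. int p ^ n dvd int p ^ l * CH.\<chi> c)" if k: "k \<le> m" for k l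
  proof -
    have exG: "c [^]\<^bsub>G\<^esub> (p ^ (n + l)) = \<one>\<^bsub>G\<^esub>" if "c \<in> ?N k" for c
    proof -
      have "c \<in> group_center G" using that CG.mem_generate_z_pow CG.z_pow_center by auto
      then show ?thesis
        using CG.center_pow_pn A.nat_pow_pow[of c "p ^ n" "p ^ l"] CG.center_carrier by (simp add: power_add)
    qed
    have exH: "c [^]\<^bsub>H\<^esub> (p ^ (n + l)) = \<one>\<^bsub>H\<^esub>" if "c \<in> ?N' k" for c
    proof -
      have "c \<in> group_center H" using that CH.mem_generate_z_pow CH.z_pow_center by auto
      then show ?thesis
        using CH.center_pow_pn B.nat_pow_pow[of c "p ^ n" "p ^ l"] CH.center_carrier by (simp add: power_add)
    qed
    have "(\<forall>c\<in>CG.tors (carrier G) k. int p ^ n dvd int p ^ l * CG.\<chi> c) \<longleftrightarrow>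
       (\<forall>c\<in>CG.tors (carrier G) k. c [^]\<^bsub>G\<^esub> (p ^ (n + l)) = \<one>\<^bsub>G\<^esub>)"
      using CG.chi_pow_one_iff CG.tors_subset by blast
    also have "\<dots> \<longleftrightarrow> (\<forall>c\<in>CH.tors (carrier H) k. c [^]\<^bsub>H\<^esub> (p ^ (n + l)) = \<one>\<^bsub>H\<^esub>)"
      unfolding tG[OF k] tH[OF k]
      by (rule center_mod_power_transfer[OF matchedN[OF k] CG.z_pow_normal(1) CH.z_pow_normal(1)
          CG.z_pow_normal(2) CH.z_pow_normal(2) exG exH])
    also have "\<dots> \<longleftrightarrow> (\<forall>c\<in>CH.tors (carrier H) k. int p ^ n dvd int p ^ l * CH.\<chi> c)"
      using CH.chi_pow_one_iff CH.tors_subset by blast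
    finally show ?thesis .
  qed
  have inv: "(\<forall>c\<in>CG.tors (carrier G) k. int p ^ n dvd int p ^ l * CG.\<chi> c) \<longleftrightarrow>
      (\<forall>c\<in>CH.tors (carrier H) k. int p ^ n dvd int p ^ l * CH.\<chi> c)" for k l
  proof (cases "k \<le> m")
    case False
    then have "CG.tors (carrier G) k = CG.tors (carrier G) m" "CH.tors (carrier H) k = CH.tors (carrier H) m"
      using top[of k] top[of m] by auto
    then show ?thesis using low[of m l] by simp
  qed (rule low)
  have "\<exists>\<Gamma>. C.isometry n (carrier G) (carrier H) \<Gamma>"
  proof (rule C.isometry_exists[OF A.subgroup_self B.subgroup_self])
    show "int p ^ n dvd CG.\<chi> c" if "c \<in> CG.tors (carrier G) 0" for c
      using that by (intro CG.chi_rad) (auto simp: CG.tors_def)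
    show "int p ^ n dvd CH.\<chi> c" if "c \<in> CH.tors (carrier H) 0" for c
      using that by (intro CH.chi_rad) (auto simp: CH.tors_def)
    show "card (CG.tors (carrier G) k) * card (CH.tors (carrier H) 0) =
        card (CH.tors (carrier H) k) * card (CG.tors (carrier G) 0)" for k
      using cards by simp
  qed (rule inv)
  then show ?thesis using C.iso_of_isometry by blast
qed

lemma (in group) class_two_derived_central:
  assumes "has_nilpotency_class G 2"
  shows "derived G (carrier G) \<subseteq> group_center G" "derived G (carrier G) \<noteq> {\<one>}"
proof -
  have D: "lower_central_series G 1 = derived G (carrier G)"
    by (simp add: commutator_subgroup_def derived_def)
  have "\<forall>m<2. lower_central_series G m \<noteq> {\<one>}" using assms unfolding has_nilpotency_class_def by blast
  from this[rule_format, of 1] show "derived G (carrier G) \<noteq> {\<one>}" unfolding D by simp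
  have triv: "commutator_subgroup G (derived G (carrier G)) (carrier G) = {\<one>}"
    using assms D by (simp add: has_nilpotency_class_def numeral_2_eq_2)
  have c1: "c \<otimes> x \<otimes> inv c \<otimes> inv x = \<one>" if "c \<in> derived G (carrier G)" "x \<in> carrier G" for c x
  proof -
    have "c \<otimes> x \<otimes> inv c \<otimes> inv x \<in> commutator_subgroup G (derived G (carrier G)) (carrier G)"
      unfolding commutator_subgroup_def by (rule generate.incl) (use that in blast)
    then show ?thesis unfolding triv by simp
  qed
  show "derived G (carrier G) \<subseteq> group_center G"
  proof
    fix c assume c: "c \<in> derived G (carrier G)"
    have cG: "c \<in> carrier G" using c derived_in_carrier[of "carrier G"] by blast
    have "c \<otimes> x = x \<otimes> c" if x: "x \<in> carrier G" for x
    proof -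
      have "c \<otimes> x \<otimes> inv c \<otimes> inv x \<otimes> x \<otimes> c = \<one> \<otimes> x \<otimes> c" by (simp only: c1[OF c x])
      then show ?thesis using cG x by (simp add: m_assoc inv_mult_cancel)
    qed
    then show "c \<in> group_center G" using cG by (simp add: group_center_def)
  qed
qed

lemma (in group) cyclic_center_generator:
  assumes "cyclic_group (G\<lparr>carrier := group_center G\<rparr>)"
  obtains z where "z \<in> group_center G" "group_center G = generate G {z}"
proof -
  interpret Z: group "G\<lparr>carrier := group_center G\<rparr>" by (rule subgroup_imp_group[OF subgroup_center])
  obtain z where z: "z \<in> group_center G" "group_center G = range (\<lambda>i::int. z [^]\<^bsub>G\<lparr>carrier := group_center G\<rparr>\<^esub> i)"
    using assms unfolding Z.cyclic_group by auto
  have "z \<in> carrier G" using z(1) by (simp add: group_center_def)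
  then have "generate G {z} = range (\<lambda>i::int. z [^] i)" unfolding generate_pow[OF \<open>z \<in> carrier G\<close>] by blast
  also have "\<dots> = range (\<lambda>i::int. z [^]\<^bsub>G\<lparr>carrier := group_center G\<rparr>\<^esub> i)"
    by (intro image_cong refl int_pow_consistent[OF subgroup_center z(1)])
  also have "\<dots> = group_center G" by (rule z(2)[symmetric])
  finally show thesis by (intro that[OF z(1)]) (rule sym)
qed

lemma (in group) cyclic_center_class_twoI:
  assumes "finite (carrier G)" "Factorial_Ring.prime p" "odd p" "z \<in> group_center G"
    and Z: "group_center G = generate G {z}" and ord: "ord z = p ^ n"
    and D: "derived G (carrier G) \<subseteq> group_center G"
  shows "cyclic_center_class_two G p n z"
proof
  have zG: "z \<in> carrier G" using assms(4) by (simp add: group_center_def)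
  show "\<exists>i::int. x = z [^] i" if "x \<in> group_center G" for x
    using that zG unfolding Z by (auto simp: generate_pow)
  show "comm x y \<in> group_center G" if "x \<in> carrier G" "y \<in> carrier G" for x y
  proof -
    have "comm x y \<in> derived G (carrier G)"
      unfolding derived_def comm_def by (rule generate.incl) (use that in blast)
    then show ?thesis using D by blast
  qed
qed (use assms in auto)

text \<open>It remains to see that \<open>Z(H)\<close> is cyclic of the same order
  \<open>p^n\<close> as \<open>Z(G)\<close>. The orders agree, and since the power
  \<open>p^(n-1)\<close> does not kill \<open>Z(G)\<close>, it does not kill
  \<open>Z(H)\<close>; so \<open>Z(H)\<close> contains an element of order \<open>p^n\<close>.\<close>

theorem theorem1p1:
  fixes p :: nat
    and G :: "('g, 'm) monoid_scheme"
    and H :: "('h, 'n) monoid_scheme"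
  assumes "Factorial_Ring.prime p" and "odd p"
    and "CHAR('f::field) = p"
    and "finite_p_group p G"
    and "has_nilpotency_class G 2"
    and "cyclic_group (G\<lparr>carrier := group_center G\<rparr>)"
    and "group H"
    and "is_algebra_iso (group_algebra TYPE('f) G) (group_algebra TYPE('f) H)"
  shows "G \<cong> H"
proof -
  obtain e where G: "group G" "finite (carrier G)" "order G = p ^ e"
    using assms(4) by (auto simp: finite_p_group_def)
  obtain \<phi> where "\<phi> \<in> algebra_iso (group_algebra TYPE('f) G) (group_algebra TYPE('f) H)"
    using assms(8) by (auto simp: is_algebra_iso_def)
  then have \<phi>: "algebra_isomorphism G H TYPE('f) \<phi>" by (simp add: algebra_isomorphism_def)
  have finH: "finite (carrier H)" by (rule algebra_isomorphism.finite_H[OF \<phi> G(2)])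
  have "card (carrier H) \<le> card (carrier G)"
    by (rule algebra_isomorphism.card_le_of_finite[OF \<phi> G(2) subset_refl finH])
  moreover have "card (carrier G) \<le> card (carrier H)"
    by (rule algebra_isomorphism.card_le_of_finite[OF algebra_isomorphism_inverse[OF \<phi> G(1,2)] finH subset_refl G(2)])
  ultimately have ord: "order G = order H" by (simp add: order_def)
  interpret I: p_group_algebra_isomorphism G H "TYPE('f)" \<phi> p e e
    using assms(1,3,7) G finH ord \<phi>
    by (simp add: p_group_algebra_isomorphism_def p_group_algebra_def p_group_algebra_axioms_def
      finite_group_algebra_def finite_group_algebra_axioms_def)
  obtain z where z: "z \<in> group_center G" "group_center G = generate G {z}"
    using I.A.cyclic_center_generator[OF assms(6)] by blast
  have zG: "z \<in> carrier G" using z(1) by (simp add: group_center_def)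
  have cZ: "card (group_center G) = group.ord G z"
    using I.A.generate_pow_card[OF zG] z(2) by simp
  have "group.ord G z dvd p ^ e" using I.A.ord_dvd_group_order[OF zG] G(3) by simp
  then obtain n where n: "group.ord G z = p ^ n" using divides_primepow_nat[OF assms(1)] by blast
  note D = I.A.class_two_derived_central[OF assms(5)]
  have n0: "n \<noteq> 0"
  proof
    assume "n = 0"
    then have "card (group_center G) = 1" using cZ n by simp
    then obtain a where "group_center G = {a}" by (auto simp: card_1_singleton_iff)
    then have "group_center G = {\<one>\<^bsub>G\<^esub>}" using subgroup.one_closed[OF I.A.subgroup_center] by auto
    moreover have "\<one>\<^bsub>G\<^esub> \<in> derived G (carrier G)"
      unfolding derived_def by (rule generate.one)
    ultimately show False using D by auto
  qed
  have CG: "cyclic_center_class_two G p n z"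
    by (rule I.A.cyclic_center_class_twoI[OF G(2) assms(1,2) z n D(1)])
  have "\<not> p ^ n dvd p ^ (n - 1)"
  proof
    assume "p ^ n dvd p ^ (n - 1)"
    then have "n \<le> n - 1" by (rule power_dvd_imp_le) (rule prime_gt_1_nat[OF assms(1)])
    then show False using n0 by simp
  qed
  then have "z [^]\<^bsub>G\<^esub> (p ^ (n - 1)) \<noteq> \<one>\<^bsub>G\<^esub>"
    unfolding I.A.pow_eq_id[OF zG, of "p ^ (n - 1)"] n .
  then obtain z' where z': "z' \<in> group_center H" "z' [^]\<^bsub>H\<^esub> (p ^ (n - 1)) \<noteq> \<one>\<^bsub>H\<^esub>"
    using I.center_power_transfer[of "n - 1"] z(1) by blast
  have z'H: "z' \<in> carrier H" using z'(1) by (simp add: group_center_def)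
  have sub: "generate H {z'} \<subseteq> group_center H"
    by (rule I.B.generate_subgroup_incl[OF _ I.B.subgroup_center]) (use z'(1) in simp)
  have finZH: "finite (group_center H)" using finite_subset[OF _ finH] by (auto simp: group_center_def)
  have cZH: "card (group_center H) = p ^ n" using I.card_center_eq cZ n by simp
  have "group.ord H z' = card (generate H {z'})" by (rule I.B.generate_pow_card[OF z'H])
  also have "card (generate H {z'}) dvd card (group_center H)"
  proof -
    interpret Z: group "H\<lparr>carrier := group_center H\<rparr>" by (rule I.B.subgroup_imp_group[OF I.B.subgroup_center])
    have sZ: "subgroup (generate H {z'}) (H\<lparr>carrier := group_center H\<rparr>)"
      by (rule I.B.subgroup_incl[OF I.B.generate_is_subgroup I.B.subgroup_center sub]) (use z'H in simp)
    have "card (generate H {z'}) dvd order (H\<lparr>carrier := group_center H\<rparr>)"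
      unfolding Z.lagrange[OF sZ, symmetric] by (rule dvd_triv_right)
    then show ?thesis by (simp add: order_def)
  qed
  finally have "group.ord H z' dvd p ^ n" using cZH by simp
  then obtain k where k: "k \<le> n" "group.ord H z' = p ^ k" using divides_primepow_nat[OF assms(1)] by blast
  have "k = n"
  proof (rule ccontr)
    assume "k \<noteq> n"
    then have "p ^ k dvd p ^ (n - 1)" using k(1) by (intro le_imp_power_dvd) simp
    then show False using z'(2) I.B.pow_eq_id[OF z'H, of "p ^ (n - 1)"] k(2) by simp
  qed
  then have n': "group.ord H z' = p ^ n" using k(2) by simp
  have "group_center H = generate H {z'}"
    using card_subset_eq[OF finZH sub] cZH n' I.B.generate_pow_card[OF z'H] by simp
  then have CH: "cyclic_center_class_two H p n z'"
    by (rule I.B.cyclic_center_class_twoI[OF finH assms(1,2) z'(1) _ n' I.derived_central_transfer[OF ord D(1)]])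
  show ?thesis by (rule I.iso_of_cyclic_centers[OF CG CH ord])
qed

end
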